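(* Let $H$ be a discrete regular Fourier hypergroup. Then the following conditions are equivalent. (i) $A(H)$ has a $1$-bounded approximate identity. (ii) $A(H)$ has a $D$-bounded approximate identity for some $D\ge 1$. (iii) $H$ satisfies $(P_2)$.
   Context: A hypergroup is a locally compact Hausdorff space $H$ with an associative bilinear convolution $*$ on the bounded Radon measures $M(H)$ such that: each $\delta_x*\delta_y$ is a probability measure with compact support; $(x,y)\mapsto\delta_x*\delta_y$ is continuous for the weak topology on probability measures; $(x,y)\mapsto\operatorname{supp}(\delta_x*\delta_y)$ is continuous into the compact subsets of $H$ with the Michael topology; there is an identity $e$ with $\delta_e*\delta_x=\delta_x=\delta_x*\delta_e$; there is a homeomorphic involution $x\mapsto\tilde x$ with $(\delta_x*\delta_y)^{\sim}=\delta_{\tilde y}*\delta_{\tilde x}$; and $e\in\operatorname{supp}(\delta_x*\delta_y)$ iff $x=\tilde y$. It is discrete if its topology is discrete. Put $L_xf(y)=\int f\,d(\delta_{\tilde x}*\delta_y)$. $\lambda$ denotes a left Haar measure, i.e. a nonzero Radon measure with $\lambda(L_xf)=\lambda(f)$ for $f\in C_c(H)$, $x\in H$ (it is assumed to exist; it always does for discrete $H$). $L^p(H)=L^p(H,\lambda)$, and $f*_\lambda g(x)=\int_H f(t)\,L_tg(x)\,d\lambda(t)$. For $f\in L^1(H)$ let $\lambda_f(\xi)=f*_\lambda\xi$ on $L^2(H)$; $\mathrm{VN}(H)\subseteq\mathcal B(L^2(H))$ is the von Neumann algebra generated by $\{\lambda_f:f\in L^1(H)\}$. The Fourier space $A(H)$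 is the Banach space of continuous functions on $H$ that is the closed linear span of $\{\xi*_\lambda\tilde\xi:\xi\in L^2(H)\}$, $\tilde\xi(x)=\overline{\xi(\tilde x)}$, inside the Fourier–Stieltjes space of $H$. Equivalently, it is the predual of $\mathrm{VN}(H)$: $u\in A(H)$ iff there is a normal functional $\varphi_u$ on $\mathrm{VN}(H)$ with $\varphi_u(\lambda_f)=\int_H fu\,d\lambda$ for all $f\in L^1(H)$, and $\|u\|_{A(H)}=\|\varphi_u\|$. $H$ is a regular Fourier hypergroup if $A(H)$ with pointwise multiplication and this norm is a Banach algebra. A $D$-bounded approximate identity of $A(H)$ is a net $(e_\alpha)$ in $A(H)$ with $\|e_\alpha\|_{A(H)}\le D$ and $\|e_\alpha u-u\|_{A(H)}\to0$ for all $u\in A(H)$. $H$ satisfies $(P_2)$ if for every $\epsilon>0$ and compact $K\subseteq H$ there is $\xi\in L^2(H)$ with $\xi\ge0$, $\|\xi\|_2=1$ and $\|\delta_x*\xi-\xi\|_2<\epsilon$ for all $x\in K$, where $\delta_x*\xi=L_x\xi$. *)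

theory Defs
  imports "HOL-Probability.Probability"
begin

section \<open>Radon measures\<close>

text \<open>
  The underlying space is a type \<open>'a\<close> with its topology.  Positive measures are
  Isabelle measures on the Borel sets; complex measures are set functions
  \<open>'a set \<Rightarrow> complex\<close> that vanish outside the Borel sets.
\<close>

definition radon_measure :: "'a::topological_space measure \<Rightarrow> bool" where
  "radon_measure M \<longleftrightarrow>
     sets M = sets borel \<and>
     (\<forall>K. compact K \<longrightarrow> emeasure M K < \<infinity>) \<and>
     (\<forall>A\<in>sets borel. emeasure M A = (INF U\<in>{U. open U \<and> A \<subseteq> U}. emeasure M U)) \<and>
     (\<forall>U. open U \<longrightarrow> emeasure M U = (SUP K\<in>{K. compact K \<and> K \<subseteq> U}. emeasure M K))"

definition cmeasure_of :: "'a measure \<Rightarrow> 'a set \<Rightarrow> complex" where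
  "cmeasure_of M = (\<lambda>A. complex_of_real (measure M A))"

text \<open>\<open>M(H)\<close>: the complex linear span of the finite positive Radon measures.\<close>

definition bounded_radon :: "('a::topological_space set \<Rightarrow> complex) set" where
  "bounded_radon = {\<mu>. \<exists>a b c d.
     (\<forall>M\<in>{a, b, c, d}. radon_measure M \<and> finite_measure M) \<and>
     \<mu> = (\<lambda>A. cmeasure_of a A - cmeasure_of b A + \<i> * (cmeasure_of c A - cmeasure_of d A))}"

definition point_mass :: "'a::topological_space \<Rightarrow> 'a set \<Rightarrow> complex" where
  "point_mass x = cmeasure_of (return borel x)"

definition msupport :: "'a::topological_space measure \<Rightarrow> 'a set" where
  "msupport M = {x. \<forall>U. open U \<and> x \<in> U \<longrightarrow> emeasure M U > 0}"

definition radon_prob :: "'a::topological_space measure set" where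
  "radon_prob = {M. radon_measure M \<and> prob_space M}"

definition weak_topology :: "'a::topological_space measure topology" where
  "weak_topology = topology_generated_by
     {{M \<in> radon_prob. integral\<^sup>L M f \<in> U} |f (U :: real set).
        continuous_on UNIV f \<and> bounded (range f) \<and> open U}"

definition michael_topology :: "'a::topological_space set topology" where
  "michael_topology = topology_generated_by
     {{K. compact K \<and> K \<inter> U \<noteq> {} \<and> K \<subseteq> V} |U V. open U \<and> open V}"


section \<open>Hypergroups\<close>

type_synonym 'a convolution = "('a set \<Rightarrow> complex) \<Rightarrow> ('a set \<Rightarrow> complex) \<Rightarrow> ('a set \<Rightarrow> complex)"

text \<open>
  \<open>\<delta>\<^sub>x * \<delta>\<^sub>y\<close> as an Isabelle measure.  For a hypergroup the convolution of point
  masses is a positive set function, so that passing to real parts loses nothing.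
\<close>

definition pconv :: "'a::topological_space convolution \<Rightarrow> 'a \<Rightarrow> 'a \<Rightarrow> 'a measure" where
  "pconv conv x y = measure_of UNIV (sets borel)
     (\<lambda>A. ennreal (Re (conv (point_mass x) (point_mass y) A)))"

locale hypergroup =
  fixes conv :: "'a::t2_space convolution"
    and tilde :: "'a \<Rightarrow> 'a"
    and e :: 'a
  assumes locally_compact: "locally_compact_space (euclidean :: 'a topology)"
    and conv_closed: "\<lbrakk>\<mu> \<in> bounded_radon; \<nu> \<in> bounded_radon\<rbrakk> \<Longrightarrow> conv \<mu> \<nu> \<in> bounded_radon"
    and conv_linear_left: "\<lbrakk>\<mu> \<in> bounded_radon; \<nu> \<in> bounded_radon; \<rho> \<in> bounded_radon\<rbrakk> \<Longrightarrow>
      conv (\<lambda>A. c * \<mu> A + \<nu> A) \<rho> = (\<lambda>A. c * conv \<mu> \<rho> A + conv \<nu> \<rho> A)"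
    and conv_linear_right: "\<lbrakk>\<mu> \<in> bounded_radon; \<nu> \<in> bounded_radon; \<rho> \<in> bounded_radon\<rbrakk> \<Longrightarrow>
      conv \<rho> (\<lambda>A. c * \<mu> A + \<nu> A) = (\<lambda>A. c * conv \<rho> \<mu> A + conv \<rho> \<nu> A)"
    and conv_assoc: "\<lbrakk>\<mu> \<in> bounded_radon; \<nu> \<in> bounded_radon; \<rho> \<in> bounded_radon\<rbrakk> \<Longrightarrow>
      conv (conv \<mu> \<nu>) \<rho> = conv \<mu> (conv \<nu> \<rho>)"
    and conv_prob: "\<exists>M\<in>radon_prob. compact (msupport M) \<and>
      conv (point_mass x) (point_mass y) = cmeasure_of M"
    and conv_continuous: "continuous_map euclidean weak_topology (\<lambda>(x, y). pconv conv x y)"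
    and supp_continuous:
      "continuous_map euclidean michael_topology (\<lambda>(x, y). msupport (pconv conv x y))"
    and identity_left: "conv (point_mass e) (point_mass x) = point_mass x"
    and identity_right: "conv (point_mass x) (point_mass e) = point_mass x"
    and tilde_continuous: "continuous_on UNIV tilde"
    and tilde_tilde: "tilde (tilde x) = x"
    and tilde_conv: "distr (pconv conv x y) borel tilde = pconv conv (tilde y) (tilde x)"
    and supp_identity: "e \<in> msupport (pconv conv x y) \<longleftrightarrow> x = tilde y"

locale discrete_hypergroup = hypergroup conv tilde e
  for conv :: "'a::t2_space convolution" and tilde :: "'a \<Rightarrow> 'a" and e :: 'a +
  assumes discrete: "(euclidean :: 'a topology) = discrete_topology UNIV"

definition ltrans ::
    "'a::topological_space convolution \<Rightarrow> ('a \<Rightarrow> 'a) \<Rightarrow> 'a \<Rightarrow> ('a \<Rightarrow> complex) \<Rightarrow> 'a \<Rightarrow> complex" where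
  "ltrans conv tilde x f y = integral\<^sup>L (pconv conv (tilde x) y) f"

definition left_haar_measure ::
    "'a::topological_space convolution \<Rightarrow> ('a \<Rightarrow> 'a) \<Rightarrow> 'a measure \<Rightarrow> bool" where
  "left_haar_measure conv tilde lam \<longleftrightarrow>
     radon_measure lam \<and> emeasure lam UNIV \<noteq> 0 \<and>
     (\<forall>f x. continuous_on UNIV f \<and> compact (closure {t. f t \<noteq> 0}) \<longrightarrow>
        integral\<^sup>L lam (ltrans conv tilde x f) = integral\<^sup>L lam f)"


section \<open>Von Neumann algebras on \<open>L\<^sup>2\<close>\<close>

text \<open>
  Elements of \<open>L\<^sup>2\<close> are handled through representing functions, and equality in
  \<open>L\<^sup>2\<close> is equality almost everywhere.  Accordingly an operator is a map on
  functions of which only the values, modulo null functions, on square-integrable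
  functions matter.
\<close>

definition L2 :: "'a measure \<Rightarrow> ('a \<Rightarrow> complex) set" where
  "L2 M = {f \<in> borel_measurable M. integrable M (\<lambda>x. (cmod (f x))\<^sup>2)}"

definition l2_norm :: "'a measure \<Rightarrow> ('a \<Rightarrow> complex) \<Rightarrow> real" where
  "l2_norm M f = sqrt (\<integral>x. (cmod (f x))\<^sup>2 \<partial>M)"

definition l2_inner :: "'a measure \<Rightarrow> ('a \<Rightarrow> complex) \<Rightarrow> ('a \<Rightarrow> complex) \<Rightarrow> complex" where
  "l2_inner M f g = (\<integral>x. f x * cnj (g x) \<partial>M)"

type_synonym 'a operator = "('a \<Rightarrow> complex) \<Rightarrow> 'a \<Rightarrow> complex"

text \<open>
  Linearity almost everywhere and boundedness together make such a map compatible
  with equality almost everywhere.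
\<close>

definition bounded_ops :: "'a measure \<Rightarrow> 'a operator set" where
  "bounded_ops M = {T. (\<forall>\<xi>\<in>L2 M. T \<xi> \<in> L2 M) \<and>
     (\<forall>\<xi>\<in>L2 M. \<forall>\<eta>\<in>L2 M. \<forall>c. AE x in M. T (\<lambda>t. c * \<xi> t + \<eta> t) x = c * T \<xi> x + T \<eta> x) \<and>
     (\<exists>C. \<forall>\<xi>\<in>L2 M. l2_norm M (T \<xi>) \<le> C * l2_norm M \<xi>)}"

definition op_norm :: "'a measure \<Rightarrow> 'a operator \<Rightarrow> real" where
  "op_norm M T = Sup {l2_norm M (T \<xi>) |\<xi>. \<xi> \<in> L2 M \<and> l2_norm M \<xi> \<le> 1}"

definition commutant :: "'a measure \<Rightarrow> 'a operator set \<Rightarrow> 'a operator set" where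
  "commutant M S =
     {T \<in> bounded_ops M. \<forall>R\<in>S. \<forall>\<xi>\<in>L2 M. AE x in M. T (R \<xi>) x = R (T \<xi>) x}"

definition is_adjoint :: "'a measure \<Rightarrow> 'a operator \<Rightarrow> 'a operator \<Rightarrow> bool" where
  "is_adjoint M T R \<longleftrightarrow> (\<forall>\<xi>\<in>L2 M. \<forall>\<eta>\<in>L2 M. l2_inner M (T \<xi>) \<eta> = l2_inner M \<xi> (R \<eta>))"

definition von_neumann_algebra :: "'a measure \<Rightarrow> 'a operator set \<Rightarrow> bool" where
  "von_neumann_algebra M N \<longleftrightarrow> N \<subseteq> bounded_ops M \<and>
     (\<forall>T\<in>N. \<forall>R\<in>bounded_ops M. is_adjoint M T R \<longrightarrow> R \<in> N) \<and>
     commutant M (commutant M N) = N"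

definition vn_generated :: "'a measure \<Rightarrow> 'a operator set \<Rightarrow> 'a operator set" where
  "vn_generated M S = \<Inter> {N. von_neumann_algebra M N \<and> S \<subseteq> N}"

definition ultraweak_topology :: "'a measure \<Rightarrow> 'a operator topology" where
  "ultraweak_topology M = topology_generated_by
     {{T \<in> bounded_ops M. (\<Sum>n. l2_inner M (T (\<xi> n)) (\<eta> n)) \<in> U}
        |(\<xi> :: nat \<Rightarrow> 'a \<Rightarrow> complex) (\<eta> :: nat \<Rightarrow> 'a \<Rightarrow> complex) U.
        (\<forall>n. \<xi> n \<in> L2 M \<and> \<eta> n \<in> L2 M) \<and>
        summable (\<lambda>n. (l2_norm M (\<xi> n))\<^sup>2) \<and> summable (\<lambda>n. (l2_norm M (\<eta> n))\<^sup>2) \<and> open U}"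

definition normal_functional ::
    "'a measure \<Rightarrow> 'a operator set \<Rightarrow> ('a operator \<Rightarrow> complex) \<Rightarrow> bool" where
  "normal_functional M N \<phi> \<longleftrightarrow>
     (\<forall>S\<in>N. \<forall>T\<in>N. \<forall>c. \<phi> (\<lambda>\<xi> x. c * S \<xi> x + T \<xi> x) = c * \<phi> S + \<phi> T) \<and>
     continuous_map (subtopology (ultraweak_topology M) N) euclidean \<phi>"

definition functional_norm ::
    "'a measure \<Rightarrow> 'a operator set \<Rightarrow> ('a operator \<Rightarrow> complex) \<Rightarrow> real" where
  "functional_norm M N \<phi> = Sup {cmod (\<phi> T) |T. T \<in> N \<and> op_norm M T \<le> 1}"


section \<open>The Fourier space of a hypergroup\<close>

text \<open>\<open>hconv conv tilde lam f g\<close> is \<open>f *\<^sub>\<lambda> g\<close>, and \<open>hconv conv tilde lam f\<close> is the operator \<open>\<lambda>\<^sub>f\<close>.\<close>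

definition hconv ::
    "'a::topological_space convolution \<Rightarrow> ('a \<Rightarrow> 'a) \<Rightarrow> 'a measure \<Rightarrow> ('a \<Rightarrow> complex) \<Rightarrow> 'a operator" where
  "hconv conv tilde lam f g x = (\<integral>t. f t * ltrans conv tilde t g x \<partial>lam)"

definition VN :: "'a::topological_space convolution \<Rightarrow> ('a \<Rightarrow> 'a) \<Rightarrow> 'a measure \<Rightarrow> 'a operator set" where
  "VN conv tilde lam = vn_generated lam {hconv conv tilde lam f |f. integrable lam f}"

definition represents ::
    "'a::topological_space convolution \<Rightarrow> ('a \<Rightarrow> 'a) \<Rightarrow> 'a measure \<Rightarrow>
      ('a operator \<Rightarrow> complex) \<Rightarrow> ('a \<Rightarrow> complex) \<Rightarrow> bool" where
  "represents conv tilde lam \<phi> u \<longleftrightarrow>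
     normal_functional lam (VN conv tilde lam) \<phi> \<and>
     (\<forall>f. integrable lam f \<longrightarrow> \<phi> (hconv conv tilde lam f) = (\<integral>x. f x * u x \<partial>lam))"

text \<open>
  Boundedness of \<open>u\<close> (the Fourier space sits inside the Fourier--Stieltjes space, which
  consists of bounded continuous functions) makes \<open>f u\<close> integrable for all integrable \<open>f\<close>.
\<close>

definition fourier_space ::
    "'a::topological_space convolution \<Rightarrow> ('a \<Rightarrow> 'a) \<Rightarrow> 'a measure \<Rightarrow> ('a \<Rightarrow> complex) set" where
  "fourier_space conv tilde lam =
     {u. continuous_on UNIV u \<and> bounded (range u) \<and> (\<exists>\<phi>. represents conv tilde lam \<phi> u)}"

text \<open>
  The normal functional \<open>\<phi>\<^sub>u\<close> representing \<open>u\<close> is unique on \<open>VN(H)\<close>, as the operators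
  \<open>\<lambda>\<^sub>f\<close> are ultraweakly dense; the infimum is that of the singleton of its norm.  As a
  total function, \<open>\<phi>\<^sub>u\<close> is determined on \<open>VN(H)\<close> only, so it is not named by a definite
  description.
\<close>

definition fourier_norm ::
    "'a::topological_space convolution \<Rightarrow> ('a \<Rightarrow> 'a) \<Rightarrow> 'a measure \<Rightarrow> ('a \<Rightarrow> complex) \<Rightarrow> real" where
  "fourier_norm conv tilde lam u =
     Inf {functional_norm lam (VN conv tilde lam) \<phi> |\<phi>. represents conv tilde lam \<phi> u}"

definition function_banach_algebra ::
    "('a \<Rightarrow> complex) set \<Rightarrow> (('a \<Rightarrow> complex) \<Rightarrow> real) \<Rightarrow> bool" where
  "function_banach_algebra B nrm \<longleftrightarrow>
     (\<lambda>x. 0) \<in> B \<and>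
     (\<forall>u\<in>B. \<forall>v\<in>B. \<forall>c. (\<lambda>x. c * u x + v x) \<in> B) \<and>
     (\<forall>u\<in>B. \<forall>v\<in>B. (\<lambda>x. u x * v x) \<in> B) \<and>
     (\<forall>u\<in>B. nrm u = 0 \<longleftrightarrow> u = (\<lambda>x. 0)) \<and>
     (\<forall>u\<in>B. \<forall>c. nrm (\<lambda>x. c * u x) = cmod c * nrm u) \<and>
     (\<forall>u\<in>B. \<forall>v\<in>B. nrm (\<lambda>x. u x + v x) \<le> nrm u + nrm v) \<and>
     (\<forall>u\<in>B. \<forall>v\<in>B. nrm (\<lambda>x. u x * v x) \<le> nrm u * nrm v) \<and>
     (\<forall>s :: nat \<Rightarrow> 'a \<Rightarrow> complex. (\<forall>n. s n \<in> B) \<and>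
        (\<forall>\<epsilon>>0. \<exists>N. \<forall>m\<ge>N. \<forall>n\<ge>N. nrm (\<lambda>x. s m x - s n x) < \<epsilon>) \<longrightarrow>
        (\<exists>u\<in>B. (\<lambda>n. nrm (\<lambda>x. s n x - u x)) \<longlonglongrightarrow> 0))"

definition regular_fourier ::
    "'a::topological_space convolution \<Rightarrow> ('a \<Rightarrow> 'a) \<Rightarrow> 'a measure \<Rightarrow> bool" where
  "regular_fourier conv tilde lam \<longleftrightarrow>
     function_banach_algebra (fourier_space conv tilde lam) (fourier_norm conv tilde lam)"

text \<open>
  Nets are rendered as proper filters on the function space: a net gives its
  eventuality filter, and every proper filter arises from a net in this way.
\<close>

definition has_bai ::
    "'a::topological_space convolution \<Rightarrow> ('a \<Rightarrow> 'a) \<Rightarrow> 'a measure \<Rightarrow> real \<Rightarrow> bool" where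
  "has_bai conv tilde lam D \<longleftrightarrow>
     (\<exists>F :: ('a \<Rightarrow> complex) filter. F \<noteq> bot \<and>
        eventually (\<lambda>v. v \<in> fourier_space conv tilde lam \<and> fourier_norm conv tilde lam v \<le> D) F \<and>
        (\<forall>u\<in>fourier_space conv tilde lam.
           ((\<lambda>v. fourier_norm conv tilde lam (\<lambda>x. v x * u x - u x)) \<longlongrightarrow> 0) F))"

definition property_P2 ::
    "'a::topological_space convolution \<Rightarrow> ('a \<Rightarrow> 'a) \<Rightarrow> 'a measure \<Rightarrow> bool" where
  "property_P2 conv tilde lam \<longleftrightarrow>
     (\<forall>\<epsilon>>0. \<forall>K. compact K \<longrightarrow>
        (\<exists>\<xi> :: 'a \<Rightarrow> real. (\<forall>t. \<xi> t \<ge> 0) \<and>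
           (let \<xi>' = (\<lambda>t. complex_of_real (\<xi> t)) in
             \<xi>' \<in> L2 lam \<and> l2_norm lam \<xi>' = 1 \<and>
             (\<forall>x\<in>K. l2_norm lam (\<lambda>t. ltrans conv tilde x \<xi>' t - \<xi>' t) < \<epsilon>))))"

end

theory Submission
  imports Defs
begin

text \<open>
  On a discrete hypergroup the left translations \<open>L\<^sub>t\<close> are given by finitely supported stochastic
  kernels, and \<open>L\<^sub>s L\<^sub>t\<close> is a convex combination of the \<open>L\<^sub>u\<close> with \<open>u\<close> in the support of
  \<open>\<delta>\<^sub>s * \<delta>\<^sub>t\<close>.

  (iii) implies (i): for \<open>\<xi>\<close> as in \<open>(P\<^sub>2)\<close> the coefficients \<open>t \<mapsto> \<langle>L\<^sub>t \<xi>, \<xi>\<rangle>\<close> lie in the unit ball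
  of \<open>A(H)\<close> and tend to 1 pointwise.  Since \<open>A(H)\<close> is a Banach algebra in which the finitely
  supported functions are dense, they form an approximate identity.

  (ii) implies (iii): let \<open>T = \<Sum>\<^sub>t p\<^sub>t L\<^sub>t\<close> with finitely supported probability weights.  Every power
  of \<open>T\<close> is again of this form.  A \<open>D\<close>-bounded approximate identity tends to 1 pointwise, and pairing
  it with \<open>T\<^sup>n\<close> gives \<open>1 \<le> D \<parallel>T\<parallel>\<^sup>n\<close> for all \<open>n\<close>, so \<open>\<parallel>T\<parallel> = 1\<close>.  An almost norming unit vector may
  be replaced by its absolute value \<open>\<xi>\<close>; then the contractions \<open>L\<^sub>t \<xi>\<close> have an average of norm almost
  1, so by uniform convexity they are all close to each other, and to \<open>L\<^sub>e \<xi> = \<xi>\<close>.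
\<close>

section \<open>Square-integrable functions\<close>

text \<open>The algebra \<open>VN\<close> is given as an intersection of bicommutants, which says
  little about its individual members. Density of the finitely supported functions is therefore
  obtained on the predual side: an ultraweakly continuous functional is a finite combination of
  series of vector functionals, and these are limits, uniformly on the unit ball, of functionals
  built from finitely supported vectors, whose coefficients are finitely supported functions. The
  hypergroup may be uncountable, so Radon measures are controlled by inner regularity through finite
  sets, and operators are tested on finitely supported vectors. The Haar measure enters through
  \<open>w y * coef a y x = w x * coef (tilde a) x y\<close>, which makes translations contractions
  of L2. The fixed constant \<open>D\<close> is harmless because it cannot offset the decay of the
  powers of a number below 1; positivity and total weight 1 of the averages are what make every
  power pair with a function near 1 to a number near 1.\<close>

lemma L2_integrable: "f \<in> L2 M \<Longrightarrow> integrable M (\<lambda>x. (cmod (f x))\<^sup>2)"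
  by (simp add: L2_def)

lemma l2_norm_nonneg [simp]: "0 \<le> l2_norm M f"
  by (simp add: l2_norm_def)

lemma l2_norm_sq: "(l2_norm M f)\<^sup>2 = (\<integral>x. (cmod (f x))\<^sup>2 \<partial>M)"
  by (simp add: l2_norm_def)

lemma L2_zero [simp]: "(\<lambda>x. 0) \<in> L2 M"
  by (simp add: L2_def)

lemma l2_norm_zero [simp]: "l2_norm M (\<lambda>x. 0) = 0"
  by (simp add: l2_norm_def)

lemma l2_norm_scale: "l2_norm M (\<lambda>x. c * f x) = cmod c * l2_norm M f"
  by (simp add: l2_norm_def norm_mult power_mult_distrib real_sqrt_mult)

lemma L2_lin:
  assumes "f \<in> L2 M" "g \<in> L2 M"
  shows "(\<lambda>x. c * f x + g x) \<in> L2 M"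
proof -
  have m: "(\<lambda>x. c * f x + g x) \<in> borel_measurable M"
    using assms by (auto simp: L2_def)
  have "integrable M (\<lambda>x. 2 * ((cmod c)\<^sup>2 * (cmod (f x))\<^sup>2) + 2 * (cmod (g x))\<^sup>2)"
    using assms by (auto simp: L2_def)
  then have "integrable M (\<lambda>x. (cmod (c * f x + g x))\<^sup>2)"
  proof (rule Bochner_Integration.integrable_bound)
    show "AE x in M. norm ((cmod (c * f x + g x))\<^sup>2)
        \<le> norm (2 * ((cmod c)\<^sup>2 * (cmod (f x))\<^sup>2) + 2 * (cmod (g x))\<^sup>2)"
    proof (rule AE_I2)
      fix x
      have "(cmod (c * f x + g x))\<^sup>2 \<le> (cmod c * cmod (f x) + cmod (g x))\<^sup>2"
        by (rule power_mono) (metis norm_mult norm_triangle_ineq, simp)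
      also have "\<dots> \<le> 2 * (cmod c * cmod (f x))\<^sup>2 + 2 * (cmod (g x))\<^sup>2"
        by (smt (verit) sum_squares_bound power2_sum)
      finally show "norm ((cmod (c * f x + g x))\<^sup>2)
          \<le> norm (2 * ((cmod c)\<^sup>2 * (cmod (f x))\<^sup>2) + 2 * (cmod (g x))\<^sup>2)"
        by (simp add: power_mult_distrib)
    qed
  qed (use m in measurable)
  with m show ?thesis by (simp add: L2_def)
qed

lemma L2_scale: "f \<in> L2 M \<Longrightarrow> (\<lambda>x. c * f x) \<in> L2 M"
  using L2_lin[of f M "\<lambda>x. 0" c] by simp

lemma L2_diff: "f \<in> L2 M \<Longrightarrow> g \<in> L2 M \<Longrightarrow> (\<lambda>x. f x - g x) \<in> L2 M"
  using L2_lin[of g M f "-1"] by (simp add: algebra_simps)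

lemma L2_mult_integrable:
  assumes "f \<in> L2 M" "g \<in> L2 M"
  shows "integrable M (\<lambda>x. cmod (f x) * cmod (g x))"
proof -
  have "integrable M (\<lambda>x. (cmod (f x))\<^sup>2 + (cmod (g x))\<^sup>2)"
    using assms by (auto simp: L2_def)
  then show ?thesis
  proof (rule Bochner_Integration.integrable_bound)
    show "AE x in M. norm (cmod (f x) * cmod (g x)) \<le> norm ((cmod (f x))\<^sup>2 + (cmod (g x))\<^sup>2)"
    proof (rule AE_I2)
      fix x
      have "2 * (cmod (f x) * cmod (g x)) \<le> (cmod (f x))\<^sup>2 + (cmod (g x))\<^sup>2"
        using sum_squares_bound[of "cmod (f x)" "cmod (g x)"] by simp
      moreover have "0 \<le> cmod (f x) * cmod (g x)" by simp
      ultimately show "norm (cmod (f x) * cmod (g x)) \<le> norm ((cmod (f x))\<^sup>2 + (cmod (g x))\<^sup>2)"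
        unfolding real_norm_def by linarith
    qed
  qed (use assms in \<open>auto simp: L2_def\<close>)
qed

text \<open>\<open>L2\<close> is a set of representing functions, so Cauchy-Schwarz is derived by
  hand: the integral of the square of s |f| - |g| is a nonnegative quadratic in s, and s = I / A
  minimises it.\<close>

lemma l2_Holder:
  assumes "f \<in> L2 M" "g \<in> L2 M"
  shows "(\<integral>x. cmod (f x) * cmod (g x) \<partial>M) \<le> l2_norm M f * l2_norm M g"
proof -
  define A B I where "A = (\<integral>x. (cmod (f x))\<^sup>2 \<partial>M)" and "B = (\<integral>x. (cmod (g x))\<^sup>2 \<partial>M)"
    and "I = (\<integral>x. cmod (f x) * cmod (g x) \<partial>M)"
  note int = L2_integrable[OF assms(1)] L2_integrable[OF assms(2)] L2_mult_integrable[OF assms]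
  have q: "0 \<le> s\<^sup>2 * A - 2 * s * I + B" for s :: real
  proof -
    have "0 \<le> (\<integral>x. (s * cmod (f x) - cmod (g x))\<^sup>2 \<partial>M)" by simp
    also have "\<dots> = (\<integral>x. s\<^sup>2 * (cmod (f x))\<^sup>2 - (2 * s) * (cmod (f x) * cmod (g x)) + (cmod (g x))\<^sup>2 \<partial>M)"
      by (simp add: power2_eq_square algebra_simps)
    also have "\<dots> = s\<^sup>2 * A - 2 * s * I + B"
      using int by (simp add: A_def B_def I_def)
    finally show ?thesis .
  qed
  have A0: "A \<ge> 0" and B0: "B \<ge> 0" and I0: "I \<ge> 0" by (simp_all add: A_def B_def I_def)
  have "I \<le> sqrt (A * B)"
  proof (cases "A = 0")
    case True
    have "I = 0"
    proof (rule ccontr)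
      assume "I \<noteq> 0"
      with I0 have "I > 0" by simp
      \<comment> \<open>For A = 0 the quadratic is B - 2 s I, and this s makes it equal to - B - 2 <
        0.\<close>
      with q[of "(B + 1) / I"] True B0 show False by simp
    qed
    with True show ?thesis by simp
  next
    case False
    with A0 have "A > 0" by simp
    have "0 \<le> (I / A)\<^sup>2 * A - 2 * (I / A) * I + B" by (rule q)
    also have "\<dots> = B - I\<^sup>2 / A" using \<open>A > 0\<close> by (simp add: field_simps power2_eq_square)
    finally have "I\<^sup>2 \<le> A * B" using \<open>A > 0\<close> by (simp add: field_simps)
    then show ?thesis by (rule real_le_rsqrt)
  qed
  then show ?thesis by (simp add: A_def B_def I_def l2_norm_def real_sqrt_mult)
qed

lemma L2_inner_integrable:
  assumes "f \<in> L2 M" "g \<in> L2 M"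
  shows "integrable M (\<lambda>x. f x * cnj (g x))"
proof (rule Bochner_Integration.integrable_bound[OF L2_mult_integrable[OF assms]])
  show "(\<lambda>x. f x * cnj (g x)) \<in> borel_measurable M"
    using assms by (auto simp: L2_def intro!: borel_measurable_times
        borel_measurable_continuous_on[OF continuous_on_cnj[OF continuous_on_id]])
qed (simp add: norm_mult)

lemma l2_Cauchy_Schwarz:
  assumes "f \<in> L2 M" "g \<in> L2 M"
  shows "cmod (l2_inner M f g) \<le> l2_norm M f * l2_norm M g"
proof -
  have "cmod (l2_inner M f g) \<le> (\<integral>x. cmod (f x * cnj (g x)) \<partial>M)"
    unfolding l2_inner_def by (rule integral_norm_bound)
  also have "\<dots> = (\<integral>x. cmod (f x) * cmod (g x) \<partial>M)" by (simp add: norm_mult)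
  also have "\<dots> \<le> l2_norm M f * l2_norm M g" by (rule l2_Holder[OF assms])
  finally show ?thesis .
qed

lemma l2_inner_lin_left:
  assumes "f \<in> L2 M" "g \<in> L2 M" "h \<in> L2 M"
  shows "l2_inner M (\<lambda>x. c * f x + g x) h = c * l2_inner M f h + l2_inner M g h"
proof -
  have "l2_inner M (\<lambda>x. c * f x + g x) h = (\<integral>x. c * (f x * cnj (h x)) + g x * cnj (h x) \<partial>M)"
    by (simp add: l2_inner_def algebra_simps)
  then show ?thesis using L2_inner_integrable[OF assms(1,3)] L2_inner_integrable[OF assms(2,3)]
    by (simp add: l2_inner_def)
qed

lemma l2_inner_diff_left:
  assumes "f \<in> L2 M" "g \<in> L2 M" "h \<in> L2 M"
  shows "l2_inner M (\<lambda>x. f x - g x) h = l2_inner M f h - l2_inner M g h"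
  using l2_inner_lin_left[OF assms(2,1,3), of "-1"] by (simp add: algebra_simps)

lemma l2_inner_diff_right:
  assumes "f \<in> L2 M" "g \<in> L2 M" "h \<in> L2 M"
  shows "l2_inner M h (\<lambda>x. f x - g x) = l2_inner M h f - l2_inner M h g"
  using L2_inner_integrable[OF assms(3,1)] L2_inner_integrable[OF assms(3,2)]
  by (simp add: l2_inner_def algebra_simps)

lemma l2_norm_triangle:
  assumes "f \<in> L2 M" "g \<in> L2 M"
  shows "l2_norm M (\<lambda>x. f x + g x) \<le> l2_norm M f + l2_norm M g"
proof -
  note int = L2_integrable[OF assms(1)] L2_integrable[OF assms(2)] L2_mult_integrable[OF assms]
  have L: "(\<lambda>x. f x + g x) \<in> L2 M" using L2_lin[OF assms, of 1] by simp
  have "(l2_norm M (\<lambda>x. f x + g x))\<^sup>2 \<le>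
      (\<integral>x. (cmod (f x))\<^sup>2 + 2 * (cmod (f x) * cmod (g x)) + (cmod (g x))\<^sup>2 \<partial>M)"
    unfolding l2_norm_sq
  proof (rule integral_mono)
    fix x
    have "(cmod (f x + g x))\<^sup>2 \<le> (cmod (f x) + cmod (g x))\<^sup>2"
      by (intro power_mono norm_triangle_ineq) simp
    then show "(cmod (f x + g x))\<^sup>2 \<le> (cmod (f x))\<^sup>2 + 2 * (cmod (f x) * cmod (g x)) + (cmod (g x))\<^sup>2"
      by (simp add: power2_sum)
  qed (use int L2_integrable[OF L] in auto)
  also have "\<dots> = (l2_norm M f)\<^sup>2 + 2 * (\<integral>x. cmod (f x) * cmod (g x) \<partial>M) + (l2_norm M g)\<^sup>2"
    using int by (simp add: l2_norm_sq)
  also have "\<dots> \<le> (l2_norm M f + l2_norm M g)\<^sup>2"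
    using l2_Holder[OF assms] by (simp add: power2_sum)
  finally show ?thesis by (rule power2_le_imp_le) simp
qed

lemma l2_norm_mono:
  assumes "g \<in> L2 M" "f \<in> borel_measurable M" "\<And>x. cmod (f x) \<le> cmod (g x)"
  shows "f \<in> L2 M" "l2_norm M f \<le> l2_norm M g"
proof -
  have "integrable M (\<lambda>x. (cmod (f x))\<^sup>2)"
    by (rule Bochner_Integration.integrable_bound[OF L2_integrable[OF assms(1)]])
       (use assms in \<open>auto intro!: power_mono\<close>)
  then show "f \<in> L2 M" using assms by (simp add: L2_def)
  show "l2_norm M f \<le> l2_norm M g"
    unfolding l2_norm_def using assms \<open>f \<in> L2 M\<close>
    by (intro real_sqrt_le_mono integral_mono power_mono) (auto simp: L2_def)
qed

section \<open>Measures on discrete spaces\<close>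

text \<open>Strictly positive weights leave no nonempty null set, so equality almost everywhere is
  plain equality (\<open>AE_iff\<close>) and an element of L2 has only one representing function.
  The type may be uncountable.\<close>

locale discrete_measure =
  fixes M :: "'a measure" and w :: "'a \<Rightarrow> real"
  assumes density: "M = density (count_space UNIV) (\<lambda>x. ennreal (w x))"
    and w_pos: "\<And>x. 0 < w x"
begin

lemma sets_M [simp, measurable_cong]: "sets M = UNIV"
  by (simp add: density)

lemma space_M [simp]: "space M = UNIV"
  by (simp add: density)

lemma measurable_M [simp]: "f \<in> borel_measurable M"
  by (simp add: measurable_def)

lemma w_nonneg [simp]: "0 \<le> w x"
  using w_pos[of x] by simp

lemma w_nz [simp]: "w x \<noteq> 0"
  using w_pos[of x] by simp

lemma integrable_iff:
  fixes f :: "'a \<Rightarrow> 'b::{banach, second_countable_topology}"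
  shows "integrable M f \<longleftrightarrow> (\<lambda>x. norm (w x *\<^sub>R f x)) summable_on UNIV"
proof -
  have "integrable M f \<longleftrightarrow> integrable (count_space UNIV) (\<lambda>x. w x *\<^sub>R f x)"
    unfolding density by (subst integrable_density) auto
  also have "\<dots> \<longleftrightarrow> Infinite_Set_Sum.abs_summable_on (\<lambda>x. w x *\<^sub>R f x) UNIV"
    by (simp add: Infinite_Set_Sum.abs_summable_on_def)
  finally show ?thesis by (simp only: abs_summable_equivalent[symmetric])
qed

lemma integral_infsum:
  fixes f :: "'a \<Rightarrow> 'b::{banach, second_countable_topology}"
  assumes "integrable M f"
  shows "integral\<^sup>L M f = (\<Sum>\<^sub>\<infinity>x. w x *\<^sub>R f x)"
proof -
  have "integral\<^sup>L M f = integral\<^sup>L (count_space UNIV) (\<lambda>x. w x *\<^sub>R f x)"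
    unfolding density by (subst integral_density) auto
  also have "\<dots> = infsetsum (\<lambda>x. w x *\<^sub>R f x) UNIV"
    by (simp add: infsetsum_def)
  also have "\<dots> = (\<Sum>\<^sub>\<infinity>x. w x *\<^sub>R f x)"
    using assms by (intro infsetsum_infsum) (simp add: integrable_iff abs_summable_equivalent[symmetric])
  finally show ?thesis .
qed

lemma
  fixes f :: "'a \<Rightarrow> 'b::{banach, second_countable_topology}"
  assumes "finite F" "\<And>x. x \<notin> F \<Longrightarrow> f x = 0"
  shows integrable_finite: "integrable M f"
    and integral_finite: "integral\<^sup>L M f = (\<Sum>x\<in>F. w x *\<^sub>R f x)"
proof -
  have "(\<lambda>x. norm (w x *\<^sub>R f x)) summable_on F"
    using assms(1) by simp
  then have "(\<lambda>x. norm (w x *\<^sub>R f x)) summable_on UNIV"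
    by (rule summable_on_cong_neutral[THEN iffD1, rotated 3]) (use assms in auto)
  then show i: "integrable M f" by (simp add: integrable_iff)
  have "(\<Sum>\<^sub>\<infinity>x. w x *\<^sub>R f x) = (\<Sum>\<^sub>\<infinity>x\<in>F. w x *\<^sub>R f x)"
    by (rule infsum_cong_neutral) (use assms in auto)
  then show "integral\<^sup>L M f = (\<Sum>x\<in>F. w x *\<^sub>R f x)"
    using integral_infsum[OF i] assms(1) by simp
qed

lemma
  fixes f :: "'a \<Rightarrow> real"
  assumes "\<And>x. 0 \<le> f x" "\<And>F. finite F \<Longrightarrow> (\<Sum>x\<in>F. w x * f x) \<le> C"
  shows integrable_bounded_sums: "integrable M f"
    and integral_bounded_sums: "integral\<^sup>L M f \<le> C"
proof -
  have "(\<lambda>x. w x * f x) summable_on UNIV"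
    by (rule nonneg_bdd_above_summable_on) (use assms in \<open>auto intro!: bdd_aboveI[of _ C]\<close>)
  then show i: "integrable M f"
    using assms(1) by (simp add: integrable_iff abs_mult)
  show "integral\<^sup>L M f \<le> C"
    unfolding integral_infsum[OF i]
    by (rule infsum_le_finite_sums) (use \<open>(\<lambda>x. w x * f x) summable_on UNIV\<close> assms in auto)
qed

lemma sum_le_integral:
  fixes f :: "'a \<Rightarrow> real"
  assumes "integrable M f" "\<And>x. 0 \<le> f x" "finite F"
  shows "(\<Sum>x\<in>F. w x * f x) \<le> integral\<^sup>L M f"
proof -
  have "(\<lambda>x. w x * f x) summable_on UNIV"
    using assms by (simp add: integrable_iff abs_mult)
  then show ?thesis unfolding integral_infsum[OF assms(1)]
    using assms by (auto intro!: finite_sum_le_infsum)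
qed

lemma AE_iff: "(AE x in M. P x) \<longleftrightarrow> (\<forall>x. P x)"
  unfolding density by (subst AE_density) (auto simp: AE_count_space w_pos)

lemma L2_iff: "f \<in> L2 M \<longleftrightarrow> integrable M (\<lambda>x. (cmod (f x))\<^sup>2)"
  by (simp add: L2_def)

text \<open>Bounds over all finite sets give membership and the norm estimate at once. The operators
  below are estimated in this form, where sums can be exchanged freely.\<close>

lemma L2_boundI:
  assumes "\<And>F. finite F \<Longrightarrow> (\<Sum>x\<in>F. w x * (cmod (f x))\<^sup>2) \<le> C\<^sup>2" "0 \<le> C"
  shows "f \<in> L2 M" "l2_norm M f \<le> C"
proof -
  show "f \<in> L2 M" unfolding L2_iff
    by (rule integrable_bounded_sums) (use assms in auto)
  have "(l2_norm M f)\<^sup>2 \<le> C\<^sup>2" unfolding l2_norm_sq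
    by (rule integral_bounded_sums) (use assms in auto)
  then show "l2_norm M f \<le> C" using assms(2) by (rule power2_le_imp_le)
qed

lemma sum_le_l2_norm:
  assumes "f \<in> L2 M" "finite F"
  shows "(\<Sum>x\<in>F. w x * (cmod (f x))\<^sup>2) \<le> (l2_norm M f)\<^sup>2"
  unfolding l2_norm_sq using assms by (intro sum_le_integral) (auto simp: L2_iff)

text \<open>Each point has positive mass, so point evaluation is continuous on L2; this controls the
  values of translates at a fixed point.\<close>

lemma L2_pointwise:
  assumes "f \<in> L2 M"
  shows "cmod (f x) \<le> l2_norm M f / sqrt (w x)"
proof -
  have "w x * (cmod (f x))\<^sup>2 \<le> (l2_norm M f)\<^sup>2"
    using sum_le_l2_norm[OF assms, of "{x}"] by simp
  then have "sqrt (w x * (cmod (f x))\<^sup>2) \<le> l2_norm M f"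
    by (intro real_le_lsqrt) simp_all
  then show ?thesis using w_pos[of x] by (simp add: real_sqrt_mult field_simps)
qed

definition restr :: "'a set \<Rightarrow> ('a \<Rightarrow> complex) \<Rightarrow> 'a \<Rightarrow> complex" where
  "restr F f x = (if x \<in> F then f x else 0)"

lemma finite_support_restr: "finite F \<Longrightarrow> finite {x. restr F f x \<noteq> 0}"
  by (rule finite_subset[of _ F]) (auto simp: restr_def)

lemma finite_support_L2:
  assumes "finite {x. f x \<noteq> 0}"
  shows "f \<in> L2 M"
  unfolding L2_iff by (rule integrable_finite[OF assms]) simp

lemma
  assumes "f \<in> L2 M"
  shows L2_restr: "restr F f \<in> L2 M" and l2_norm_restr_le: "l2_norm M (restr F f) \<le> l2_norm M f"
  using l2_norm_mono[OF assms, of "restr F f"] by (auto simp: restr_def)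

lemma l2_inner_restr: "l2_inner M f (restr F f) = complex_of_real ((l2_norm M (restr F f))\<^sup>2)"
proof -
  have "l2_inner M f (restr F f) = (\<integral>x. complex_of_real ((cmod (restr F f x))\<^sup>2) \<partial>M)"
    unfolding l2_inner_def restr_def
    by (intro Bochner_Integration.integral_cong refl) (simp add: complex_norm_square del: of_real_power)
  then show ?thesis unfolding l2_norm_sq integral_complex_of_real .
qed

lemma l2_restr_approx:
  assumes "f \<in> L2 M" "0 < \<epsilon>"
  obtains F where "finite F" "l2_norm M (\<lambda>x. f x - restr F f x) < \<epsilon>"
proof -
  let ?g = "\<lambda>x. w x * (cmod (f x))\<^sup>2"
  have i: "integrable M (\<lambda>x. (cmod (f x))\<^sup>2)" using assms by (simp add: L2_iff)
  then have s: "?g summable_on UNIV" by (simp add: integrable_iff)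
  have "\<epsilon>\<^sup>2 > 0" using assms by simp
  \<comment> \<open>Half of the square of \<open>\<epsilon>\<close>, because the approximation is
    non-strict and a strict bound is wanted.\<close>
  then obtain F where F: "finite F" "dist (sum ?g F) (infsum ?g UNIV) \<le> \<epsilon>\<^sup>2 / 2"
    using infsum_finite_approximation[OF s, of "\<epsilon>\<^sup>2 / 2"] by auto
  have j: "integrable M (\<lambda>x. (cmod (restr F f x))\<^sup>2)"
    using L2_restr[OF assms(1)] by (simp add: L2_iff)
  have "(l2_norm M (\<lambda>x. f x - restr F f x))\<^sup>2 = (\<integral>x. (cmod (f x))\<^sup>2 - (cmod (restr F f x))\<^sup>2 \<partial>M)"
    unfolding l2_norm_sq by (intro Bochner_Integration.integral_cong) (auto simp: restr_def)
  also have "\<dots> = infsum ?g UNIV - (\<Sum>x\<in>F. w x * (cmod (restr F f x))\<^sup>2)"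
    using i j integral_finite[OF F(1), of "\<lambda>x. (cmod (restr F f x))\<^sup>2"]
    by (simp add: integral_infsum restr_def)
  also have "\<dots> = infsum ?g UNIV - sum ?g F"
    by (simp add: restr_def)
  also have "\<dots> < \<epsilon>\<^sup>2" using F(2) \<open>\<epsilon>\<^sup>2 > 0\<close> unfolding dist_real_def by linarith
  finally have "l2_norm M (\<lambda>x. f x - restr F f x) < \<epsilon>"
    using assms(2) by (intro power_less_imp_less_base[of _ 2 \<epsilon>]) simp_all
  with F(1) that show thesis by blast
qed

end

section \<open>Discrete hypergroups\<close>

lemma cmeasure_of_null [simp]: "cmeasure_of (null_measure M) = (\<lambda>A. 0)"
  by (simp add: cmeasure_of_def)

context discrete_hypergroup
begin

section \<open>Radon measures on a discrete space\<close>

lemma open_discrete [simp]: "open (A :: 'a set)"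
  using discrete by (metis open_openin openin_discrete_topology subset_UNIV)

lemma compact_discrete [simp]: "compact (A :: 'a set) \<longleftrightarrow> finite A"
  by (metis compactin_discrete_topology compactin_euclidean_iff discrete subset_UNIV)

lemma sets_borel_discrete [simp]: "sets (borel :: 'a measure) = UNIV"
  using borel_open[of "_ :: 'a set"] by auto

lemma continuous_on_discrete [simp]:
  "continuous_on A (f :: 'a \<Rightarrow> 'b::topological_space)"
  by (simp add: continuous_on_open_vimage)

lemma radon_sets: "radon_measure (N :: 'a measure) \<Longrightarrow> sets N = UNIV"
  unfolding radon_measure_def by (drule conjunct1) simp

lemma radon_inner_regular:
  "radon_measure (N :: 'a measure) \<Longrightarrow> emeasure N A = (SUP K\<in>{K. finite K \<and> K \<subseteq> A}. emeasure N K)"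
  unfolding radon_measure_def compact_discrete using open_discrete by blast

text \<open>Countable additivity says nothing about an uncountable \<open>A\<close>. Inner
  regularity does: every set is open, and its compact subsets are finite.\<close>

lemma radon_null_set:
  assumes "radon_measure (N :: 'a measure)" "\<And>x. x \<in> A \<Longrightarrow> emeasure N {x} = 0"
  shows "emeasure N A = 0"
proof -
  have "emeasure N K = 0" if "finite K" "K \<subseteq> A" for K
    using that assms by (subst emeasure_eq_sum_singleton) (auto simp: radon_sets)
  then have "(SUP K\<in>{K. finite K \<and> K \<subseteq> A}. emeasure N K) \<le> 0"
    by (intro SUP_least) simp
  then show ?thesis using radon_inner_regular[OF assms(1), of A] by simp
qed

text \<open>Every set is open, so outer regularity is attained at the set itself, and inner
  regularity at its intersection with \<open>F\<close>.\<close>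

lemma radon_measureI:
  assumes s: "sets (N :: 'a measure) = UNIV" and "finite_measure N" "finite F" "emeasure N (- F) = 0"
  shows "radon_measure N"
proof -
  interpret finite_measure N by fact
  have e: "emeasure N A = emeasure N (A \<inter> F)" for A
  proof -
    have "- F \<in> null_sets N" using assms by auto
    then have "emeasure N (A - (- F)) = emeasure N A"
      by (intro emeasure_Diff_null_set) (auto simp: s)
    then show ?thesis by (simp add: Diff_eq)
  qed
  have "emeasure N A = (INF U\<in>{U. open U \<and> A \<subseteq> U}. emeasure N U)" for A
    by (intro antisym INF_greatest INF_lower emeasure_mono) (auto simp: s)
  moreover have "emeasure N A = (SUP K\<in>{K. compact K \<and> K \<subseteq> A}. emeasure N K)" for A
  proof (rule antisym)
    show "emeasure N A \<le> (SUP K\<in>{K. compact K \<and> K \<subseteq> A}. emeasure N K)"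
      by (subst e, rule SUP_upper) (use assms in auto)
  qed (auto intro!: SUP_least emeasure_mono simp: s)
  moreover have "emeasure N K < \<infinity>" for K
    using emeasure_finite by (simp add: less_top[symmetric])
  moreover have "sets N = sets borel" by (simp add: s)
  ultimately show ?thesis
    unfolding radon_measure_def by (intro conjI allI ballI impI)
qed

lemma point_mass_eq: "point_mass x = (\<lambda>A. indicator A (x :: 'a))"
  by (auto simp: point_mass_def cmeasure_of_def measure_return indicator_def)

text \<open>Linearity and associativity of \<open>conv\<close> are postulated on
  \<open>bounded_radon\<close>, so combinations of point masses have to be placed there before the
  axioms apply.\<close>

lemma nonneg_combination_radon:
  fixes a :: "'a \<Rightarrow> real"
  assumes "finite F" "\<And>z. z \<in> F \<Longrightarrow> 0 \<le> a z"
  shows "(\<lambda>A. \<Sum>z\<in>F. complex_of_real (a z) * point_mass z A) \<in> bounded_radon"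
proof -
  define N where "N = density (count_space (UNIV :: 'a set)) (\<lambda>z. ennreal (a z) * indicator F z)"
  have em: "emeasure N A = ennreal (\<Sum>z\<in>F. a z * indicator A z)" for A
  proof -
    have "emeasure N A = (\<integral>\<^sup>+z. ennreal (a z) * indicator F z * indicator A z \<partial>count_space UNIV)"
      unfolding N_def by (subst emeasure_density) auto
    also have "\<dots> = (\<Sum>z\<in>F. ennreal (a z) * indicator F z * indicator A z)"
      using assms(1) by (intro nn_integral_count_space') (auto simp: indicator_def)
    also have "\<dots> = (\<Sum>z\<in>F. ennreal (a z * indicator A z))"
      by (intro sum.cong) (auto simp: indicator_def)
    also have "\<dots> = ennreal (\<Sum>z\<in>F. a z * indicator A z)"
      using assms(2) by (intro sum_ennreal) (auto simp: indicator_def)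
    finally show ?thesis .
  qed
  have m: "measure N A = (\<Sum>z\<in>F. a z * indicator A z)" for A
    unfolding measure_def em using assms(2) by (intro enn2real_ennreal sum_nonneg) (auto simp: indicator_def)
  have f: "finite_measure N" by standard (simp add: em)
  have s: "sets N = UNIV" by (simp add: N_def)
  have N: "radon_measure N"
  proof (rule radon_measureI[OF s f assms(1)])
    have "(\<Sum>z\<in>F. a z * indicator (- F) z) = 0"
      by (intro sum.neutral) (auto simp: indicator_def)
    then show "emeasure N (- F) = 0" by (simp add: em)
  qed
  \<comment> \<open>The zero measure fills the negative and imaginary slots of the decomposition in
    \<open>bounded_radon\<close>.\<close>
  let ?o = "null_measure (borel :: 'a measure)"
  have o: "finite_measure ?o" by (auto intro!: finite_measureI)
  then have "radon_measure ?o" by (intro radon_measureI[of _ "{}"]) auto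
  with N f o have r: "\<forall>N'\<in>{N, ?o, ?o, ?o}. radon_measure N' \<and> finite_measure N'" by blast
  have "(\<Sum>z\<in>F. complex_of_real (a z) * point_mass z A) = cmeasure_of N A" for A
    unfolding cmeasure_of_def m of_real_sum
    by (intro sum.cong refl) (simp add: point_mass_eq indicator_def)
  then have "(\<lambda>A. \<Sum>z\<in>F. complex_of_real (a z) * point_mass z A) =
      (\<lambda>A. cmeasure_of N A - cmeasure_of ?o A + \<i> * (cmeasure_of ?o A - cmeasure_of ?o A))"
    unfolding cmeasure_of_null by simp
  with r show ?thesis unfolding bounded_radon_def mem_Collect_eq by blast
qed

lemma point_mass_radon: "point_mass (x :: 'a) \<in> bounded_radon"
  using nonneg_combination_radon[of "{x}" "\<lambda>_. 1"] by simp

section \<open>Convolution of finite combinations of point masses\<close>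

lemma conv_combination_left:
  assumes "finite F" "\<And>z. z \<in> F \<Longrightarrow> 0 \<le> a z"
  shows "conv (\<lambda>A. \<Sum>z\<in>F. complex_of_real (a z) * point_mass z A) (point_mass y) =
    (\<lambda>A. \<Sum>z\<in>F. complex_of_real (a z) * conv (point_mass z) (point_mass y) A)"
  using assms
proof (induction F)
  case empty
  \<comment> \<open>The linearity axiom has no separate clause for the zero measure, which is
    therefore written as -1 times a point mass plus the same point mass.\<close>
  have "conv (\<lambda>A. (-1) * point_mass e A + point_mass e A) (point_mass y) =
      (\<lambda>A. (-1) * conv (point_mass e) (point_mass y) A + conv (point_mass e) (point_mass y) A)"
    by (rule conv_linear_left) (rule point_mass_radon)+
  then show ?case by simp
next
  case (insert z F)
  have "conv (\<lambda>A. complex_of_real (a z) * point_mass z A + (\<Sum>z\<in>F. complex_of_real (a z) * point_mass z A)) (point_mass y) =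
      (\<lambda>A. complex_of_real (a z) * conv (point_mass z) (point_mass y) A +
        conv (\<lambda>A. \<Sum>z\<in>F. complex_of_real (a z) * point_mass z A) (point_mass y) A)"
    using insert.hyps insert.prems
    by (intro conv_linear_left point_mass_radon nonneg_combination_radon) auto
  moreover have "conv (\<lambda>A. \<Sum>z\<in>F. complex_of_real (a z) * point_mass z A) (point_mass y) =
      (\<lambda>A. \<Sum>z\<in>F. complex_of_real (a z) * conv (point_mass z) (point_mass y) A)"
    using insert.prems by (intro insert.IH) auto
  ultimately show ?case unfolding sum.insert[OF insert.hyps] by (simp only:)
qed

lemma conv_combination_right:
  assumes "finite F" "\<And>z. z \<in> F \<Longrightarrow> 0 \<le> a z"
  shows "conv (point_mass y) (\<lambda>A. \<Sum>z\<in>F. complex_of_real (a z) * point_mass z A) =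
    (\<lambda>A. \<Sum>z\<in>F. complex_of_real (a z) * conv (point_mass y) (point_mass z) A)"
  using assms
proof (induction F)
  case empty
  have "conv (point_mass y) (\<lambda>A. (-1) * point_mass e A + point_mass e A) =
      (\<lambda>A. (-1) * conv (point_mass y) (point_mass e) A + conv (point_mass y) (point_mass e) A)"
    by (rule conv_linear_right) (rule point_mass_radon)+
  then show ?case by simp
next
  case (insert z F)
  have "conv (point_mass y) (\<lambda>A. complex_of_real (a z) * point_mass z A + (\<Sum>z\<in>F. complex_of_real (a z) * point_mass z A)) =
      (\<lambda>A. complex_of_real (a z) * conv (point_mass y) (point_mass z) A +
        conv (point_mass y) (\<lambda>A. \<Sum>z\<in>F. complex_of_real (a z) * point_mass z A) A)"
    using insert.hyps insert.prems
    by (intro conv_linear_right point_mass_radon nonneg_combination_radon) auto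
  moreover have "conv (point_mass y) (\<lambda>A. \<Sum>z\<in>F. complex_of_real (a z) * point_mass z A) =
      (\<lambda>A. \<Sum>z\<in>F. complex_of_real (a z) * conv (point_mass y) (point_mass z) A)"
    using insert.prems by (intro insert.IH) auto
  ultimately show ?case unfolding sum.insert[OF insert.hyps] by (simp only:)
qed

text \<open>\<open>pconv\<close> is built from real parts of a complex set function. The axiom
  \<open>conv_prob\<close> supplies a genuine probability measure with these values, and
  \<open>measure_of\<close> rebuilds that measure from them.\<close>

lemma pconv_radon_prob: "pconv conv x y \<in> radon_prob"
  and finite_msupport: "finite (msupport (pconv conv x y))"
  and conv_point_masses: "conv (point_mass x) (point_mass y) = cmeasure_of (pconv conv x y)"
proof -
  obtain N where N: "N \<in> radon_prob" "finite (msupport N)"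
      "conv (point_mass x) (point_mass y) = cmeasure_of N"
    using conv_prob[of x y] by auto
  interpret prob_space N using N by (simp add: radon_prob_def)
  have s: "sets N = sets borel" using N by (simp add: radon_prob_def radon_sets)
  then have "space N = UNIV" by (metis sets_eq_imp_space_eq space_borel)
  then have "pconv conv x y = N"
    unfolding pconv_def N(3) cmeasure_of_def using measure_of_of_measure[of N] s
    by (simp add: emeasure_eq_measure[symmetric])
  with N show "pconv conv x y \<in> radon_prob" "finite (msupport (pconv conv x y))"
    "conv (point_mass x) (point_mass y) = cmeasure_of (pconv conv x y)" by auto
qed

sublocale pconv: prob_space "pconv conv x y" for x y
  using pconv_radon_prob by (simp add: radon_prob_def)

lemma radon_pconv: "radon_measure (pconv conv x y)"
  using pconv_radon_prob by (simp add: radon_prob_def)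

lemma sets_pconv [simp]: "sets (pconv conv x y) = UNIV"
  by (rule radon_sets[OF radon_pconv])

lemma space_pconv [simp]: "space (pconv conv x y) = UNIV"
  using sets_eq_imp_space_eq[of "pconv conv x y" borel] by simp

section \<open>Structure constants of a discrete hypergroup\<close>

abbreviation supp :: "'a \<Rightarrow> 'a \<Rightarrow> 'a set" where
  "supp x y \<equiv> msupport (pconv conv x y)"

text \<open>The structure constants: the product of the point masses at \<open>x\<close> and
  \<open>y\<close> is the sum of \<open>coef x y z\<close> times the point mass at \<open>z\<close>.
  For fixed \<open>x\<close> they form a stochastic matrix in \<open>y\<close> and \<open>z\<close>
  with finite rows.\<close>

definition coef :: "'a \<Rightarrow> 'a \<Rightarrow> 'a \<Rightarrow> real" where
  "coef x y z = measure (pconv conv x y) {z}"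

lemma coef_nonneg [simp]: "0 \<le> coef x y z"
  by (simp add: coef_def)

lemma in_supp_iff: "z \<in> supp x y \<longleftrightarrow> coef x y z \<noteq> 0"
proof -
  have "z \<in> supp x y \<longleftrightarrow> emeasure (pconv conv x y) {z} > 0"
  proof
    assume pos: "emeasure (pconv conv x y) {z} > 0"
    have "emeasure (pconv conv x y) U > 0" if "z \<in> U" for U
      using that by (intro less_le_trans[OF pos] emeasure_mono) auto
    then show "z \<in> supp x y" unfolding msupport_def by blast
  qed (simp add: msupport_def)
  then show ?thesis
    by (simp add: coef_def pconv.emeasure_eq_measure zero_less_measure_iff)
qed

text \<open>The complement of the support consists of points of mass zero but may be uncountable,
  hence the appeal to \<open>radon_null_set\<close>.\<close>

lemma AE_supp: "AE z in pconv conv x y. z \<in> supp x y"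
proof (rule AE_I[of _ _ "- supp x y"])
  show "emeasure (pconv conv x y) (- supp x y) = 0"
    by (rule radon_null_set[OF radon_pconv])
       (auto simp: in_supp_iff coef_def pconv.emeasure_eq_measure)
qed auto

lemma integral_pconv:
  fixes f :: "'a \<Rightarrow> 'b::{banach, second_countable_topology}"
  shows "integral\<^sup>L (pconv conv x y) f = (\<Sum>z\<in>supp x y. coef x y z *\<^sub>R f z)"
proof -
  have m: "g \<in> borel_measurable (pconv conv x y)" for g :: "'a \<Rightarrow> 'b"
    by (simp add: measurable_def)
  have "integral\<^sup>L (pconv conv x y) f =
      (\<integral>t. (\<Sum>z\<in>supp x y. indicator {z} t *\<^sub>R f z) \<partial>pconv conv x y)"
  proof (rule integral_cong_AE[OF m m])
    show "AE t in pconv conv x y. f t = (\<Sum>z\<in>supp x y. indicator {z} t *\<^sub>R f z)"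
      using AE_supp
    proof eventually_elim
      case (elim t)
      have "(\<Sum>z\<in>supp x y. indicator {z} t *\<^sub>R f z) = (\<Sum>z\<in>supp x y. if t = z then f z else 0)"
        by (intro sum.cong) (auto simp: indicator_def)
      with elim show ?case by (simp add: finite_msupport)
    qed
  qed
  also have "\<dots> = (\<Sum>z\<in>supp x y. \<integral>t. indicator {z} t *\<^sub>R f z \<partial>pconv conv x y)"
    by (intro Bochner_Integration.integral_sum integrable_scaleR_left)
       (auto intro!: integrable_real_indicator simp: pconv.emeasure_eq_measure)
  also have "\<dots> = (\<Sum>z\<in>supp x y. coef x y z *\<^sub>R f z)"
  proof (intro sum.cong refl)
    fix z
    have "integrable (pconv conv x y) (indicator {z} :: 'a \<Rightarrow> real)"
      by (auto intro!: integrable_real_indicator simp: pconv.emeasure_eq_measure)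
    then show "(\<integral>t. indicator {z} t *\<^sub>R f z \<partial>pconv conv x y) = coef x y z *\<^sub>R f z"
      by (simp add: coef_def)
  qed
  finally show ?thesis .
qed

lemma measure_pconv: "measure (pconv conv x y) A = (\<Sum>z\<in>supp x y. coef x y z * indicator A z)"
  using integral_pconv[of x y "indicator A :: _ \<Rightarrow> real"] by simp

lemma sum_coef: "(\<Sum>z\<in>supp x y. coef x y z) = 1"
  using measure_pconv[of x y UNIV] pconv.prob_space[of x y] by simp

lemma conv_point_masses_sum:
  "conv (point_mass x) (point_mass y) =
    (\<lambda>A. \<Sum>z\<in>supp x y. complex_of_real (coef x y z) * point_mass z A)"
proof
  fix A
  show "conv (point_mass x) (point_mass y) A =
      (\<Sum>z\<in>supp x y. complex_of_real (coef x y z) * point_mass z A)"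
    unfolding conv_point_masses cmeasure_of_def measure_pconv of_real_sum
    by (intro sum.cong refl) (simp add: point_mass_eq indicator_def)
qed

lemma conv_singleton: "conv (point_mass x) (point_mass y) {z} = complex_of_real (coef x y z)"
  by (simp add: conv_point_masses cmeasure_of_def coef_def)

text \<open>Associativity for three point masses, read off at a singleton. Both the products of
  translations and the symmetry of the coefficients under the Haar weights come from it.\<close>

lemma coef_assoc:
  "(\<Sum>z\<in>supp x y. coef x y z * coef z v u) = (\<Sum>z\<in>supp y v. coef y v z * coef x z u)"
proof -
  have "complex_of_real (\<Sum>z\<in>supp x y. coef x y z * coef z v u) =
      conv (conv (point_mass x) (point_mass y)) (point_mass v) {u}"
    unfolding conv_point_masses_sum[of x y]
    by (subst conv_combination_left) (auto simp: finite_msupport conv_singleton)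
  also have "\<dots> = conv (point_mass x) (conv (point_mass y) (point_mass v)) {u}"
    by (simp add: conv_assoc point_mass_radon)
  also have "\<dots> = complex_of_real (\<Sum>z\<in>supp y v. coef y v z * coef x z u)"
    unfolding conv_point_masses_sum[of y v]
    by (subst conv_combination_right) (auto simp: finite_msupport conv_singleton)
  finally show ?thesis by (simp only: of_real_eq_iff)
qed

lemma coef_identity_left: "coef e y x = of_bool (x = y)"
  using conv_singleton[of e y x] unfolding identity_left
  by (auto simp: point_mass_eq indicator_def split: if_splits)

lemma supp_identity_left [simp]: "supp e y = {y}"
  by (auto simp: in_supp_iff coef_identity_left)

lemma coef_e_iff: "coef x y e \<noteq> 0 \<longleftrightarrow> x = tilde y"
  using supp_identity by (simp add: in_supp_iff)

text \<open>The point \<open>e\<close> lies in the support of the product of its point mass with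
  itself, and the axiom on \<open>e\<close> in supports turns this into the equation.\<close>

lemma tilde_e [simp]: "tilde e = e"
  using coef_e_iff[of e e] by (simp add: coef_identity_left)

lemma coef_tilde: "coef (tilde y) (tilde x) z = coef x y (tilde z)"
proof -
  have "tilde -` {z} = {tilde z}" using tilde_tilde by auto
  moreover have "measure (distr (pconv conv x y) borel tilde) {z} = measure (pconv conv x y) (tilde -` {z})"
    by (subst measure_distr) (auto simp: measurable_def)
  ultimately show ?thesis by (simp add: coef_def tilde_conv[symmetric])
qed

end

section \<open>Translations\<close>

text \<open>The identity E(X - EX)^2 = EX^2 - (EX)^2. Nonnegativity of the left side is the Jensen
  inequality behind the contraction estimate; the exact form later measures how far vectors are from
  their average.\<close>

lemma weighted_variance:
  fixes p a :: "'i \<Rightarrow> real"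
  assumes "(\<Sum>i\<in>S. p i) = 1"
  shows "(\<Sum>i\<in>S. p i * (a i - (\<Sum>j\<in>S. p j * a j))\<^sup>2) =
    (\<Sum>i\<in>S. p i * (a i)\<^sup>2) - (\<Sum>j\<in>S. p j * a j)\<^sup>2"
proof -
  define m where "m = (\<Sum>j\<in>S. p j * a j)"
  have "(\<Sum>i\<in>S. p i * (a i - m)\<^sup>2) =
      (\<Sum>i\<in>S. p i * (a i)\<^sup>2 - (2 * m) * (p i * a i) + m\<^sup>2 * p i)"
    by (intro sum.cong refl) (simp add: power2_eq_square algebra_simps)
  also have "\<dots> = (\<Sum>i\<in>S. p i * (a i)\<^sup>2) - 2 * m * m + m\<^sup>2 * 1"
    by (simp only: sum.distrib sum_subtractf sum_distrib_left[symmetric] m_def[symmetric] assms)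
  finally show ?thesis by (simp add: m_def power2_eq_square)
qed

lemma (in discrete_hypergroup) radon_finite:
  assumes "radon_measure (N :: 'a measure)" "finite K"
  shows "emeasure N K < \<infinity>"
proof -
  have "\<forall>K. compact K \<longrightarrow> emeasure N K < \<infinity>"
    using assms(1) unfolding radon_measure_def by (elim conjE)
  with assms(2) show ?thesis by simp
qed

text \<open>One inequality is inner regularity by finite sets. For the other, finite sums of point
  masses are bounded by the mass of \<open>A\<close>, so they are summable over \<open>A\<close>
  even when \<open>A\<close> is uncountable.\<close>

lemma (in discrete_hypergroup) radon_eq_density:
  assumes N: "radon_measure (N :: 'a measure)"
  shows "N = density (count_space UNIV) (\<lambda>x. ennreal (measure N {x}))"
proof (rule measure_eqI)
  show "sets N = sets (density (count_space UNIV) (\<lambda>x. ennreal (measure N {x})))"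
    by (simp add: radon_sets[OF N])
  fix A
  let ?w = "\<lambda>x. measure N {x}"
  have sing: "emeasure N {x} = ennreal (?w x)" for x
    using radon_finite[OF N, of "{x}"] by (simp add: emeasure_eq_ennreal_measure less_top)
  have K: "emeasure N K = (\<Sum>x\<in>K. ennreal (?w x))" if "finite K" for K
    using that by (subst emeasure_eq_sum_singleton) (auto simp: radon_sets[OF N] sing)
  let ?I = "\<integral>\<^sup>+x. ennreal (?w x) * indicator A x \<partial>count_space UNIV"
  have "emeasure N A \<le> ?I"
    unfolding radon_inner_regular[OF N, of A]
  proof (rule SUP_least)
    fix K assume "K \<in> {K. finite K \<and> K \<subseteq> A}"
    then have "finite K" "K \<subseteq> A" by auto
    have "emeasure N K = (\<Sum>x\<in>K. ennreal (?w x) * indicator K x)"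
      unfolding K[OF \<open>finite K\<close>] by (intro sum.cong) auto
    also have "\<dots> = (\<integral>\<^sup>+x. ennreal (?w x) * indicator K x \<partial>count_space UNIV)"
      using \<open>finite K\<close> by (intro nn_integral_count_space'[symmetric]) auto
    also have "\<dots> \<le> ?I"
      using \<open>K \<subseteq> A\<close> by (intro nn_integral_mono) (auto simp: indicator_def)
    finally show "emeasure N K \<le> ?I" .
  qed
  moreover have "?I \<le> emeasure N A"
  proof (cases "emeasure N A = \<infinity>")
    case False
    define r where "r = measure N A"
    have r: "emeasure N A = ennreal r" using False by (simp add: r_def emeasure_eq_ennreal_measure)
    have b: "sum ?w K \<le> r" if "finite K" "K \<subseteq> A" for K
    proof -
      have "ennreal (sum ?w K) = emeasure N K" by (simp add: K that)
      also have "\<dots> \<le> ennreal r" unfolding r[symmetric]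
        using that by (intro emeasure_mono) (auto simp: radon_sets[OF N])
      finally show ?thesis by (simp add: r_def)
    qed
    then have s: "?w summable_on A"
      by (intro nonneg_bdd_above_summable_on) (auto intro!: bdd_aboveI[of _ r])
    then have s': "Infinite_Set_Sum.abs_summable_on ?w A"
      by (simp add: abs_summable_equivalent[symmetric])
    have "?I = (\<integral>\<^sup>+x. ennreal (?w x) \<partial>count_space A)"
      by (simp add: nn_integral_count_space_indicator)
    also have "\<dots> = ennreal (infsetsum ?w A)"
      using s' by (intro nn_integral_conv_infsetsum) auto
    also have "infsetsum ?w A = infsum ?w A" by (rule infsetsum_infsum[OF s'])
    also have "ennreal (infsum ?w A) \<le> ennreal r"
      by (intro ennreal_leI infsum_le_finite_sums s b)
    finally show ?thesis by (simp add: r)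
  qed simp
  ultimately show "emeasure N A = emeasure (density (count_space UNIV) (\<lambda>x. ennreal (?w x))) A"
    by (subst emeasure_density) auto
qed

section \<open>Haar weights and symmetries of the structure constants\<close>

locale discrete_haar = discrete_hypergroup conv tilde e
  for conv :: "'a::t2_space convolution" and tilde :: "'a \<Rightarrow> 'a" and e :: 'a +
  fixes lam :: "'a measure"
  assumes haar: "left_haar_measure conv tilde lam"
begin

lemma radon_lam: "radon_measure lam"
  using haar unfolding left_haar_measure_def by (rule conjunct1)

definition w :: "'a \<Rightarrow> real" where
  "w x = measure lam {x}"

lemma emeasure_lam_singleton: "emeasure lam {x} = ennreal (w x)"
proof -
  have "emeasure lam {x} < \<infinity>" by (rule radon_finite[OF radon_lam]) simp
  then show ?thesis by (simp add: w_def emeasure_eq_ennreal_measure less_top)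
qed

text \<open>The point \<open>z0\<close> may lie outside the support: then both sides vanish.\<close>

lemma sum_supp_single:
  assumes "\<And>z. z \<noteq> z0 \<Longrightarrow> g z = 0"
  shows "(\<Sum>z\<in>supp x y. coef x y z * g z) = coef x y z0 * (g z0 :: real)"
proof -
  have "(\<Sum>z\<in>supp x y. coef x y z * g z) = (\<Sum>z\<in>supp x y. if z = z0 then coef x y z0 * g z0 else 0)"
    using assms by (intro sum.cong) auto
  then show ?thesis using in_supp_iff[of z0 x y] by (simp add: finite_msupport)
qed

lemma integral_lam_singleton:
  "(\<integral>z. indicator {x} z *\<^sub>R c \<partial>lam) = w x *\<^sub>R (c :: complex)"
proof -
  have "integrable lam (indicator {x} :: 'a \<Rightarrow> real)"
    by (auto intro!: integrable_real_indicator simp: emeasure_lam_singleton radon_sets[OF radon_lam])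
  then show ?thesis by (simp add: w_def radon_sets[OF radon_lam])
qed

text \<open>Invariance of the Haar measure, tested on the indicator of {e}. The product of the point
  masses at \<open>tilde x\<close> and \<open>z\<close> charges \<open>e\<close> only for
  \<open>z = x\<close>, so the translated indicator is a multiple of the indicator of {x}.\<close>

lemma w_coef_e: "w x * coef (tilde x) x e = w e"
proof -
  let ?f = "indicator {e} :: 'a \<Rightarrow> complex"
  have "ltrans conv tilde x ?f z = indicator {x} z *\<^sub>R complex_of_real (coef (tilde x) x e)" for z
  proof -
    have "ltrans conv tilde x ?f z = complex_of_real (\<Sum>u\<in>supp (tilde x) z. coef (tilde x) z u * indicator {e} u)"
      unfolding ltrans_def integral_pconv of_real_sum
      by (intro sum.cong) (auto simp: indicator_def scaleR_conv_of_real)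
    also have "(\<Sum>u\<in>supp (tilde x) z. coef (tilde x) z u * indicator {e} u) = coef (tilde x) z e"
      by (subst sum_supp_single[of e]) auto
    also have "\<dots> = indicator {x} z * coef (tilde x) x e"
    proof (cases "z = x")
      case False
      then have "tilde x \<noteq> tilde z" by (metis tilde_tilde)
      with False show ?thesis using coef_e_iff[of "tilde x" z] by simp
    qed simp
    finally show ?thesis by (cases "z = x") simp_all
  qed
  then have "ltrans conv tilde x ?f = (\<lambda>z. indicator {x} z *\<^sub>R complex_of_real (coef (tilde x) x e))"
    by (rule ext)
  then have "integral\<^sup>L lam (ltrans conv tilde x ?f) = w x *\<^sub>R complex_of_real (coef (tilde x) x e)"
    by (simp only: integral_lam_singleton)
  moreover have "?f = (\<lambda>z. indicator {e} z *\<^sub>R 1)" by (auto simp: indicator_def)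
  then have "integral\<^sup>L lam ?f = w e *\<^sub>R 1"
    by (simp only: integral_lam_singleton)
  moreover have "integral\<^sup>L lam (ltrans conv tilde x ?f) = integral\<^sup>L lam ?f"
  proof -
    have fin: "finite {t. ?f t \<noteq> 0}" by (rule finite_subset[of _ "{e}"]) (auto simp: indicator_def)
    then have "closure {t. ?f t \<noteq> 0} = {t. ?f t \<noteq> 0}" by (intro closure_closed finite_imp_closed)
    then have "compact (closure {t. ?f t \<noteq> 0})" using fin by simp
    moreover have "\<forall>f x. continuous_on UNIV f \<and> compact (closure {t. f t \<noteq> 0}) \<longrightarrow>
        integral\<^sup>L lam (ltrans conv tilde x f) = integral\<^sup>L lam f"
      using haar unfolding left_haar_measure_def by (elim conjE)
    ultimately show ?thesis using continuous_on_discrete by blast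
  qed
  ultimately have "complex_of_real (w x * coef (tilde x) x e) = complex_of_real (w e)"
    by (simp add: scaleR_conv_of_real)
  then show ?thesis by (simp only: of_real_eq_iff)
qed

lemma coef_tilde_e_nz: "coef (tilde x) x e \<noteq> 0"
  by (simp add: coef_e_iff)

text \<open>A zero mass at \<open>e\<close> would propagate to all points through
  \<open>w_coef_e\<close>, and a Radon measure on a discrete space whose points all have mass zero
  is zero.\<close>

lemma w_positive: "0 < w x"
proof -
  have "w e \<noteq> 0"
  proof
    assume "w e = 0"
    then have "w x = 0" for x using w_coef_e[of x] coef_tilde_e_nz[of x] by simp
    then have "emeasure lam {x} = 0" for x by (simp add: emeasure_lam_singleton)
    then have "emeasure lam UNIV = 0"
      by (intro radon_null_set[OF radon_lam, of UNIV])
    moreover have "emeasure lam UNIV \<noteq> 0"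
      using haar unfolding left_haar_measure_def by (elim conjE)
    ultimately show False by simp
  qed
  then have "w x \<noteq> 0" using w_coef_e[of x] by auto
  then show ?thesis by (simp add: w_def zero_less_measure_iff)
qed

sublocale discrete_measure lam w
proof
  show "lam = density (count_space UNIV) (\<lambda>x. ennreal (w x))"
    using radon_eq_density[OF radon_lam] by (simp add: w_def)
qed (rule w_positive)

text \<open>Evaluate the associativity of \<open>\<delta>\<^bsub>tilde x\<^esub> * \<delta>\<^sub>a * \<delta>\<^sub>y\<close> at the set \<open>{e}\<close>: one term of each sum survives.\<close>

lemma coef_rotate: "w y * coef a y x = w x * coef (tilde x) a (tilde y)"
proof -
  have "(\<Sum>z\<in>supp (tilde x) a. coef (tilde x) a z * coef z y e) =
      (\<Sum>z\<in>supp a y. coef a y z * coef (tilde x) z e)"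
    by (rule coef_assoc)
  moreover have "(\<Sum>z\<in>supp (tilde x) a. coef (tilde x) a z * coef z y e) =
      coef (tilde x) a (tilde y) * coef (tilde y) y e"
    using coef_e_iff by (intro sum_supp_single) blast
  moreover have "coef (tilde x) z e = 0" if "z \<noteq> x" for z
    using coef_e_iff[of "tilde x" z] that tilde_tilde by metis
  then have "(\<Sum>z\<in>supp a y. coef a y z * coef (tilde x) z e) = coef a y x * coef (tilde x) x e"
    by (intro sum_supp_single)
  ultimately have "coef (tilde x) a (tilde y) * coef (tilde y) y e = coef a y x * coef (tilde x) x e"
    by simp
  \<comment> \<open>By \<open>w_coef_e\<close> each coefficient at \<open>e\<close> absorbs one of
    the two weights and becomes \<open>w e\<close>, which then cancels.\<close>
  then have "w x * w y * (coef (tilde x) a (tilde y) * coef (tilde y) y e) =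
      w x * w y * (coef a y x * coef (tilde x) x e)" by simp
  then have "w x * coef (tilde x) a (tilde y) * w e = w y * coef a y x * w e"
    using w_coef_e[of x] w_coef_e[of y] by (metis mult.assoc mult.commute)
  then show ?thesis by simp
qed

text \<open>Detailed balance. Since \<open>coef (tilde t)\<close> is the kernel of translation by
  \<open>t\<close>, this makes translation by \<open>tilde t\<close> the adjoint of translation by
  \<open>t\<close> in L2. It combines \<open>coef_rotate\<close> with the involution.\<close>

lemma coef_adjoint: "w y * coef a y x = w x * coef (tilde a) x y"
  using coef_rotate[of y a x] coef_tilde[of x "tilde a" "tilde y"] by (simp add: tilde_tilde)

text \<open>Rotations and the involution move \<open>t\<close> from the first to the last argument
  of the coefficient, where the support of a single product confines it. This makes coefficients of
  finitely supported vectors finitely supported.\<close>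

lemma finite_translates: "finite {t. coef (tilde t) y x \<noteq> 0}"
proof (rule finite_subset)
  show "{t. coef (tilde t) y x \<noteq> 0} \<subseteq> supp y (tilde x)"
  proof
    fix t assume "t \<in> {t. coef (tilde t) y x \<noteq> 0}"
    then have "coef (tilde x) (tilde t) (tilde y) \<noteq> 0"
      using coef_rotate[of y "tilde t" x] by auto
    then have "coef y (tilde x) t \<noteq> 0"
      using coef_rotate[of "tilde t" "tilde x" "tilde y"] coef_adjoint[of "tilde t" "tilde x" "tilde y"]
        coef_rotate[of "tilde x" y t] by (auto simp: tilde_tilde)
    then show "t \<in> supp y (tilde x)" by (simp add: in_supp_iff)
  qed
qed (rule finite_msupport)

section \<open>Translations as contractions of L2\<close>

abbreviation L :: "'a \<Rightarrow> ('a \<Rightarrow> complex) \<Rightarrow> 'a \<Rightarrow> complex" where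
  "L \<equiv> ltrans conv tilde"

lemma ltrans_sum: "L t f y = (\<Sum>z\<in>supp (tilde t) y. complex_of_real (coef (tilde t) y z) * f z)"
  unfolding ltrans_def integral_pconv by (simp add: scaleR_conv_of_real)

text \<open>A common index set for different \<open>y\<close> is what permits exchanging sums over
  kernels.\<close>

lemma ltrans_sum_superset:
  assumes "finite S" "supp (tilde t) y \<subseteq> S"
  shows "L t f y = (\<Sum>z\<in>S. complex_of_real (coef (tilde t) y z) * f z)"
  unfolding ltrans_sum using assms by (intro sum.mono_neutral_left) (auto simp: in_supp_iff)

lemma ltrans_lin: "L t (\<lambda>x. c * f x + g x) y = c * L t f y + L t g y"
  by (simp add: ltrans_sum algebra_simps sum.distrib sum_distrib_left)

lemma ltrans_e [simp]: "L e f = f"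
  by (rule ext) (simp add: ltrans_sum coef_identity_left)

lemma cmod_ltrans_le: "cmod (L t f y) \<le> (\<Sum>z\<in>supp (tilde t) y. coef (tilde t) y z * cmod (f z))"
  unfolding ltrans_sum by (rule order_trans[OF norm_sum]) (simp add: norm_mult)

lemma sum_coef_le: "finite F \<Longrightarrow> (\<Sum>y\<in>F. coef a z y) \<le> 1"
  using pconv.finite_measure_eq_sum_singleton[of F a z] pconv.prob_le_1[of a z F]
  by (simp add: coef_def)

text \<open>A Schur test. The rows of the kernel sum to 1, which gives the pointwise Jensen bound;
  detailed balance turns its weighted column sums into row sums of \<open>coef t\<close>, which are
  at most 1.\<close>

lemma sum_ltrans_le:
  assumes f: "f \<in> L2 lam" and F: "finite F"
  shows "(\<Sum>y\<in>F. w y * (cmod (L t f y))\<^sup>2) \<le> (l2_norm lam f)\<^sup>2"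
proof -
  let ?k = "coef (tilde t)"
  define G where "G = (\<Union>y\<in>F. supp (tilde t) y)"
  have G: "finite G" using F by (auto simp: G_def finite_msupport)
  have "(cmod (L t f y))\<^sup>2 \<le> (\<Sum>z\<in>G. ?k y z * (cmod (f z))\<^sup>2)" if "y \<in> F" for y
  proof -
    let ?S = "supp (tilde t) y"
    have "0 \<le> (\<Sum>i\<in>?S. ?k y i * (cmod (f i) - (\<Sum>j\<in>?S. ?k y j * cmod (f j)))\<^sup>2)"
      by (intro sum_nonneg mult_nonneg_nonneg) auto
    also have "\<dots> = (\<Sum>z\<in>?S. ?k y z * (cmod (f z))\<^sup>2) - (\<Sum>j\<in>?S. ?k y j * cmod (f j))\<^sup>2"
      by (rule weighted_variance[OF sum_coef])
    finally have "(\<Sum>j\<in>?S. ?k y j * cmod (f j))\<^sup>2 \<le> (\<Sum>z\<in>?S. ?k y z * (cmod (f z))\<^sup>2)" by simp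
    moreover have "(cmod (L t f y))\<^sup>2 \<le> (\<Sum>j\<in>?S. ?k y j * cmod (f j))\<^sup>2"
      by (intro power_mono cmod_ltrans_le) simp
    moreover have "(\<Sum>z\<in>?S. ?k y z * (cmod (f z))\<^sup>2) \<le> (\<Sum>z\<in>G. ?k y z * (cmod (f z))\<^sup>2)"
      using that G by (intro sum_mono2) (auto simp: G_def)
    ultimately show ?thesis by linarith
  qed
  then have "(\<Sum>y\<in>F. w y * (cmod (L t f y))\<^sup>2) \<le> (\<Sum>y\<in>F. w y * (\<Sum>z\<in>G. ?k y z * (cmod (f z))\<^sup>2))"
    by (intro sum_mono mult_left_mono) auto
  also have "\<dots> = (\<Sum>y\<in>F. \<Sum>z\<in>G. w z * (cmod (f z))\<^sup>2 * coef t z y)"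
    using coef_adjoint[of _ "tilde t"]
    by (simp add: sum_distrib_left mult.assoc[symmetric] tilde_tilde) (simp add: mult_ac)
  also have "\<dots> = (\<Sum>z\<in>G. w z * (cmod (f z))\<^sup>2 * (\<Sum>y\<in>F. coef t z y))"
    by (subst sum.swap) (simp add: sum_distrib_left)
  also have "\<dots> \<le> (\<Sum>z\<in>G. w z * (cmod (f z))\<^sup>2 * 1)"
    by (intro sum_mono mult_left_mono sum_coef_le F) auto
  also have "\<dots> \<le> (l2_norm lam f)\<^sup>2"
    using sum_le_l2_norm[OF f G] by simp
  finally show ?thesis .
qed

lemma
  assumes "f \<in> L2 lam"
  shows ltrans_L2: "L t f \<in> L2 lam" and l2_norm_ltrans_le: "l2_norm lam (L t f) \<le> l2_norm lam f"
  using L2_boundI[OF sum_ltrans_le[OF assms]] by auto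

text \<open>Composing two kernels is associativity of the coefficients. As the kernel of
  \<open>L t\<close> is \<open>coef (tilde t)\<close>, the factors come out in reversed
  order.\<close>

lemma ltrans_ltrans:
  "L s (L t f) y = (\<Sum>r\<in>supp (tilde t) (tilde s). complex_of_real (coef (tilde t) (tilde s) r) * L (tilde r) f y)"
proof -
  let ?S = "supp (tilde s) y" and ?R = "supp (tilde t) (tilde s)"
  \<comment> \<open>Large enough for both iterated sums: the points reached from \<open>y\<close> in
    two steps, and those reached by the kernels \<open>coef r\<close>.\<close>
  define G where "G = (\<Union>z\<in>?S. supp (tilde t) z) \<union> (\<Union>r\<in>?R. supp r y)"
  have G: "finite G" by (auto simp: G_def finite_msupport)
  have "L s (L t f) y = (\<Sum>z\<in>?S. complex_of_real (coef (tilde s) y z) *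
      (\<Sum>x\<in>G. complex_of_real (coef (tilde t) z x) * f x))"
    unfolding ltrans_sum[of s] using G
    by (intro sum.cong refl arg_cong2[where f = "(*)"] ltrans_sum_superset) (auto simp: G_def)
  also have "\<dots> = (\<Sum>x\<in>G. complex_of_real (\<Sum>z\<in>?S. coef (tilde s) y z * coef (tilde t) z x) * f x)"
    by (simp add: sum_distrib_left sum_distrib_right mult.assoc) (rule sum.swap)
  also have "\<dots> = (\<Sum>x\<in>G. complex_of_real (\<Sum>r\<in>?R. coef (tilde t) (tilde s) r * coef r y x) * f x)"
    by (simp only: coef_assoc)
  also have "\<dots> = (\<Sum>r\<in>?R. complex_of_real (coef (tilde t) (tilde s) r) *
      (\<Sum>x\<in>G. complex_of_real (coef r y x) * f x))"
    by (simp add: sum_distrib_left sum_distrib_right mult.assoc) (rule sum.swap)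
  also have "\<dots> = (\<Sum>r\<in>?R. complex_of_real (coef (tilde t) (tilde s) r) * L (tilde r) f y)"
    using G by (intro sum.cong refl arg_cong2[where f = "(*)"] ltrans_sum_superset[symmetric,
          of _ "tilde _", unfolded tilde_tilde]) (auto simp: G_def)
  finally show ?thesis .
qed

section \<open>Convolution operators on L2\<close>

abbreviation H :: "('a \<Rightarrow> complex) \<Rightarrow> 'a operator" where
  "H \<equiv> hconv conv tilde lam"

text \<open>For fixed \<open>x\<close> the values \<open>L t \<xi> x\<close> are bounded uniformly
  in \<open>t\<close>, because translations are contractions and point evaluation is
  continuous.\<close>

lemma hconv_integrable:
  assumes "integrable lam f" "\<xi> \<in> L2 lam"
  shows "integrable lam (\<lambda>t. f t * L t \<xi> x)"
proof (rule Bochner_Integration.integrable_bound)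
  show "integrable lam (\<lambda>t. (l2_norm lam \<xi> / sqrt (w x)) * norm (f t))"
    using assms(1) by simp
  have "cmod (L t \<xi> x) \<le> l2_norm lam \<xi> / sqrt (w x)" for t
    using L2_pointwise[OF ltrans_L2[OF assms(2)], of t x] l2_norm_ltrans_le[OF assms(2), of t]
    by (meson divide_right_mono order_trans real_sqrt_ge_zero w_nonneg)
  then have "cmod (f t) * cmod (L t \<xi> x) \<le> cmod (f t) * (l2_norm lam \<xi> / sqrt (w x))" for t
    by (intro mult_left_mono) auto
  then show "AE t in lam. norm (f t * L t \<xi> x) \<le> norm ((l2_norm lam \<xi> / sqrt (w x)) * norm (f t))"
    by (intro AE_I2) (simp add: norm_mult mult.commute)
qed simp

lemma hconv_lin:
  assumes "integrable lam f" "\<xi> \<in> L2 lam" "\<eta> \<in> L2 lam"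
  shows "H f (\<lambda>x. c * \<xi> x + \<eta> x) y = c * H f \<xi> y + H f \<eta> y"
proof -
  have "H f (\<lambda>x. c * \<xi> x + \<eta> x) y = (\<integral>t. c * (f t * L t \<xi> y) + f t * L t \<eta> y \<partial>lam)"
    unfolding hconv_def ltrans_lin by (simp add: algebra_simps)
  then show ?thesis using hconv_integrable[OF assms(1,2), of y] hconv_integrable[OF assms(1,3), of y]
    by (simp add: hconv_def)
qed

lemma l2_inner_finite:
  assumes "finite F" "\<And>x. x \<notin> F \<Longrightarrow> \<eta> x = 0"
  shows "l2_inner lam \<xi> \<eta> = (\<Sum>x\<in>F. complex_of_real (w x) * (\<xi> x * cnj (\<eta> x)))"
  unfolding l2_inner_def using integral_finite[OF assms(1), of "\<lambda>x. \<xi> x * cnj (\<eta> x)"] assms(2)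
  by (simp add: scaleR_conv_of_real)

text \<open>The weak form of \<open>H f\<close> as an integral of translations. For finitely
  supported \<open>\<eta>\<close> the inner product is a finite sum, so finite additivity of the
  integral suffices. It also identifies the function represented by a vector functional.\<close>

lemma
  assumes f: "integrable lam f" and \<xi>: "\<xi> \<in> L2 lam" and F: "finite F" "\<And>x. x \<notin> F \<Longrightarrow> \<eta> x = 0"
  shows hconv_inner_integrable: "integrable lam (\<lambda>t. f t * l2_inner lam (L t \<xi>) \<eta>)"
    and hconv_inner: "l2_inner lam (H f \<xi>) \<eta> = (\<integral>t. f t * l2_inner lam (L t \<xi>) \<eta> \<partial>lam)"
proof -
  have fin: "l2_inner lam \<zeta> \<eta> = (\<Sum>x\<in>F. complex_of_real (w x) * (\<zeta> x * cnj (\<eta> x)))" for \<zeta>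
    by (rule l2_inner_finite[OF F])
  have eq: "f t * l2_inner lam (L t \<xi>) \<eta> =
      (\<Sum>x\<in>F. (complex_of_real (w x) * cnj (\<eta> x)) * (f t * L t \<xi> x))" for t
    unfolding fin by (simp add: sum_distrib_left mult_ac)
  show "integrable lam (\<lambda>t. f t * l2_inner lam (L t \<xi>) \<eta>)"
    unfolding eq by (intro Bochner_Integration.integrable_sum integrable_mult_right hconv_integrable[OF f \<xi>])
  have "(\<integral>t. f t * l2_inner lam (L t \<xi>) \<eta> \<partial>lam) =
      (\<Sum>x\<in>F. (complex_of_real (w x) * cnj (\<eta> x)) * H f \<xi> x)"
    unfolding eq hconv_def using hconv_integrable[OF f \<xi>]
    by (subst Bochner_Integration.integral_sum) auto
  also have "\<dots> = l2_inner lam (H f \<xi>) \<eta>"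
    unfolding fin by (simp add: mult_ac)
  finally show "l2_inner lam (H f \<xi>) \<eta> = (\<integral>t. f t * l2_inner lam (L t \<xi>) \<eta> \<partial>lam)" ..
qed

text \<open>Testing against finitely supported vectors avoids any interchange of infinite sums.\<close>

lemma
  assumes f: "integrable lam f" and \<xi>: "\<xi> \<in> L2 lam"
  shows hconv_L2: "H f \<xi> \<in> L2 lam"
    and l2_norm_hconv_le: "l2_norm lam (H f \<xi>) \<le> (\<integral>t. cmod (f t) \<partial>lam) * l2_norm lam \<xi>"
proof -
  let ?C = "(\<integral>t. cmod (f t) \<partial>lam) * l2_norm lam \<xi>"
  have "(\<Sum>x\<in>F. w x * (cmod (H f \<xi> x))\<^sup>2) \<le> ?C\<^sup>2" if F: "finite F" for F
  proof -
    \<comment> \<open>Testing against the truncation of \<open>H f \<xi>\<close> itself turns the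
      pairing into a square norm, of which one factor is cancelled at the end.\<close>
    let ?\<eta> = "restr F (H f \<xi>)"
    have \<eta>: "?\<eta> \<in> L2 lam" by (intro finite_support_L2 finite_support_restr F)
    have b: "cmod (f t * l2_inner lam (L t \<xi>) ?\<eta>) \<le> cmod (f t) * (l2_norm lam \<xi> * l2_norm lam ?\<eta>)" for t
    proof -
      have "cmod (l2_inner lam (L t \<xi>) ?\<eta>) \<le> l2_norm lam (L t \<xi>) * l2_norm lam ?\<eta>"
        by (rule l2_Cauchy_Schwarz[OF ltrans_L2[OF \<xi>] \<eta>])
      also have "\<dots> \<le> l2_norm lam \<xi> * l2_norm lam ?\<eta>"
        by (intro mult_right_mono l2_norm_ltrans_le \<xi>) simp
      finally show ?thesis by (simp add: norm_mult mult_left_mono)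
    qed
    have "(l2_norm lam ?\<eta>)\<^sup>2 = cmod (l2_inner lam (H f \<xi>) ?\<eta>)"
      by (simp add: l2_inner_restr norm_power)
    also have "\<dots> = cmod (\<integral>t. f t * l2_inner lam (L t \<xi>) ?\<eta> \<partial>lam)"
      by (subst hconv_inner[OF f \<xi> F]) (auto simp: restr_def)
    also have "\<dots> \<le> (\<integral>t. cmod (f t) * (l2_norm lam \<xi> * l2_norm lam ?\<eta>) \<partial>lam)"
    proof (rule order_trans[OF integral_norm_bound integral_mono])
      have "integrable lam (\<lambda>t. f t * l2_inner lam (L t \<xi>) ?\<eta>)"
        by (rule hconv_inner_integrable[OF f \<xi> F]) (simp add: restr_def)
      then show "integrable lam (\<lambda>t. norm (f t * l2_inner lam (L t \<xi>) ?\<eta>))"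
        by (rule integrable_norm)
    qed (use f b in auto)
    also have "\<dots> = ?C * l2_norm lam ?\<eta>" by simp
    finally have "l2_norm lam ?\<eta> \<le> ?C"
      by (cases "l2_norm lam ?\<eta> = 0") (auto simp: power2_eq_square less_le)
    moreover have "(l2_norm lam ?\<eta>)\<^sup>2 = (\<Sum>x\<in>F. w x * (cmod (H f \<xi> x))\<^sup>2)"
      unfolding l2_norm_sq by (subst integral_finite[OF F]) (auto simp: restr_def)
    ultimately show ?thesis by (metis l2_norm_nonneg power_mono)
  qed
  moreover have "0 \<le> ?C" by simp
  ultimately show "H f \<xi> \<in> L2 lam" "l2_norm lam (H f \<xi>) \<le> ?C"
    by (blast intro: L2_boundI)+
qed

lemma hconv_bounded_op: "integrable lam f \<Longrightarrow> H f \<in> bounded_ops lam"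
  unfolding bounded_ops_def AE_iff
  by (auto simp: hconv_L2 hconv_lin intro!: l2_norm_hconv_le exI[of _ "\<integral>t. cmod (f t) \<partial>lam"])

end

section \<open>Normal functionals\<close>

text \<open>The kernel lemma of linear algebra, by induction on \<open>W\<close>. The operators are
  not elements of a vector space type, so the linear structure is passed as one operation
  \<open>lin c S T\<close>, standing for c S + T.\<close>

lemma functional_in_span:
  fixes \<phi> :: "'v \<Rightarrow> complex" and lin :: "complex \<Rightarrow> 'v \<Rightarrow> 'v \<Rightarrow> 'v"
  assumes "finite W"
    and closed: "\<And>c S T. S \<in> N \<Longrightarrow> T \<in> N \<Longrightarrow> lin c S T \<in> N"
    and lin_W: "\<And>\<omega> c S T. \<omega> \<in> W \<Longrightarrow> S \<in> N \<Longrightarrow> T \<in> N \<Longrightarrow> \<omega> (lin c S T) = c * \<omega> S + \<omega> T"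
    and lin_\<phi>: "\<And>c S T. S \<in> N \<Longrightarrow> T \<in> N \<Longrightarrow> \<phi> (lin c S T) = c * \<phi> S + \<phi> T"
    and ker: "\<And>T. T \<in> N \<Longrightarrow> (\<And>\<omega>. \<omega> \<in> W \<Longrightarrow> \<omega> T = 0) \<Longrightarrow> \<phi> T = 0"
  shows "\<exists>c. \<forall>T\<in>N. \<phi> T = (\<Sum>\<omega>\<in>W. c \<omega> * \<omega> T)"
  using assms(1) lin_W lin_\<phi> ker
proof (induction W arbitrary: \<phi>)
  case empty
  then show ?case by auto
next
  case (insert \<omega>0 W)
  show ?case
  proof (cases "\<exists>T0\<in>N. (\<forall>\<omega>\<in>W. \<omega> T0 = 0) \<and> \<omega>0 T0 \<noteq> 0")
    case True
    then obtain T0 where T0: "T0 \<in> N" "\<And>\<omega>. \<omega> \<in> W \<Longrightarrow> \<omega> T0 = 0" "\<omega>0 T0 \<noteq> 0" by blast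
    \<comment> \<open>This \<open>d\<close> makes \<open>\<phi>\<close> minus \<open>d\<close> times
      \<open>\<omega>0\<close> vanish at \<open>T0\<close>. Any \<open>T\<close> in the kernel of
      \<open>W\<close> can be moved along \<open>T0\<close> into the kernel of
      \<open>\<omega>0\<close>, so the difference vanishes on the kernel of
      \<open>W\<close>.\<close>
    define d where "d = \<phi> T0 / \<omega>0 T0"
    have "\<exists>c. \<forall>T\<in>N. \<phi> T - d * \<omega>0 T = (\<Sum>\<omega>\<in>W. c \<omega> * \<omega> T)"
    proof (rule insert.IH)
      fix T assume T: "T \<in> N" "\<And>\<omega>. \<omega> \<in> W \<Longrightarrow> \<omega> T = 0"
      let ?T = "lin (- (\<omega>0 T / \<omega>0 T0)) T0 T"
      have "?T \<in> N" using T T0 closed by blast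
      moreover have "\<omega> ?T = 0" if "\<omega> \<in> insert \<omega>0 W" for \<omega>
      proof (cases "\<omega> = \<omega>0")
        case True
        then show ?thesis
          using T0(3) insert.prems(1)[OF that T0(1) T(1), of "- (\<omega>0 T / \<omega>0 T0)"] by simp
      next
        case False
        then show ?thesis
          using that T0(2)[of \<omega>] T(2)[of \<omega>] insert.prems(1)[OF that T0(1) T(1), of "- (\<omega>0 T / \<omega>0 T0)"]
          by simp
      qed
      ultimately have "\<phi> ?T = 0" by (rule insert.prems(3))
      then show "\<phi> T - d * \<omega>0 T = 0"
        using insert.prems(2)[OF T0(1) T(1)] by (simp add: d_def field_simps)
    next
      fix c S T assume "S \<in> N" "T \<in> N"
      then show "\<phi> (lin c S T) - d * \<omega>0 (lin c S T) = c * (\<phi> S - d * \<omega>0 S) + (\<phi> T - d * \<omega>0 T)"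
        using insert.prems(2)[of S T c] insert.prems(1)[of \<omega>0 S T c] by (simp add: algebra_simps)
    qed (use insert.prems in auto)
    then obtain c where c: "\<And>T. T \<in> N \<Longrightarrow> \<phi> T - d * \<omega>0 T = (\<Sum>\<omega>\<in>W. c \<omega> * \<omega> T)" by blast
    have "\<phi> T = (\<Sum>\<omega>\<in>insert \<omega>0 W. (c(\<omega>0 := d)) \<omega> * \<omega> T)" if "T \<in> N" for T
    proof -
      have "(\<Sum>\<omega>\<in>W. (c(\<omega>0 := d)) \<omega> * \<omega> T) = (\<Sum>\<omega>\<in>W. c \<omega> * \<omega> T)"
        using insert.hyps by (intro sum.cong) auto
      then show ?thesis using c[OF that] insert.hyps by (simp add: algebra_simps)
    qed
    then show ?thesis by blast
  next
    case False
    \<comment> \<open>Here \<open>\<omega>0\<close> vanishes on the common kernel of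
      \<open>W\<close>, so the kernel condition already holds for \<open>W\<close> and
      \<open>\<omega>0\<close> receives the coefficient 0.\<close>
    have "\<exists>c. \<forall>T\<in>N. \<phi> T = (\<Sum>\<omega>\<in>W. c \<omega> * \<omega> T)"
    proof (rule insert.IH)
      fix T assume T: "T \<in> N" "\<And>\<omega>. \<omega> \<in> W \<Longrightarrow> \<omega> T = 0"
      with False have "\<omega> T = 0" if "\<omega> \<in> insert \<omega>0 W" for \<omega> using that by auto
      with T(1) show "\<phi> T = 0" by (rule insert.prems(3))
    qed (use insert.prems in auto)
    then obtain c where c: "\<And>T. T \<in> N \<Longrightarrow> \<phi> T = (\<Sum>\<omega>\<in>W. c \<omega> * \<omega> T)" by blast
    have "\<phi> T = (\<Sum>\<omega>\<in>insert \<omega>0 W. (c(\<omega>0 := 0)) \<omega> * \<omega> T)" if "T \<in> N" for T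
    proof -
      have "(\<Sum>\<omega>\<in>W. (c(\<omega>0 := 0)) \<omega> * \<omega> T) = (\<Sum>\<omega>\<in>W. c \<omega> * \<omega> T)"
        using insert.hyps by (intro sum.cong) auto
      then show ?thesis using c[OF that] insert.hyps by simp
    qed
    then show ?thesis by blast
  qed
qed

context discrete_measure
begin

section \<open>Bounded operators and generated von Neumann algebras\<close>

lemma bounded_opD:
  assumes "T \<in> bounded_ops M"
  shows "\<xi> \<in> L2 M \<Longrightarrow> T \<xi> \<in> L2 M"
    and "\<xi> \<in> L2 M \<Longrightarrow> \<eta> \<in> L2 M \<Longrightarrow> T (\<lambda>t. c * \<xi> t + \<eta> t) = (\<lambda>x. c * T \<xi> x + T \<eta> x)"
    and "\<exists>C\<ge>0. \<forall>\<xi>\<in>L2 M. l2_norm M (T \<xi>) \<le> C * l2_norm M \<xi>"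
proof -
  show "\<xi> \<in> L2 M \<Longrightarrow> T \<xi> \<in> L2 M"
    and "\<xi> \<in> L2 M \<Longrightarrow> \<eta> \<in> L2 M \<Longrightarrow> T (\<lambda>t. c * \<xi> t + \<eta> t) = (\<lambda>x. c * T \<xi> x + T \<eta> x)"
    using assms by (auto simp: bounded_ops_def AE_iff)
  obtain C where "\<And>\<xi>. \<xi> \<in> L2 M \<Longrightarrow> l2_norm M (T \<xi>) \<le> C * l2_norm M \<xi>"
    using assms unfolding bounded_ops_def by blast
  then have "l2_norm M (T \<xi>) \<le> \<bar>C\<bar> * l2_norm M \<xi>" if "\<xi> \<in> L2 M" for \<xi>
    using that by (meson abs_ge_self l2_norm_nonneg mult_right_mono order_trans)
  then show "\<exists>C\<ge>0. \<forall>\<xi>\<in>L2 M. l2_norm M (T \<xi>) \<le> C * l2_norm M \<xi>"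
    by (intro exI[of _ "\<bar>C\<bar>"]) auto
qed

lemma bounded_opI:
  assumes "\<And>\<xi>. \<xi> \<in> L2 M \<Longrightarrow> T \<xi> \<in> L2 M"
    and "\<And>\<xi> \<eta> c x. \<xi> \<in> L2 M \<Longrightarrow> \<eta> \<in> L2 M \<Longrightarrow> T (\<lambda>t. c * \<xi> t + \<eta> t) x = c * T \<xi> x + T \<eta> x"
    and "\<And>\<xi>. \<xi> \<in> L2 M \<Longrightarrow> l2_norm M (T \<xi>) \<le> C * l2_norm M \<xi>"
  shows "T \<in> bounded_ops M"
  unfolding bounded_ops_def AE_iff using assms by blast

lemma bounded_op_zero:
  assumes "T \<in> bounded_ops M"
  shows "T (\<lambda>t. 0) = (\<lambda>x. 0)"
proof
  fix x
  have "T (\<lambda>t. 1 * 0 + 0) x = 1 * T (\<lambda>t. 0) x + T (\<lambda>t. 0) x"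
    by (subst bounded_opD(2)[OF assms]) auto
  then show "T (\<lambda>t. 0) x = 0" by simp
qed

lemma bounded_op_scale:
  assumes "T \<in> bounded_ops M" "\<xi> \<in> L2 M"
  shows "T (\<lambda>t. c * \<xi> t) = (\<lambda>x. c * T \<xi> x)"
  using bounded_opD(2)[OF assms(1) assms(2) L2_zero, of c] bounded_op_zero[OF assms(1)] by simp

lemma bounded_op_diff:
  assumes "T \<in> bounded_ops M" "\<xi> \<in> L2 M" "\<eta> \<in> L2 M"
  shows "T (\<lambda>t. \<xi> t - \<eta> t) = (\<lambda>x. T \<xi> x - T \<eta> x)"
  using bounded_opD(2)[OF assms(1) assms(3) assms(2), of "-1"] by simp

lemma op_norm_upper:
  assumes T: "T \<in> bounded_ops M" and "\<xi> \<in> L2 M" "l2_norm M \<xi> \<le> 1"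
  shows "l2_norm M (T \<xi>) \<le> op_norm M T"
proof -
  obtain C where C: "C \<ge> 0" "\<And>\<xi>. \<xi> \<in> L2 M \<Longrightarrow> l2_norm M (T \<xi>) \<le> C * l2_norm M \<xi>"
    using bounded_opD(3)[OF T] by blast
  have "l2_norm M (T \<xi>) \<le> C" if "\<xi> \<in> L2 M" "l2_norm M \<xi> \<le> 1" for \<xi>
    using C(2)[OF that(1)] mult_left_mono[OF that(2) C(1)] by simp
  then have "bdd_above {l2_norm M (T \<xi>) |\<xi>. \<xi> \<in> L2 M \<and> l2_norm M \<xi> \<le> 1}"
    by (auto intro!: bdd_aboveI[of _ C])
  then show ?thesis unfolding op_norm_def using assms by (intro cSup_upper) auto
qed

lemma op_norm_leI:
  assumes "\<And>\<xi>. \<xi> \<in> L2 M \<Longrightarrow> l2_norm M \<xi> \<le> 1 \<Longrightarrow> l2_norm M (T \<xi>) \<le> C"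
  shows "op_norm M T \<le> C"
  unfolding op_norm_def
proof (rule cSup_least)
  show "{l2_norm M (T \<xi>) |\<xi>. \<xi> \<in> L2 M \<and> l2_norm M \<xi> \<le> 1} \<noteq> {}"
    by (auto intro!: exI[of _ "\<lambda>x. 0"])
qed (use assms in auto)

lemma op_norm_bound:
  assumes T: "T \<in> bounded_ops M" and \<xi>: "\<xi> \<in> L2 M"
  shows "l2_norm M (T \<xi>) \<le> op_norm M T * l2_norm M \<xi>"
proof (cases "l2_norm M \<xi> = 0")
  case True
  then show ?thesis using bounded_opD(3)[OF T] \<xi> by force
next
  case False
  then have pos: "l2_norm M \<xi> > 0" by (simp add: less_le)
  let ?c = "complex_of_real (inverse (l2_norm M \<xi>))"
  have c: "cmod ?c = inverse (l2_norm M \<xi>)" by (simp add: norm_inverse)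
  have "l2_norm M (T (\<lambda>t. ?c * \<xi> t)) \<le> op_norm M T"
    using \<xi> pos by (intro op_norm_upper[OF T] L2_scale) (simp_all only: l2_norm_scale c, simp)
  then have "inverse (l2_norm M \<xi>) * l2_norm M (T \<xi>) \<le> op_norm M T"
    unfolding bounded_op_scale[OF T \<xi>] l2_norm_scale c .
  then show ?thesis using pos by (simp add: field_simps)
qed

lemma l2_inner_op_bound:
  assumes "T \<in> bounded_ops M" "op_norm M T \<le> 1" "\<xi> \<in> L2 M" "\<eta> \<in> L2 M"
  shows "cmod (l2_inner M (T \<xi>) \<eta>) \<le> l2_norm M \<xi> * l2_norm M \<eta>"
proof -
  have "cmod (l2_inner M (T \<xi>) \<eta>) \<le> l2_norm M (T \<xi>) * l2_norm M \<eta>"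
    using assms by (intro l2_Cauchy_Schwarz bounded_opD(1)[OF assms(1)])
  also have "l2_norm M (T \<xi>) \<le> op_norm M T * l2_norm M \<xi>" using assms by (intro op_norm_bound)
  also have "\<dots> \<le> 1 * l2_norm M \<xi>" using assms by (intro mult_right_mono) auto
  finally show ?thesis by (simp add: mult_right_mono)
qed

lemma bounded_ops_lin:
  assumes S: "S \<in> bounded_ops M" and T: "T \<in> bounded_ops M"
  shows "(\<lambda>\<xi> x. c * S \<xi> x + T \<xi> x) \<in> bounded_ops M"
proof (rule bounded_opI[where C = "cmod c * op_norm M S + op_norm M T"])
  fix \<xi> assume \<xi>: "\<xi> \<in> L2 M"
  show "(\<lambda>x. c * S \<xi> x + T \<xi> x) \<in> L2 M"
    by (intro L2_lin bounded_opD(1)[OF S] bounded_opD(1)[OF T] \<xi>)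
  have "l2_norm M (\<lambda>x. c * S \<xi> x + T \<xi> x) \<le> l2_norm M (\<lambda>x. c * S \<xi> x) + l2_norm M (T \<xi>)"
    by (intro l2_norm_triangle L2_scale bounded_opD(1)[OF S] bounded_opD(1)[OF T] \<xi>)
  also have "\<dots> \<le> cmod c * (op_norm M S * l2_norm M \<xi>) + op_norm M T * l2_norm M \<xi>"
    unfolding l2_norm_scale by (intro add_mono mult_left_mono op_norm_bound S T \<xi>) simp
  finally show "l2_norm M (\<lambda>x. c * S \<xi> x + T \<xi> x) \<le> (cmod c * op_norm M S + op_norm M T) * l2_norm M \<xi>"
    by (simp add: algebra_simps)
next
  fix \<xi> \<eta> d x assume L: "\<xi> \<in> L2 M" "\<eta> \<in> L2 M"
  show "c * S (\<lambda>t. d * \<xi> t + \<eta> t) x + T (\<lambda>t. d * \<xi> t + \<eta> t) x =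
      d * (c * S \<xi> x + T \<xi> x) + (c * S \<eta> x + T \<eta> x)"
    unfolding bounded_opD(2)[OF S L] bounded_opD(2)[OF T L] by (simp add: algebra_simps)
qed

lemma commutant_lin:
  assumes "C \<subseteq> bounded_ops M" "S \<in> commutant M C" "T \<in> commutant M C"
  shows "(\<lambda>\<xi> x. c * S \<xi> x + T \<xi> x) \<in> commutant M C"
proof -
  have B: "S \<in> bounded_ops M" "T \<in> bounded_ops M" using assms by (auto simp: commutant_def)
  have "c * S (R \<xi>) x + T (R \<xi>) x = R (\<lambda>x. c * S \<xi> x + T \<xi> x) x" if "R \<in> C" "\<xi> \<in> L2 M" for R \<xi> x
  proof -
    have "R \<in> bounded_ops M" using that assms by auto
    then have "R (\<lambda>x. c * S \<xi> x + T \<xi> x) = (\<lambda>x. c * R (S \<xi>) x + R (T \<xi>) x)"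
      using that by (intro bounded_opD(2) bounded_opD(1)[OF B(1)] bounded_opD(1)[OF B(2)])
    then show ?thesis using that assms by (auto simp: commutant_def AE_iff)
  qed
  then show ?thesis using bounded_ops_lin[OF B] by (simp add: commutant_def AE_iff)
qed

text \<open>For generators that are bounded operators, this puts an algebra of bounded operators
  into the family intersected in \<open>vn_generated\<close>, so that the generated algebra consists
  of bounded operators.\<close>

lemma von_neumann_algebra_bounded_ops: "von_neumann_algebra M (bounded_ops M)"
proof -
  have "T \<in> commutant M (commutant M (bounded_ops M))" if "T \<in> bounded_ops M" for T
    using that by (auto simp: commutant_def AE_iff)
  then show ?thesis
    unfolding von_neumann_algebra_def by (auto simp: commutant_def[of M "commutant M _"])
qed

lemma vn_generated_subset: "G \<subseteq> bounded_ops M \<Longrightarrow> vn_generated M G \<subseteq> bounded_ops M"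
  using von_neumann_algebra_bounded_ops by (auto simp: vn_generated_def)

lemma vn_generated_generator: "T \<in> G \<Longrightarrow> T \<in> vn_generated M G"
  by (auto simp: vn_generated_def)

text \<open>Every von Neumann algebra equals its bicommutant, and commutants are closed under linear
  combinations; this passes to the intersection.\<close>

lemma vn_generated_lin:
  assumes "S \<in> vn_generated M G" "T \<in> vn_generated M G"
  shows "(\<lambda>\<xi> x. c * S \<xi> x + T \<xi> x) \<in> vn_generated M G"
  unfolding vn_generated_def
proof (rule InterI)
  fix N assume N: "N \<in> {N. von_neumann_algebra M N \<and> G \<subseteq> N}"
  then have ST: "S \<in> N" "T \<in> N" using assms by (auto simp: vn_generated_def)
  have eq: "commutant M (commutant M N) = N" using N by (simp add: von_neumann_algebra_def)
  have "commutant M N \<subseteq> bounded_ops M" by (auto simp: commutant_def)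
  from commutant_lin[OF this, of S T c] ST show "(\<lambda>\<xi> x. c * S \<xi> x + T \<xi> x) \<in> N"
    unfolding eq by blast
qed

section \<open>Ultraweakly continuous functionals\<close>

definition vector_series :: "('a operator \<Rightarrow> complex) set" where
  "vector_series = {\<lambda>T. \<Sum>n. l2_inner M (T (\<xi> n)) (\<eta> n) |\<xi> \<eta>. (\<forall>n. \<xi> n \<in> L2 M \<and> \<eta> n \<in> L2 M) \<and>
    summable (\<lambda>n. (l2_norm M (\<xi> n))\<^sup>2) \<and> summable (\<lambda>n. (l2_norm M (\<eta> n))\<^sup>2)}"

lemma summable_l2_norm_mult:
  assumes "summable (\<lambda>n. (l2_norm M (\<xi> n))\<^sup>2)" "summable (\<lambda>n. (l2_norm M (\<eta> n))\<^sup>2)"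
  shows "summable (\<lambda>n::nat. l2_norm M (\<xi> n) * l2_norm M (\<eta> n))"
proof (rule summable_comparison_test')
  show "summable (\<lambda>n. (l2_norm M (\<xi> n))\<^sup>2 + (l2_norm M (\<eta> n))\<^sup>2)"
    using assms by (rule summable_add)
  show "norm (l2_norm M (\<xi> n) * l2_norm M (\<eta> n)) \<le> (l2_norm M (\<xi> n))\<^sup>2 + (l2_norm M (\<eta> n))\<^sup>2" for n
    using sum_squares_bound[of "l2_norm M (\<xi> n)" "l2_norm M (\<eta> n)"]
      mult_nonneg_nonneg[OF l2_norm_nonneg[of M "\<xi> n"] l2_norm_nonneg[of M "\<eta> n"]]
    unfolding real_norm_def by linarith
qed

lemma summable_l2_inner:
  assumes "T \<in> bounded_ops M" "\<forall>n. \<xi> n \<in> L2 M \<and> \<eta> n \<in> L2 M"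
    "summable (\<lambda>n. (l2_norm M (\<xi> n))\<^sup>2)" "summable (\<lambda>n. (l2_norm M (\<eta> n))\<^sup>2)"
  shows "summable (\<lambda>n::nat. l2_inner M (T (\<xi> n)) (\<eta> n))"
proof (rule summable_comparison_test')
  show "summable (\<lambda>n. op_norm M T * (l2_norm M (\<xi> n) * l2_norm M (\<eta> n)))"
    using assms by (intro summable_mult summable_l2_norm_mult)
  fix n
  have "cmod (l2_inner M (T (\<xi> n)) (\<eta> n)) \<le> l2_norm M (T (\<xi> n)) * l2_norm M (\<eta> n)"
    using assms(2) by (intro l2_Cauchy_Schwarz bounded_opD(1)[OF assms(1)]) auto
  also have "\<dots> \<le> (op_norm M T * l2_norm M (\<xi> n)) * l2_norm M (\<eta> n)"
    using assms by (intro mult_right_mono op_norm_bound) auto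
  finally show "norm (l2_inner M (T (\<xi> n)) (\<eta> n)) \<le> op_norm M T * (l2_norm M (\<xi> n) * l2_norm M (\<eta> n))"
    by (simp add: mult.assoc)
qed

lemma vector_series_lin:
  assumes "\<omega> \<in> vector_series" and S: "S \<in> bounded_ops M" and T: "T \<in> bounded_ops M"
  shows "\<omega> (\<lambda>\<xi> x. c * S \<xi> x + T \<xi> x) = c * \<omega> S + \<omega> T"
proof -
  obtain \<xi> \<eta> where \<omega>: "\<omega> = (\<lambda>T. \<Sum>n. l2_inner M (T (\<xi> n)) (\<eta> n))"
    and L: "\<forall>n. \<xi> n \<in> L2 M \<and> \<eta> n \<in> L2 M"
    and s: "summable (\<lambda>n. (l2_norm M (\<xi> n))\<^sup>2)" "summable (\<lambda>n. (l2_norm M (\<eta> n))\<^sup>2)"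
    using assms(1) by (auto simp: vector_series_def)
  have "l2_inner M (\<lambda>x. c * S (\<xi> n) x + T (\<xi> n) x) (\<eta> n) =
      c * l2_inner M (S (\<xi> n)) (\<eta> n) + l2_inner M (T (\<xi> n)) (\<eta> n)" for n
    using L by (intro l2_inner_lin_left bounded_opD(1)[OF S] bounded_opD(1)[OF T]) auto
  then show ?thesis unfolding \<omega>
    using summable_l2_inner[OF S L s] summable_l2_inner[OF T L s]
    by (simp add: suminf_add[symmetric] suminf_mult[symmetric] summable_mult)
qed

lemma vector_in_vector_series:
  assumes "\<xi> \<in> L2 M" "\<eta> \<in> L2 M"
  shows "(\<lambda>T. l2_inner M (T \<xi>) \<eta>) \<in> vector_series"
proof -
  let ?\<xi> = "\<lambda>n::nat. if n = 0 then \<xi> else (\<lambda>x. 0)" and ?\<eta> = "\<lambda>n::nat. if n = 0 then \<eta> else (\<lambda>x. 0)"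
  have "(\<Sum>n. l2_inner M (T (?\<xi> n)) (?\<eta> n)) = l2_inner M (T \<xi>) \<eta>" for T
    by (subst suminf_finite[of "{0}"]) (auto simp: l2_inner_def)
  moreover have "summable (\<lambda>n. (l2_norm M (if n = 0 then f else (\<lambda>x. 0)))\<^sup>2)" for f
    by (rule summable_finite[of "{0::nat}"]) auto
  ultimately show ?thesis using assms unfolding vector_series_def
    by (intro CollectI exI[of _ ?\<xi>] exI[of _ ?\<eta>]) auto
qed

lemma openin_vector_series:
  assumes "\<omega> \<in> vector_series" "open U"
  shows "openin (ultraweak_topology M) {T \<in> bounded_ops M. \<omega> T \<in> U}"
  using assms unfolding ultraweak_topology_def vector_series_def
  by (intro topology_generated_by_Basis) blast

lemma topspace_ultraweak: "topspace (ultraweak_topology M) = bounded_ops M"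
proof
  show "topspace (ultraweak_topology M) \<subseteq> bounded_ops M"
    unfolding ultraweak_topology_def topology_generated_by_topspace by auto
  have "openin (ultraweak_topology M) {T \<in> bounded_ops M. l2_inner M (T (\<lambda>x. 0)) (\<lambda>x. 0) \<in> UNIV}"
    by (intro openin_vector_series vector_in_vector_series) auto
  then show "bounded_ops M \<subseteq> topspace (ultraweak_topology M)"
    by (auto dest: openin_subset)
qed

text \<open>
  Hence an ultraweakly continuous functional vanishes on a finite intersection of kernels of vector
  series, and it is a linear combination of them by pure linear algebra.
\<close>

lemma ultraweak_open_contains_fibre:
  assumes "openin (ultraweak_topology M) X" "T0 \<in> X"
  shows "\<exists>W. finite W \<and> W \<subseteq> vector_series \<and>
    (\<forall>T\<in>bounded_ops M. (\<forall>\<omega>\<in>W. \<omega> T = \<omega> T0) \<longrightarrow> T \<in> X)"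
proof -
  have "generate_topology_on
     {{T \<in> bounded_ops M. (\<Sum>n. l2_inner M (T (\<xi> n)) (\<eta> n)) \<in> U}
        |(\<xi> :: nat \<Rightarrow> 'a \<Rightarrow> complex) (\<eta> :: nat \<Rightarrow> 'a \<Rightarrow> complex) U.
        (\<forall>n. \<xi> n \<in> L2 M \<and> \<eta> n \<in> L2 M) \<and>
        summable (\<lambda>n. (l2_norm M (\<xi> n))\<^sup>2) \<and> summable (\<lambda>n. (l2_norm M (\<eta> n))\<^sup>2) \<and> open U} X"
    using assms(1) unfolding ultraweak_topology_def by (rule openin_topology_generated_by)
  then show ?thesis using assms(2)
  proof (induction rule: generate_topology_on.induct)
    case Empty
    then show ?case by simp
  next
    case (Int a b)
    from Int.IH(1) Int.prems obtain W1 where "finite W1" "W1 \<subseteq> vector_series"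
        "\<forall>T\<in>bounded_ops M. (\<forall>\<omega>\<in>W1. \<omega> T = \<omega> T0) \<longrightarrow> T \<in> a" by blast
    moreover from Int.IH(2) Int.prems obtain W2 where "finite W2" "W2 \<subseteq> vector_series"
        "\<forall>T\<in>bounded_ops M. (\<forall>\<omega>\<in>W2. \<omega> T = \<omega> T0) \<longrightarrow> T \<in> b" by blast
    ultimately show ?case by (intro exI[of _ "W1 \<union> W2"]) auto
  next
    case (UN K)
    then obtain k where "k \<in> K" "T0 \<in> k" by blast
    from UN.IH[OF this] obtain W where "finite W" "W \<subseteq> vector_series"
        "\<forall>T\<in>bounded_ops M. (\<forall>\<omega>\<in>W. \<omega> T = \<omega> T0) \<longrightarrow> T \<in> k" by blast
    with \<open>k \<in> K\<close> show ?case by (intro exI[of _ W]) auto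
  next
    case (Basis s)
    then obtain \<omega> U where "\<omega> \<in> vector_series" "s = {T \<in> bounded_ops M. \<omega> T \<in> U}"
      unfolding vector_series_def by blast
    with Basis.prems show ?case by (intro exI[of _ "{\<omega>}"]) auto
  qed
qed

text \<open>The linear span of the vector functionals of finitely supported vectors. On the
  hypergroup they represent finitely supported functions, so approximation by this set becomes
  density of such functions in the Fourier space.\<close>

inductive_set finite_functionals :: "('a operator \<Rightarrow> complex) set" where
  vector: "finite {x. \<xi> x \<noteq> 0} \<Longrightarrow> finite {x. \<eta> x \<noteq> 0} \<Longrightarrow>
    (\<lambda>T. l2_inner M (T \<xi>) \<eta>) \<in> finite_functionals"
| lin: "\<phi> \<in> finite_functionals \<Longrightarrow> \<psi> \<in> finite_functionals \<Longrightarrow>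
    (\<lambda>T. c * \<phi> T + \<psi> T) \<in> finite_functionals"

end

text \<open>Separates the linear structure of \<open>VN\<close> from the hypergroup: normal
  functionals are analysed on any linear space of bounded operators.\<close>

locale operator_space = discrete_measure M w for M :: "'a measure" and w +
  fixes N :: "'a operator set"
  assumes N_bounded: "N \<subseteq> bounded_ops M"
    and N_zero: "(\<lambda>\<xi> x. 0) \<in> N"
    and N_lin: "\<And>S T c. S \<in> N \<Longrightarrow> T \<in> N \<Longrightarrow> (\<lambda>\<xi> x. c * S \<xi> x + T \<xi> x) \<in> N"
begin

lemma in_bounded_ops: "T \<in> N \<Longrightarrow> T \<in> bounded_ops M"
  using N_bounded by blast

lemma normal_vector:
  assumes "\<xi> \<in> L2 M" "\<eta> \<in> L2 M"
  shows "normal_functional M N (\<lambda>T. l2_inner M (T \<xi>) \<eta>)"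
  unfolding normal_functional_def
proof (intro conjI ballI allI)
  fix S T c assume "S \<in> N" "T \<in> N"
  then have "S \<in> bounded_ops M" "T \<in> bounded_ops M" by (auto intro: in_bounded_ops)
  then show "l2_inner M (\<lambda>x. c * S \<xi> x + T \<xi> x) \<eta> = c * l2_inner M (S \<xi>) \<eta> + l2_inner M (T \<xi>) \<eta>"
    using assms by (intro l2_inner_lin_left) (auto dest: bounded_opD(1))
next
  show "continuous_map (subtopology (ultraweak_topology M) N) euclidean (\<lambda>T. l2_inner M (T \<xi>) \<eta>)"
    unfolding continuous_map_def
  proof (intro conjI allI impI)
    fix U :: "complex set" assume "openin euclidean U"
    then have "openin (ultraweak_topology M) {T \<in> bounded_ops M. l2_inner M (T \<xi>) \<eta> \<in> U}"
      using assms by (intro openin_vector_series[OF vector_in_vector_series]) auto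
    moreover have "{T \<in> topspace (subtopology (ultraweak_topology M) N). l2_inner M (T \<xi>) \<eta> \<in> U} =
        {T \<in> bounded_ops M. l2_inner M (T \<xi>) \<eta> \<in> U} \<inter> N"
      by (auto simp: topspace_ultraweak)
    ultimately show "openin (subtopology (ultraweak_topology M) N)
        {T \<in> topspace (subtopology (ultraweak_topology M) N). l2_inner M (T \<xi>) \<eta> \<in> U}"
      by (auto simp: openin_subtopology)
  qed auto
qed

lemma normal_lin:
  assumes "normal_functional M N \<phi>" "normal_functional M N \<psi>"
  shows "normal_functional M N (\<lambda>T. c * \<phi> T + \<psi> T)"
proof -
  have "continuous_map euclidean euclidean (\<lambda>z::complex. c * z)"
    by (auto intro!: continuous_intros)
  then have "continuous_map (subtopology (ultraweak_topology M) N) euclidean (\<lambda>T. c * \<phi> T)"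
    using assms continuous_map_compose[of _ euclidean \<phi> euclidean "\<lambda>z. c * z"]
    by (auto simp: normal_functional_def o_def)
  then have "continuous_map (subtopology (ultraweak_topology M) N) euclidean (\<lambda>T. c * \<phi> T + \<psi> T)"
    using assms by (intro continuous_map_add) (auto simp: normal_functional_def)
  then show ?thesis using assms by (simp add: normal_functional_def algebra_simps)
qed

text \<open>The preimage of the unit disc contains the common kernel in \<open>N\<close> of finitely
  many vector series. A linear functional bounded on a subspace vanishes on it, by scaling, so
  \<open>functional_in_span\<close> applies.\<close>

lemma normal_representation:
  assumes \<phi>: "normal_functional M N \<phi>"
  obtains W c where "finite W" "W \<subseteq> vector_series" "\<And>T. T \<in> N \<Longrightarrow> \<phi> T = (\<Sum>\<omega>\<in>W. c \<omega> * \<omega> T)"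
proof -
  let ?Z = "\<lambda>\<xi> x. 0 :: complex"
  have lin: "\<phi> (\<lambda>\<xi> x. c * S \<xi> x + T \<xi> x) = c * \<phi> S + \<phi> T" if "S \<in> N" "T \<in> N" for S T c
    using \<phi> that by (simp add: normal_functional_def)
  have Z: "\<phi> ?Z = 0" using lin[OF N_zero N_zero, of 1] by simp
  have "openin (subtopology (ultraweak_topology M) N)
      {T \<in> topspace (subtopology (ultraweak_topology M) N). \<phi> T \<in> ball 0 1}"
    using \<phi> unfolding normal_functional_def by (intro openin_continuous_map_preimage) auto
  then obtain X where X: "openin (ultraweak_topology M) X"
      "{T \<in> topspace (subtopology (ultraweak_topology M) N). \<phi> T \<in> ball 0 1} = X \<inter> N"
    by (auto simp: openin_subtopology)
  have XN: "T \<in> X \<longleftrightarrow> cmod (\<phi> T) < 1" if "T \<in> N" for T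
  proof -
    have "T \<in> topspace (subtopology (ultraweak_topology M) N)"
      using that N_bounded by (auto simp: topspace_ultraweak)
    then have "T \<in> X \<inter> N \<longleftrightarrow> \<phi> T \<in> ball 0 1" unfolding X(2)[symmetric] by blast
    with that show ?thesis by simp
  qed
  have "?Z \<in> X" using XN[OF N_zero] by (simp add: Z)
  from ultraweak_open_contains_fibre[OF X(1) this]
  obtain W where W: "finite W" "W \<subseteq> vector_series"
      "\<forall>T\<in>bounded_ops M. (\<forall>\<omega>\<in>W. \<omega> T = \<omega> ?Z) \<longrightarrow> T \<in> X" by (elim exE conjE)
  have lin_W: "\<omega> (\<lambda>\<xi> x. c * S \<xi> x + T \<xi> x) = c * \<omega> S + \<omega> T" if "\<omega> \<in> W" "S \<in> N" "T \<in> N" for \<omega> S T c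
    using that W(2) by (intro vector_series_lin in_bounded_ops) auto
  have Z_W: "\<omega> ?Z = 0" if "\<omega> \<in> W" for \<omega>
    using lin_W[OF that N_zero N_zero, of 1] by simp
  have ker: "\<phi> T = 0" if T: "T \<in> N" and ker: "\<And>\<omega>. \<omega> \<in> W \<Longrightarrow> \<omega> T = 0" for T
  proof (rule ccontr)
    assume nz: "\<phi> T \<noteq> 0"
    let ?c = "1 / \<phi> T"
    let ?T = "\<lambda>\<xi> x. ?c * T \<xi> x + ?Z \<xi> x"
    have "?T \<in> N" by (rule N_lin[OF T N_zero])
    moreover have "\<omega> ?T = \<omega> ?Z" if "\<omega> \<in> W" for \<omega>
      using lin_W[OF that T N_zero, of ?c] ker[OF that] by simp
    ultimately have "cmod (\<phi> ?T) < 1" using W(3)[rule_format, of ?T] XN[of ?T] in_bounded_ops[of ?T] by simp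
    moreover have "\<phi> ?T = 1" using lin[OF T N_zero, of ?c] nz Z by simp
    ultimately show False by simp
  qed
  from functional_in_span[of W N "\<lambda>c S T. (\<lambda>\<xi> x. c * S \<xi> x + T \<xi> x)" \<phi>, OF W(1) N_lin lin_W lin ker]
  show ?thesis using that W by blast
qed

text \<open>Approximation in the functional norm, written as a uniform bound on the unit ball so
  that it makes sense before boundedness of the functionals is known.\<close>

definition approximable :: "('a operator \<Rightarrow> complex) \<Rightarrow> bool" where
  "approximable \<phi> \<longleftrightarrow>
    (\<forall>\<epsilon>>0. \<exists>\<psi>\<in>finite_functionals. \<forall>T\<in>N. op_norm M T \<le> 1 \<longrightarrow> cmod (\<phi> T - \<psi> T) \<le> \<epsilon>)"

lemma approximable_lin:
  assumes "approximable \<phi>" "approximable \<psi>"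
  shows "approximable (\<lambda>T. c * \<phi> T + \<psi> T)"
  unfolding approximable_def
proof (intro allI impI)
  fix \<epsilon> :: real assume \<epsilon>: "\<epsilon> > 0"
  \<comment> \<open>The summand 1 keeps the denominator positive when \<open>c = 0\<close>.\<close>
  define \<delta> where "\<delta> = \<epsilon> / (2 * (cmod c + 1))"
  have c1: "cmod c + 1 > 0" using norm_ge_zero[of c] by linarith
  then have \<delta>: "\<delta> > 0" using \<epsilon> by (simp add: \<delta>_def)
  have "cmod c * \<delta> \<le> (cmod c + 1) * \<delta>" using \<delta> by simp
  also have "\<dots> = \<epsilon> / 2" using c1 by (simp add: \<delta>_def divide_simps)
  finally have c\<delta>: "cmod c * \<delta> \<le> \<epsilon> / 2" .
  obtain \<phi>' where \<phi>': "\<phi>' \<in> finite_functionals"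
      "\<And>T. T \<in> N \<Longrightarrow> op_norm M T \<le> 1 \<Longrightarrow> cmod (\<phi> T - \<phi>' T) \<le> \<delta>"
    using assms(1) \<delta> unfolding approximable_def by blast
  obtain \<psi>' where \<psi>': "\<psi>' \<in> finite_functionals"
      "\<And>T. T \<in> N \<Longrightarrow> op_norm M T \<le> 1 \<Longrightarrow> cmod (\<psi> T - \<psi>' T) \<le> \<epsilon> / 2"
    using assms(2) \<epsilon> unfolding approximable_def by (meson half_gt_zero)
  have "cmod (c * \<phi> T + \<psi> T - (c * \<phi>' T + \<psi>' T)) \<le> \<epsilon>" if T: "T \<in> N" "op_norm M T \<le> 1" for T
  proof -
    have "c * \<phi> T + \<psi> T - (c * \<phi>' T + \<psi>' T) = c * (\<phi> T - \<phi>' T) + (\<psi> T - \<psi>' T)"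
      by (simp add: algebra_simps)
    also have "cmod \<dots> \<le> cmod c * cmod (\<phi> T - \<phi>' T) + cmod (\<psi> T - \<psi>' T)"
      by (metis norm_mult norm_triangle_ineq)
    also have "\<dots> \<le> cmod c * \<delta> + \<epsilon> / 2"
      using \<phi>'(2)[OF T] \<psi>'(2)[OF T] by (intro add_mono mult_left_mono) auto
    finally show ?thesis using c\<delta> by linarith
  qed
  then show "\<exists>\<psi>'\<in>finite_functionals. \<forall>T\<in>N. op_norm M T \<le> 1 \<longrightarrow> cmod (c * \<phi> T + \<psi> T - \<psi>' T) \<le> \<epsilon>"
    using finite_functionals.lin[OF \<phi>'(1) \<psi>'(1), of c] by (intro bexI[of _ "\<lambda>T. c * \<phi>' T + \<psi>' T"]) auto
qed

lemma approximable_zero: "approximable (\<lambda>T. 0)"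
proof -
  have "(\<lambda>T. l2_inner M (T (\<lambda>x. 0)) (\<lambda>x. 0)) \<in> finite_functionals"
    by (rule finite_functionals.vector) auto
  then show ?thesis unfolding approximable_def
    by (auto intro!: bexI[of _ "\<lambda>T. l2_inner M (T (\<lambda>x. 0)) (\<lambda>x. 0)"] simp: l2_inner_def)
qed

lemma approximable_sum:
  assumes "finite I" "\<And>i. i \<in> I \<Longrightarrow> approximable (\<phi> i)"
  shows "approximable (\<lambda>T. \<Sum>i\<in>I. c i * \<phi> i T)"
  using assms
  by (induction I rule: finite_induct) (auto simp: approximable_zero intro!: approximable_lin)

lemma approximable_limit:
  assumes "\<And>\<epsilon>. \<epsilon> > 0 \<Longrightarrow> \<exists>\<psi>. approximable \<psi> \<and> (\<forall>T\<in>N. op_norm M T \<le> 1 \<longrightarrow> cmod (\<phi> T - \<psi> T) \<le> \<epsilon>)"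
  shows "approximable \<phi>"
  unfolding approximable_def
proof (intro allI impI)
  fix \<epsilon> :: real assume "\<epsilon> > 0"
  then have \<epsilon>: "\<epsilon> / 2 > 0" by simp
  obtain \<psi> where \<psi>: "approximable \<psi>" "\<And>T. T \<in> N \<Longrightarrow> op_norm M T \<le> 1 \<Longrightarrow> cmod (\<phi> T - \<psi> T) \<le> \<epsilon> / 2"
    using assms[OF \<epsilon>] by blast
  obtain \<psi>' where \<psi>': "\<psi>' \<in> finite_functionals"
      "\<And>T. T \<in> N \<Longrightarrow> op_norm M T \<le> 1 \<Longrightarrow> cmod (\<psi> T - \<psi>' T) \<le> \<epsilon> / 2"
    using \<psi>(1) \<epsilon> unfolding approximable_def by blast
  have "cmod (\<phi> T - \<psi>' T) \<le> \<epsilon>" if "T \<in> N" "op_norm M T \<le> 1" for T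
    using \<psi>(2)[OF that] \<psi>'(2)[OF that] norm_triangle_ineq[of "\<phi> T - \<psi> T" "\<psi> T - \<psi>' T"] by simp
  with \<psi>'(1) show "\<exists>\<psi>\<in>finite_functionals. \<forall>T\<in>N. op_norm M T \<le> 1 \<longrightarrow> cmod (\<phi> T - \<psi> T) \<le> \<epsilon>" by blast
qed

lemma approximable_vector:
  assumes \<xi>: "\<xi> \<in> L2 M" and \<eta>: "\<eta> \<in> L2 M"
  shows "approximable (\<lambda>T. l2_inner M (T \<xi>) \<eta>)"
  unfolding approximable_def
proof (intro allI impI)
  fix \<epsilon> :: real assume \<epsilon>: "\<epsilon> > 0"
  \<comment> \<open>Truncating both vectors costs at most \<open>\<delta>\<close> times the sum of
    their norms; the summand 1 keeps \<open>C\<close> positive when both vanish.\<close>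
  define C where "C = l2_norm M \<xi> + l2_norm M \<eta> + 1"
  have C: "C > 0" using l2_norm_nonneg[of M \<xi>] l2_norm_nonneg[of M \<eta>] unfolding C_def by linarith
  define \<delta> where "\<delta> = \<epsilon> / C"
  have \<delta>: "\<delta> > 0" using \<epsilon> C by (simp add: \<delta>_def)
  obtain F where F: "finite F" "l2_norm M (\<lambda>x. \<xi> x - restr F \<xi> x) < \<delta>"
    using l2_restr_approx[OF \<xi> \<delta>] .
  obtain G where G: "finite G" "l2_norm M (\<lambda>x. \<eta> x - restr G \<eta> x) < \<delta>"
    using l2_restr_approx[OF \<eta> \<delta>] .
  have "cmod (l2_inner M (T \<xi>) \<eta> - l2_inner M (T (restr F \<xi>)) (restr G \<eta>)) \<le> \<epsilon>"
    if T: "T \<in> N" "op_norm M T \<le> 1" for T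
  proof -
    note B = in_bounded_ops[OF T(1)]
    note L = L2_restr[OF \<xi>, of F] L2_restr[OF \<eta>, of G]
    have "l2_inner M (T (\<lambda>x. \<xi> x - restr F \<xi> x)) \<eta> = l2_inner M (T \<xi>) \<eta> - l2_inner M (T (restr F \<xi>)) \<eta>"
      unfolding bounded_op_diff[OF B \<xi> L(1)]
      by (intro l2_inner_diff_left bounded_opD(1)[OF B] \<xi> \<eta> L)
    moreover have "l2_inner M (T (restr F \<xi>)) (\<lambda>x. \<eta> x - restr G \<eta> x) =
        l2_inner M (T (restr F \<xi>)) \<eta> - l2_inner M (T (restr F \<xi>)) (restr G \<eta>)"
      by (intro l2_inner_diff_right bounded_opD(1)[OF B] \<eta> L)
    ultimately have eq: "l2_inner M (T \<xi>) \<eta> - l2_inner M (T (restr F \<xi>)) (restr G \<eta>) =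
        l2_inner M (T (\<lambda>x. \<xi> x - restr F \<xi> x)) \<eta> + l2_inner M (T (restr F \<xi>)) (\<lambda>x. \<eta> x - restr G \<eta> x)"
      by simp
    have "cmod (l2_inner M (T (\<lambda>x. \<xi> x - restr F \<xi> x)) \<eta>) \<le> l2_norm M (\<lambda>x. \<xi> x - restr F \<xi> x) * l2_norm M \<eta>"
      by (intro l2_inner_op_bound B T L2_diff \<xi> \<eta> L)
    also have "\<dots> \<le> \<delta> * l2_norm M \<eta>" using F by (intro mult_right_mono) auto
    finally have 1: "cmod (l2_inner M (T (\<lambda>x. \<xi> x - restr F \<xi> x)) \<eta>) \<le> \<delta> * l2_norm M \<eta>" .
    have "cmod (l2_inner M (T (restr F \<xi>)) (\<lambda>x. \<eta> x - restr G \<eta> x)) \<le>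
        l2_norm M (restr F \<xi>) * l2_norm M (\<lambda>x. \<eta> x - restr G \<eta> x)"
      by (intro l2_inner_op_bound B T L2_diff \<xi> \<eta> L)
    also have "\<dots> \<le> l2_norm M \<xi> * \<delta>"
      using G l2_norm_restr_le[OF \<xi>] by (intro mult_mono) auto
    finally have 2: "cmod (l2_inner M (T (restr F \<xi>)) (\<lambda>x. \<eta> x - restr G \<eta> x)) \<le> l2_norm M \<xi> * \<delta>" .
    have "cmod (l2_inner M (T \<xi>) \<eta> - l2_inner M (T (restr F \<xi>)) (restr G \<eta>)) \<le> \<delta> * l2_norm M \<eta> + l2_norm M \<xi> * \<delta>"
      unfolding eq by (rule norm_triangle_le) (use 1 2 in linarith)
    also have "\<dots> \<le> \<delta> * C" using \<delta> by (simp add: C_def algebra_simps)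
    also have "\<dots> = \<epsilon>" using C by (simp add: \<delta>_def)
    finally show ?thesis .
  qed
  moreover have "(\<lambda>T. l2_inner M (T (restr F \<xi>)) (restr G \<eta>)) \<in> finite_functionals"
    by (intro finite_functionals.vector finite_support_restr F G)
  ultimately show "\<exists>\<psi>\<in>finite_functionals. \<forall>T\<in>N. op_norm M T \<le> 1 \<longrightarrow> cmod (l2_inner M (T \<xi>) \<eta> - \<psi> T) \<le> \<epsilon>"
    by (intro bexI[of _ "\<lambda>T. l2_inner M (T (restr F \<xi>)) (restr G \<eta>)"]) auto
qed

text \<open>On the unit ball the tail is dominated, independently of \<open>T\<close>, by the tail
  of a convergent series of norms; what remains is a finite sum of vector functionals.\<close>

lemma approximable_vector_series:
  assumes "\<omega> \<in> vector_series"
  shows "approximable \<omega>"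
proof (rule approximable_limit)
  fix \<epsilon> :: real assume \<epsilon>: "\<epsilon> > 0"
  obtain \<xi> \<eta> where \<omega>: "\<omega> = (\<lambda>T. \<Sum>n. l2_inner M (T (\<xi> n)) (\<eta> n))"
    and L: "\<forall>n. \<xi> n \<in> L2 M \<and> \<eta> n \<in> L2 M"
    and s: "summable (\<lambda>n. (l2_norm M (\<xi> n))\<^sup>2)" "summable (\<lambda>n. (l2_norm M (\<eta> n))\<^sup>2)"
    using assms by (auto simp: vector_series_def)
  let ?b = "\<lambda>n. l2_norm M (\<xi> n) * l2_norm M (\<eta> n)"
  have b: "summable ?b" by (rule summable_l2_norm_mult[OF s])
  obtain m where m: "norm (\<Sum>n. ?b (n + m)) < \<epsilon>"
    using suminf_exist_split[OF \<epsilon> b] by blast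
  define \<psi> where "\<psi> = (\<lambda>T. \<Sum>n\<in>{..<m}. 1 * l2_inner M (T (\<xi> n)) (\<eta> n))"
  have "approximable \<psi>" unfolding \<psi>_def
    using L by (intro approximable_sum approximable_vector) auto
  moreover have "cmod (\<omega> T - \<psi> T) \<le> \<epsilon>" if T: "T \<in> N" "op_norm M T \<le> 1" for T
  proof -
    note B = in_bounded_ops[OF T(1)]
    have "\<omega> T - \<psi> T = (\<Sum>n. l2_inner M (T (\<xi> (n + m))) (\<eta> (n + m)))"
      using suminf_split_initial_segment[OF summable_l2_inner[OF B L s], of m] by (simp add: \<omega> \<psi>_def)
    also have "cmod \<dots> \<le> (\<Sum>n. ?b (n + m))"
    proof (rule norm_suminf_le)
      show "summable (\<lambda>n. ?b (n + m))" using b by (rule summable_ignore_initial_segment)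
    qed (use l2_inner_op_bound[OF B T(2)] L in auto)
    finally show ?thesis using m by simp
  qed
  ultimately show "\<exists>\<psi>. approximable \<psi> \<and> (\<forall>T\<in>N. op_norm M T \<le> 1 \<longrightarrow> cmod (\<omega> T - \<psi> T) \<le> \<epsilon>)" by blast
qed

lemma approximable_normal:
  assumes "normal_functional M N \<phi>"
  shows "approximable \<phi>"
proof -
  obtain W c where W: "finite W" "W \<subseteq> vector_series" "\<And>T. T \<in> N \<Longrightarrow> \<phi> T = (\<Sum>\<omega>\<in>W. c \<omega> * \<omega> T)"
    using normal_representation[OF assms] by blast
  have "approximable (\<lambda>T. \<Sum>\<omega>\<in>W. c \<omega> * \<omega> T)"
    using W(2) by (intro approximable_sum W(1) approximable_vector_series) auto
  then show ?thesis using W(3) by (simp add: approximable_def)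
qed

lemma finite_functional_bounded:
  "\<psi> \<in> finite_functionals \<Longrightarrow> \<exists>C. \<forall>T\<in>N. op_norm M T \<le> 1 \<longrightarrow> cmod (\<psi> T) \<le> C"
proof (induction rule: finite_functionals.induct)
  case (vector \<xi> \<eta>)
  then show ?case
    using l2_inner_op_bound[OF in_bounded_ops _ finite_support_L2 finite_support_L2] by blast
next
  case (lin \<phi> \<psi> c)
  then obtain C D where "\<And>T. T \<in> N \<Longrightarrow> op_norm M T \<le> 1 \<Longrightarrow> cmod (\<phi> T) \<le> C"
      "\<And>T. T \<in> N \<Longrightarrow> op_norm M T \<le> 1 \<Longrightarrow> cmod (\<psi> T) \<le> D" by blast
  then have "cmod (c * \<phi> T + \<psi> T) \<le> cmod c * C + D" if "T \<in> N" "op_norm M T \<le> 1" for T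
    using that by (intro norm_triangle_le add_mono) (auto simp: norm_mult intro!: mult_left_mono)
  then show ?case by blast
qed

text \<open>The real supremum in \<open>functional_norm\<close> bounds its elements only if the set
  is bounded. A normal functional is within 1 of a finite functional, and those are bounded on the
  unit ball.\<close>

lemma normal_bounded:
  assumes "normal_functional M N \<phi>"
  shows "bdd_above {cmod (\<phi> T) |T. T \<in> N \<and> op_norm M T \<le> 1}"
proof -
  obtain \<psi> where \<psi>: "\<psi> \<in> finite_functionals" "\<And>T. T \<in> N \<Longrightarrow> op_norm M T \<le> 1 \<Longrightarrow> cmod (\<phi> T - \<psi> T) \<le> 1"
    using approximable_normal[OF assms] unfolding approximable_def by (meson zero_less_one)
  obtain C where C: "\<And>T. T \<in> N \<Longrightarrow> op_norm M T \<le> 1 \<Longrightarrow> cmod (\<psi> T) \<le> C"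
    using finite_functional_bounded[OF \<psi>(1)] by blast
  have "cmod (\<phi> T) \<le> 1 + C" if "T \<in> N" "op_norm M T \<le> 1" for T
    using \<psi>(2)[OF that] C[OF that] norm_triangle_ineq[of "\<phi> T - \<psi> T" "\<psi> T"] by simp
  then show ?thesis by (auto intro!: bdd_aboveI[of _ "1 + C"])
qed

lemma functional_norm_upper:
  assumes "normal_functional M N \<phi>" "T \<in> N" "op_norm M T \<le> 1"
  shows "cmod (\<phi> T) \<le> functional_norm M N \<phi>"
  unfolding functional_norm_def using assms by (intro cSup_upper normal_bounded) auto

lemma op_norm_zero: "op_norm M (\<lambda>\<xi> x. 0) \<le> 1"
  by (rule op_norm_leI) simp

lemma functional_norm_leI:
  assumes "\<And>T. T \<in> N \<Longrightarrow> op_norm M T \<le> 1 \<Longrightarrow> cmod (\<phi> T) \<le> C"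
  shows "functional_norm M N \<phi> \<le> C"
  unfolding functional_norm_def
proof (rule cSup_least)
  show "{cmod (\<phi> T) |T. T \<in> N \<and> op_norm M T \<le> 1} \<noteq> {}"
    using N_zero op_norm_zero by blast
qed (use assms in auto)

lemma functional_norm_nonneg: "normal_functional M N \<phi> \<Longrightarrow> 0 \<le> functional_norm M N \<phi>"
  using functional_norm_upper[OF _ N_zero op_norm_zero] norm_ge_zero order_trans by blast

end

section \<open>The Fourier algebra\<close>

context discrete_haar
begin

abbreviation "\<V> \<equiv> VN conv tilde lam"
abbreviation "\<A> \<equiv> fourier_space conv tilde lam"
abbreviation "A_norm \<equiv> fourier_norm conv tilde lam"
abbreviation "rep \<equiv> represents conv tilde lam"

lemma hconv_in_VN: "integrable lam f \<Longrightarrow> H f \<in> \<V>"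
  unfolding VN_def by (rule vn_generated_generator) blast

sublocale operator_space lam w \<V>
proof
  show "\<V> \<subseteq> bounded_ops lam"
    unfolding VN_def by (rule vn_generated_subset) (auto intro: hconv_bounded_op)
  have "H (\<lambda>t. 0) = (\<lambda>\<xi> x. 0)" by (simp add: hconv_def fun_eq_iff)
  then show "(\<lambda>\<xi> x. 0) \<in> \<V>" using hconv_in_VN[of "\<lambda>t. 0"] by simp
qed (auto simp: VN_def intro: vn_generated_lin)

lemma bounded_finite_support:
  assumes "finite {x. g x \<noteq> (0 :: complex)}"
  shows "bounded (range g)"
proof (rule bounded_subset)
  show "bounded (insert 0 (g ` {x. g x \<noteq> 0}))" using assms by (intro finite_imp_bounded) auto
qed auto

lemma bounded_mult_integrable:
  fixes f u :: "'a \<Rightarrow> complex"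
  assumes "integrable lam f" "bounded (range u)"
  shows "integrable lam (\<lambda>x. f x * u x)"
proof -
  obtain B where B: "\<And>x. cmod (u x) \<le> B" using assms(2) by (auto simp: bounded_iff)
  show ?thesis
  proof (rule Bochner_Integration.integrable_bound)
    show "integrable lam (\<lambda>x. B * norm (f x))" using assms(1) by simp
    have "norm (f x * u x) \<le> norm (B * norm (f x))" for x
    proof -
      have "norm (f x * u x) \<le> norm (f x) * B" unfolding norm_mult by (intro mult_left_mono B) simp
      also have "\<dots> \<le> norm (B * norm (f x))" by (simp add: mult.commute)
      finally show ?thesis .
    qed
    then show "AE x in lam. norm (f x * u x) \<le> norm (B * norm (f x))" by simp
  qed simp
qed

lemma represents_lin:
  assumes "rep \<phi> u" "rep \<psi> v" "bounded (range u)" "bounded (range v)"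
  shows "rep (\<lambda>T. c * \<phi> T + \<psi> T) (\<lambda>x. c * u x + v x)"
  unfolding represents_def
proof (intro conjI allI impI)
  show "normal_functional lam \<V> (\<lambda>T. c * \<phi> T + \<psi> T)"
    using assms by (intro normal_lin) (auto simp: represents_def)
  fix f :: "'a \<Rightarrow> complex" assume f: "integrable lam f"
  have "(\<integral>x. f x * (c * u x + v x) \<partial>lam) = (\<integral>x. c * (f x * u x) + f x * v x \<partial>lam)"
    by (simp add: algebra_simps)
  also have "\<dots> = c * (\<integral>x. f x * u x \<partial>lam) + (\<integral>x. f x * v x \<partial>lam)"
    using bounded_mult_integrable[OF f assms(3)] bounded_mult_integrable[OF f assms(4)] by simp
  finally show "c * \<phi> (H f) + \<psi> (H f) = (\<integral>x. f x * (c * u x + v x) \<partial>lam)"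
    using assms(1,2) f by (simp add: represents_def)
qed

section \<open>The norm of the Fourier space\<close>

lemma fourier_space_iff: "u \<in> \<A> \<longleftrightarrow> bounded (range u) \<and> (\<exists>\<phi>. rep \<phi> u)"
  by (simp add: fourier_space_def)

lemma represents_normal: "rep \<phi> u \<Longrightarrow> normal_functional lam \<V> \<phi>"
  by (simp add: represents_def)

text \<open>The norm is an infimum: one representing functional bounds it from above, whereas a
  lower bound has to hold for all of them, as in \<open>A_norm_geI\<close>.\<close>

lemma A_norm_leI:
  assumes "rep \<phi> u" "\<And>T. T \<in> \<V> \<Longrightarrow> op_norm lam T \<le> 1 \<Longrightarrow> cmod (\<phi> T) \<le> C"
  shows "A_norm u \<le> C"
proof -
  have "A_norm u \<le> functional_norm lam \<V> \<phi>"
    unfolding fourier_norm_def using assms(1)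
    by (intro cInf_lower bdd_belowI[of _ 0]) (auto intro: functional_norm_nonneg represents_normal)
  also have "\<dots> \<le> C" by (rule functional_norm_leI[OF assms(2)])
  finally show ?thesis .
qed

lemma A_norm_geI:
  assumes "u \<in> \<A>" "\<And>\<phi>. rep \<phi> u \<Longrightarrow> C \<le> functional_norm lam \<V> \<phi>"
  shows "C \<le> A_norm u"
  unfolding fourier_norm_def using assms by (intro cInf_greatest) (auto simp: fourier_space_iff)

lemma A_norm_less:
  assumes "u \<in> \<A>" "A_norm u < C"
  obtains \<phi> where "rep \<phi> u" "functional_norm lam \<V> \<phi> < C"
proof -
  have "\<exists>x\<in>{functional_norm lam \<V> \<phi> |\<phi>. rep \<phi> u}. x < C"
    using assms by (intro cInf_lessD) (auto simp: fourier_norm_def fourier_space_iff)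
  with that show thesis by blast
qed

lemma A_norm_nonneg: "u \<in> \<A> \<Longrightarrow> 0 \<le> A_norm u"
  by (rule A_norm_geI) (auto intro: functional_norm_nonneg represents_normal)

lemma pairing_bound:
  assumes "rep \<phi> u" "integrable lam f" "op_norm lam (H f) \<le> 1"
  shows "cmod (\<integral>x. f x * u x \<partial>lam) \<le> functional_norm lam \<V> \<phi>"
  using functional_norm_upper[OF represents_normal[OF assms(1)] hconv_in_VN[OF assms(2)] assms(3)] assms
  by (simp add: represents_def)

lemma op_norm_hconv_le: "integrable lam f \<Longrightarrow> op_norm lam (H f) \<le> (\<integral>t. cmod (f t) \<partial>lam)"
proof (rule op_norm_leI)
  fix \<xi> assume "integrable lam f" "\<xi> \<in> L2 lam" "l2_norm lam \<xi> \<le> 1"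
  then show "l2_norm lam (H f \<xi>) \<le> (\<integral>t. cmod (f t) \<partial>lam)"
    using l2_norm_hconv_le[of f \<xi>] mult_left_mono[of "l2_norm lam \<xi>" 1 "\<integral>t. cmod (f t) \<partial>lam"] by simp
qed

text \<open>The normalised point mass at \<open>x\<close> has L1-norm 1, hence yields an operator in
  the unit ball of \<open>VN\<close>, and pairing it with \<open>u\<close> evaluates
  \<open>u\<close> at \<open>x\<close>.\<close>

lemma pointwise_le_A_norm:
  assumes "u \<in> \<A>"
  shows "cmod (u x) \<le> A_norm u"
proof (rule A_norm_geI[OF assms])
  fix \<phi> assume \<phi>: "rep \<phi> u"
  let ?f = "\<lambda>t. if t = x then complex_of_real (1 / w x) else 0"
  have i: "integrable lam ?f" by (rule integrable_finite[of "{x}"]) auto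
  have "(\<integral>t. cmod (?f t) \<partial>lam) = 1" by (subst integral_finite[of "{x}"]) (auto simp: norm_divide)
  then have "op_norm lam (H ?f) \<le> 1" using op_norm_hconv_le[OF i] by simp
  from pairing_bound[OF \<phi> i this]
  have "cmod (\<integral>t. ?f t * u t \<partial>lam) \<le> functional_norm lam \<V> \<phi>" .
  moreover have "(\<integral>t. ?f t * u t \<partial>lam) = u x"
    by (subst integral_finite[of "{x}"]) (auto simp: scaleR_conv_of_real)
  ultimately show "cmod (u x) \<le> functional_norm lam \<V> \<phi>" by simp
qed

lemma vector_represents:
  assumes "\<xi> \<in> L2 lam" "finite F" "\<And>x. x \<notin> F \<Longrightarrow> \<eta> x = 0"
  shows "rep (\<lambda>T. l2_inner lam (T \<xi>) \<eta>) (\<lambda>t. l2_inner lam (L t \<xi>) \<eta>)"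
proof -
  have "\<eta> \<in> L2 lam"
    using assms(2) by (intro finite_support_L2 finite_subset[of "{x. \<eta> x \<noteq> 0}" F]) (use assms(3) in auto)
  then show ?thesis unfolding represents_def
    using assms by (intro conjI normal_vector allI impI hconv_inner)
qed

text \<open>The coefficient is nonzero at \<open>t\<close> only if the kernel of translation by
  \<open>t\<close> links the two finite supports, and \<open>finite_translates\<close> leaves
  finitely many such \<open>t\<close>.\<close>

lemma finite_functional_represents:
  "\<psi> \<in> finite_functionals \<Longrightarrow> \<exists>v. finite {x. v x \<noteq> 0} \<and> rep \<psi> v"
proof (induction rule: finite_functionals.induct)
  case (vector \<xi> \<eta>)
  let ?v = "\<lambda>t. l2_inner lam (L t \<xi>) \<eta>"
  have "{t. ?v t \<noteq> 0} \<subseteq> (\<Union>y\<in>{y. \<eta> y \<noteq> 0}. \<Union>x\<in>{x. \<xi> x \<noteq> 0}. {t. coef (tilde t) y x \<noteq> 0})"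
  proof
    fix t assume "t \<in> {t. ?v t \<noteq> 0}"
    then have "(\<Sum>y\<in>{y. \<eta> y \<noteq> 0}. complex_of_real (w y) * (L t \<xi> y * cnj (\<eta> y))) \<noteq> 0"
      using l2_inner_finite[OF vector(2), of \<eta> "L t \<xi>"] by simp
    then obtain y where y: "\<eta> y \<noteq> 0" "L t \<xi> y \<noteq> 0" by (force elim: sum.not_neutral_contains_not_neutral)
    then obtain x where "\<xi> x \<noteq> 0" "coef (tilde t) y x \<noteq> 0"
      unfolding ltrans_sum by (force elim: sum.not_neutral_contains_not_neutral)
    with y show "t \<in> (\<Union>y\<in>{y. \<eta> y \<noteq> 0}. \<Union>x\<in>{x. \<xi> x \<noteq> 0}. {t. coef (tilde t) y x \<noteq> 0})" by blast
  qed
  then have "finite {t. ?v t \<noteq> 0}"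
    by (rule finite_subset) (intro finite_UN_I vector finite_translates)
  moreover have "rep (\<lambda>T. l2_inner lam (T \<xi>) \<eta>) ?v"
    by (rule vector_represents[OF finite_support_L2[OF vector(1)] vector(2)]) simp
  ultimately show ?case by (intro exI[of _ ?v] conjI)
next
  case (lin \<phi> \<psi> c)
  then obtain u v where u: "finite {x. u x \<noteq> 0}" "rep \<phi> u" and v: "finite {x. v x \<noteq> 0}" "rep \<psi> v" by blast
  have "finite {x. c * u x + v x \<noteq> 0}"
    by (rule finite_subset[of _ "{x. u x \<noteq> 0} \<union> {x. v x \<noteq> 0}"]) (use u v in auto)
  with represents_lin[OF u(2) v(2) bounded_finite_support[OF u(1)] bounded_finite_support[OF v(1)], of c]
  show ?case by (intro exI[of _ "\<lambda>x. c * u x + v x"] conjI)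
qed

text \<open>The point mass at \<open>e\<close> is translated to a multiple of the point mass at \<open>t\<close>, so \<open>g\<close> is one of its coefficients.\<close>

lemma
  assumes "finite {x. g x \<noteq> 0}"
  shows finite_support_fourier: "g \<in> \<A>"
    and A_norm_finite_support: "A_norm g \<le> l2_norm lam g / sqrt (w e)"
proof -
  let ?d = "\<lambda>x. if x = e then 1 else 0 :: complex"
  \<comment> \<open>The second slot of the inner product undoes the conjugation, and the scalars
    cancel as w t * (w e / w t) * (1 / w e) = 1.\<close>
  let ?\<eta> = "\<lambda>x. complex_of_real (1 / w e) * cnj (g x)"
  have d: "finite {x. ?d x \<noteq> 0}" by simp
  have \<eta>: "finite {x. ?\<eta> x \<noteq> 0}" using assms by simp
  note L2 = finite_support_L2[OF d] finite_support_L2[OF \<eta>]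
  have Ld: "L t ?d y = (if y = t then complex_of_real (w e / w t) else 0)" for t y
  proof -
    have "L t ?d y = complex_of_real (\<Sum>z\<in>supp (tilde t) y. coef (tilde t) y z * of_bool (z = e))"
      unfolding ltrans_sum of_real_sum by (intro sum.cong) auto
    also have "\<dots> = complex_of_real (coef (tilde t) y e)"
      by (subst sum_supp_single[of e]) auto
    also have "\<dots> = (if y = t then complex_of_real (w e / w t) else 0)"
    proof (cases "y = t")
      case True
      then show ?thesis using w_coef_e[of t] w_nz[of t] by (metis nonzero_mult_div_cancel_left)
    next
      case False
      then have "tilde t \<noteq> tilde y" by (metis tilde_tilde)
      then show ?thesis using False coef_e_iff[of "tilde t" y] by simp
    qed
    finally show ?thesis .
  qed
  have "l2_inner lam (L t ?d) ?\<eta> = g t" for t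
  proof -
    have "l2_inner lam (L t ?d) ?\<eta> = (\<integral>y. (if y = t then complex_of_real (w e / w t) * cnj (?\<eta> t) else 0) \<partial>lam)"
      unfolding l2_inner_def Ld by (intro Bochner_Integration.integral_cong) auto
    also have "\<dots> = w t *\<^sub>R (complex_of_real (w e / w t) * cnj (?\<eta> t))"
      by (subst integral_finite[of "{t}"]) auto
    finally show ?thesis by (simp add: scaleR_conv_of_real)
  qed
  moreover have "rep (\<lambda>T. l2_inner lam (T ?d) ?\<eta>) (\<lambda>t. l2_inner lam (L t ?d) ?\<eta>)"
    by (rule vector_represents[OF L2(1) \<eta>]) blast
  ultimately have r: "rep (\<lambda>T. l2_inner lam (T ?d) ?\<eta>) g" by simp
  then show "g \<in> \<A>" using bounded_finite_support[OF assms] by (auto simp: fourier_space_iff)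
  have "(l2_norm lam ?d)\<^sup>2 = w e"
    unfolding l2_norm_sq by (subst integral_finite[of "{e}"]) auto
  then have nd: "l2_norm lam ?d = sqrt (w e)" by (metis l2_norm_nonneg real_sqrt_unique)
  have n\<eta>: "l2_norm lam ?\<eta> = l2_norm lam g / w e"
    unfolding l2_norm_scale by (simp add: l2_norm_def norm_divide)
  have "sqrt (w e) * (l2_norm lam g / w e) = l2_norm lam g / sqrt (w e)"
    using w_pos[of e] real_sqrt_mult_self[of "w e"] by (simp add: field_simps)
  then have "l2_norm lam ?d * l2_norm lam ?\<eta> = l2_norm lam g / sqrt (w e)"
    unfolding nd n\<eta> .
  then show "A_norm g \<le> l2_norm lam g / sqrt (w e)"
    using l2_inner_op_bound[OF in_bounded_ops _ L2] by (intro A_norm_leI[OF r]) metis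
qed

text \<open>The approximating finite functional represents a finitely supported function, so
  closeness of functionals on the unit ball becomes closeness in \<open>A_norm\<close>.\<close>

lemma finite_support_dense:
  assumes "u \<in> \<A>" "0 < \<epsilon>"
  obtains v where "finite {x. v x \<noteq> 0}" "A_norm (\<lambda>x. u x - v x) \<le> \<epsilon>"
proof -
  obtain \<phi> where \<phi>: "rep \<phi> u" and bu: "bounded (range u)" using assms by (auto simp: fourier_space_iff)
  obtain \<psi> where \<psi>: "\<psi> \<in> finite_functionals"
      "\<And>T. T \<in> \<V> \<Longrightarrow> op_norm lam T \<le> 1 \<Longrightarrow> cmod (\<phi> T - \<psi> T) \<le> \<epsilon>"
    using approximable_normal[OF represents_normal[OF \<phi>]] assms(2) unfolding approximable_def by blast
  obtain v where v: "finite {x. v x \<noteq> 0}" "rep \<psi> v"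
    using finite_functional_represents[OF \<psi>(1)] by blast
  have "rep (\<lambda>T. \<phi> T - \<psi> T) (\<lambda>x. u x - v x)"
    using represents_lin[OF v(2) \<phi> bounded_finite_support[OF v(1)] bu, of "-1"] by simp
  then have "A_norm (\<lambda>x. u x - v x) \<le> \<epsilon>" by (rule A_norm_leI) (rule \<psi>(2))
  with v(1) that show thesis by blast
qed

section \<open>From almost invariant vectors to an approximate identity\<close>

lemma l2_inner_self: "l2_inner lam f f = complex_of_real ((l2_norm lam f)\<^sup>2)"
proof -
  have "restr UNIV f = f" by (simp add: restr_def fun_eq_iff)
  then show ?thesis using l2_inner_restr[of f UNIV] by simp
qed

text \<open>The second vector of the coefficient is truncated because
  \<open>vector_represents\<close> asks for finite support. Half of \<open>\<epsilon>\<close> pays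
  for the truncation, half for the almost invariance.\<close>

lemma P2_imp_almost_unit:
  assumes P2: "property_P2 conv tilde lam" and "finite K" "0 < \<epsilon>"
  obtains u where "u \<in> \<A>" "A_norm u \<le> 1" "\<And>x. x \<in> K \<Longrightarrow> cmod (u x - 1) < \<epsilon>"
proof -
  have \<epsilon>2: "\<epsilon> / 2 > 0" using assms by simp
  have "compact K" using \<open>finite K\<close> by simp
  then obtain \<xi>0 :: "'a \<Rightarrow> real" where "let \<xi>' = (\<lambda>t. complex_of_real (\<xi>0 t)) in
      \<xi>' \<in> L2 lam \<and> l2_norm lam \<xi>' = 1 \<and> (\<forall>x\<in>K. l2_norm lam (\<lambda>t. L x \<xi>' t - \<xi>' t) < \<epsilon> / 2)"
    using P2 \<epsilon>2 unfolding property_P2_def by blast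
  then obtain \<xi> where \<xi>: "\<xi> \<in> L2 lam" "l2_norm lam \<xi> = 1"
      "\<And>x. x \<in> K \<Longrightarrow> l2_norm lam (\<lambda>t. L x \<xi> t - \<xi> t) < \<epsilon> / 2"
    by (auto simp: Let_def)
  obtain F where F: "finite F" "l2_norm lam (\<lambda>x. \<xi> x - restr F \<xi> x) < \<epsilon> / 2"
    using l2_restr_approx[OF \<xi>(1) \<epsilon>2] .
  let ?\<eta> = "restr F \<xi>"
  let ?u = "\<lambda>t. l2_inner lam (L t \<xi>) ?\<eta>"
  have \<eta>: "?\<eta> \<in> L2 lam" "l2_norm lam ?\<eta> \<le> 1"
    using L2_restr[OF \<xi>(1)] l2_norm_restr_le[OF \<xi>(1), of F] \<xi>(2) by auto
  have r: "rep (\<lambda>T. l2_inner lam (T \<xi>) ?\<eta>) ?u"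
    by (rule vector_represents[OF \<xi>(1) F(1)]) (simp add: restr_def)
  have "cmod (?u t) \<le> 1" for t
  proof -
    have "cmod (?u t) \<le> l2_norm lam (L t \<xi>) * l2_norm lam ?\<eta>"
      by (rule l2_Cauchy_Schwarz[OF ltrans_L2[OF \<xi>(1)] \<eta>(1)])
    also have "\<dots> \<le> 1 * 1"
      using l2_norm_ltrans_le[OF \<xi>(1), of t] \<xi>(2) \<eta>(2) by (intro mult_mono) auto
    finally show ?thesis by simp
  qed
  then have "bounded (range ?u)" by (auto simp: bounded_iff)
  with r have "?u \<in> \<A>" by (auto simp: fourier_space_iff)
  moreover have "A_norm ?u \<le> 1"
  proof (rule A_norm_leI[OF r])
    fix T assume "T \<in> \<V>" "op_norm lam T \<le> 1"
    then have "cmod (l2_inner lam (T \<xi>) ?\<eta>) \<le> l2_norm lam \<xi> * l2_norm lam ?\<eta>"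
      by (intro l2_inner_op_bound in_bounded_ops \<xi> \<eta>)
    with \<xi>(2) \<eta>(2) show "cmod (l2_inner lam (T \<xi>) ?\<eta>) \<le> 1" by simp
  qed
  moreover have "cmod (?u x - 1) < \<epsilon>" if x: "x \<in> K" for x
  proof -
    have "l2_inner lam (\<lambda>t. L x \<xi> t - \<xi> t) ?\<eta> = ?u x - l2_inner lam \<xi> ?\<eta>"
      by (intro l2_inner_diff_left ltrans_L2 \<xi> \<eta>)
    moreover have "l2_inner lam \<xi> (\<lambda>t. \<xi> t - ?\<eta> t) = 1 - l2_inner lam \<xi> ?\<eta>"
      using l2_inner_diff_right[OF \<xi>(1) \<eta>(1) \<xi>(1)] l2_inner_self[of \<xi>] \<xi>(2) by simp
    ultimately have eq: "?u x - 1 = l2_inner lam (\<lambda>t. L x \<xi> t - \<xi> t) ?\<eta> - l2_inner lam \<xi> (\<lambda>t. \<xi> t - ?\<eta> t)"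
      by simp
    have "cmod (l2_inner lam (\<lambda>t. L x \<xi> t - \<xi> t) ?\<eta>) \<le> l2_norm lam (\<lambda>t. L x \<xi> t - \<xi> t) * l2_norm lam ?\<eta>"
      by (intro l2_Cauchy_Schwarz L2_diff ltrans_L2 \<xi> \<eta>)
    also have "\<dots> \<le> l2_norm lam (\<lambda>t. L x \<xi> t - \<xi> t) * 1" by (intro mult_left_mono \<eta>) simp
    finally have 1: "cmod (l2_inner lam (\<lambda>t. L x \<xi> t - \<xi> t) ?\<eta>) < \<epsilon> / 2" using \<xi>(3)[OF x] by simp
    have "cmod (l2_inner lam \<xi> (\<lambda>t. \<xi> t - ?\<eta> t)) \<le> l2_norm lam \<xi> * l2_norm lam (\<lambda>t. \<xi> t - ?\<eta> t)"
      by (intro l2_Cauchy_Schwarz L2_diff \<xi> \<eta>)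
    then have 2: "cmod (l2_inner lam \<xi> (\<lambda>t. \<xi> t - ?\<eta> t)) < \<epsilon> / 2" using F(2) \<xi>(2) by simp
    show ?thesis unfolding eq using norm_triangle_ineq4[of "l2_inner lam (\<lambda>t. L x \<xi> t - \<xi> t) ?\<eta>"
        "l2_inner lam \<xi> (\<lambda>t. \<xi> t - ?\<eta> t)"] 1 2 by linarith
  qed
  ultimately show thesis using that by blast
qed

lemma P2_imp_bai:
  assumes P2: "property_P2 conv tilde lam" and reg: "regular_fourier conv tilde lam"
  shows "has_bai conv tilde lam 1"
proof -
  have A_lin: "\<And>u v c. u \<in> \<A> \<Longrightarrow> v \<in> \<A> \<Longrightarrow> (\<lambda>x. c * u x + v x) \<in> \<A>"
    and A_mult: "\<And>u v. u \<in> \<A> \<Longrightarrow> v \<in> \<A> \<Longrightarrow> (\<lambda>x. u x * v x) \<in> \<A>"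
    and n_scale: "\<And>u c. u \<in> \<A> \<Longrightarrow> A_norm (\<lambda>x. c * u x) = cmod c * A_norm u"
    and n_add: "\<And>u v. u \<in> \<A> \<Longrightarrow> v \<in> \<A> \<Longrightarrow> A_norm (\<lambda>x. u x + v x) \<le> A_norm u + A_norm v"
    and n_mult: "\<And>u v. u \<in> \<A> \<Longrightarrow> v \<in> \<A> \<Longrightarrow> A_norm (\<lambda>x. u x * v x) \<le> A_norm u * A_norm v"
    using reg unfolding regular_fourier_def function_banach_algebra_def by blast+
  have A_diff: "(\<lambda>x. u x - v x) \<in> \<A>" if "u \<in> \<A>" "v \<in> \<A>" for u v
    using A_lin[OF that(2,1), of "-1"] by simp
  define B where "B = {(K :: 'a set, \<epsilon> :: real). finite K \<and> \<epsilon> > 0}"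
  define G where "G = (\<lambda>(K, \<epsilon>). {v \<in> \<A>. A_norm v \<le> 1 \<and> (\<forall>x\<in>K. cmod (v x - 1) < (\<epsilon> :: real))})"
  \<comment> \<open>The sets \<open>G (K, \<epsilon>)\<close> shrink as \<open>K\<close> grows and
    \<open>\<epsilon>\<close> decreases, so they form a filter base; unions and minima provide
    directedness.\<close>
  define \<F> where "\<F> = (INF b\<in>B. principal (G b))"
  have ev: "eventually P \<F> \<longleftrightarrow> (\<exists>b\<in>B. eventually P (principal (G b)))" for P
    unfolding \<F>_def
  proof (rule eventually_INF_base)
    show "B \<noteq> {}" by (auto simp: B_def intro!: exI[of _ "{}"] exI[of _ 1])
    fix a b assume "a \<in> B" "b \<in> B"
    then show "\<exists>x\<in>B. principal (G x) \<le> inf (principal (G a)) (principal (G b))"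
      by (intro bexI[of _ "(fst a \<union> fst b, min (snd a) (snd b))"]) (auto simp: B_def G_def)
  qed
  have "G b \<noteq> {}" if "b \<in> B" for b
  proof -
    obtain K \<epsilon> where b: "b = (K, \<epsilon>)" by (rule prod.exhaust)
    with that have "finite K" "\<epsilon> > 0" by (simp_all add: B_def)
    from P2_imp_almost_unit[OF P2 this] obtain u
      where "u \<in> \<A>" "A_norm u \<le> 1" "\<And>x. x \<in> K \<Longrightarrow> cmod (u x - 1) < \<epsilon>" by blast
    then have "u \<in> G b" by (simp add: b G_def)
    then show ?thesis by blast
  qed
  then have "\<F> \<noteq> bot"
    unfolding trivial_limit_def ev eventually_principal by blast
  moreover have "eventually (\<lambda>v. v \<in> \<A> \<and> A_norm v \<le> 1) \<F>"
    unfolding ev eventually_principal by (intro bexI[of _ "({}, 1)"]) (auto simp: B_def G_def)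
  moreover have "((\<lambda>v. A_norm (\<lambda>x. v x * u x - u x)) \<longlongrightarrow> 0) \<F>" if u: "u \<in> \<A>" for u
  proof (rule tendstoI)
    fix \<epsilon> :: real assume \<epsilon>: "\<epsilon> > 0"
    obtain u' where u': "finite {x. u' x \<noteq> 0}" "A_norm (\<lambda>x. u x - u' x) \<le> \<epsilon> / 4"
      using finite_support_dense[OF u, of "\<epsilon> / 4"] \<epsilon> by auto
    note u'A = finite_support_fourier[OF u'(1)]
    note dA = A_diff[OF u u'A]
    \<comment> \<open>By \<open>A_norm_finite_support\<close> the product
      \<open>\<delta> * c\<close> bounds the norm of \<open>?b\<close> below; the summand 1 keeps
      \<open>c\<close> positive for \<open>u' = 0\<close>.\<close>
    define c where "c = l2_norm lam u' / sqrt (w e) + 1"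
    have c: "c > 0" unfolding c_def by (intro add_nonneg_pos divide_nonneg_nonneg) auto
    define \<delta> where "\<delta> = \<epsilon> / (4 * c)"
    have \<delta>: "\<delta> > 0" using \<epsilon> c by (simp add: \<delta>_def)
    have *: "dist (A_norm (\<lambda>x. v x * u x - u x)) 0 < \<epsilon>" if v: "v \<in> G ({x. u' x \<noteq> 0}, \<delta>)" for v
    proof -
      have vA: "v \<in> \<A>" and v1: "A_norm v \<le> 1" and vx: "\<And>x. u' x \<noteq> 0 \<Longrightarrow> cmod (v x - 1) < \<delta>"
        using v by (auto simp: G_def)
      \<comment> \<open>Three errors of at most \<open>\<epsilon> / 4\<close>, so that their sum is
        strictly below \<open>\<epsilon>\<close>: \<open>?a\<close> by submultiplicativity,
        \<open>?b\<close> because \<open>v\<close> is close to 1 on the finite support of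
        \<open>u'\<close>, and \<open>?d\<close> by the choice of \<open>u'\<close>.\<close>
      let ?a = "\<lambda>x. v x * (u x - u' x)" and ?b = "\<lambda>x. v x * u' x - u' x"
        and ?d = "\<lambda>x. (-1) * (u x - u' x)"
      have fb: "finite {x. ?b x \<noteq> 0}" by (rule finite_subset[OF _ u'(1)]) auto
      have A: "?a \<in> \<A>" "?b \<in> \<A>" "?d \<in> \<A>"
        using A_mult[OF vA dA] finite_support_fourier[OF fb] A_diff[OF u'A u] by auto
      have bd: "(\<lambda>x. ?b x + ?d x) \<in> \<A>" using A_lin[OF A(2,3), of 1] by simp
      have "A_norm ?a \<le> A_norm v * A_norm (\<lambda>x. u x - u' x)" by (rule n_mult[OF vA dA])
      also have "\<dots> \<le> 1 * (\<epsilon> / 4)" using v1 u'(2) A_norm_nonneg[OF dA] by (intro mult_mono) auto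
      finally have 1: "A_norm ?a \<le> \<epsilon> / 4" by simp
      have "l2_norm lam ?b \<le> l2_norm lam (\<lambda>x. complex_of_real \<delta> * u' x)"
      proof (rule l2_norm_mono(2))
        show "(\<lambda>x. complex_of_real \<delta> * u' x) \<in> L2 lam" by (intro L2_scale finite_support_L2 u')
        fix x
        have "?b x = (v x - 1) * u' x" by (simp add: algebra_simps)
        moreover have "cmod (v x - 1) * cmod (u' x) \<le> \<delta> * cmod (u' x)"
          using vx[of x] by (cases "u' x = 0") (auto intro!: mult_right_mono)
        ultimately show "cmod (?b x) \<le> cmod (complex_of_real \<delta> * u' x)"
          using \<delta> by (simp add: norm_mult)
      qed simp
      then have "l2_norm lam ?b / sqrt (w e) \<le> \<delta> * (l2_norm lam u' / sqrt (w e))"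
        using \<delta> by (simp add: l2_norm_scale divide_right_mono)
      also have "\<dots> \<le> \<delta> * c" using \<delta> by (intro mult_left_mono) (auto simp: c_def)
      also have "\<dots> = \<epsilon> / 4" using c by (simp add: \<delta>_def)
      finally have 2: "A_norm ?b \<le> \<epsilon> / 4" using A_norm_finite_support[OF fb] by linarith
      have 3: "A_norm ?d \<le> \<epsilon> / 4" using n_scale[OF dA, of "-1"] u'(2) by simp
      have "(\<lambda>x. v x * u x - u x) = (\<lambda>x. ?a x + (?b x + ?d x))" by (auto simp: algebra_simps)
      then have "A_norm (\<lambda>x. v x * u x - u x) \<le> A_norm ?a + (A_norm ?b + A_norm ?d)"
        using n_add[OF A(1) bd] n_add[OF A(2,3)] by simp
      also have "\<dots> < \<epsilon>" using 1 2 3 \<epsilon> by linarith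
      finally show ?thesis using A_norm_nonneg[OF A_diff[OF A_mult[OF vA u] u]] by simp
    qed
    show "eventually (\<lambda>v. dist (A_norm (\<lambda>x. v x * u x - u x)) 0 < \<epsilon>) \<F>"
      unfolding ev eventually_principal
      using * u'(1) \<delta> by (intro bexI[of _ "({x. u' x \<noteq> 0}, \<delta>)"]) (auto simp: B_def)
  qed
  ultimately show ?thesis unfolding has_bai_def by blast
qed

text \<open>Testing the approximate identity on the indicator of {x} and evaluating at x gives
  pointwise convergence to 1. Since the norm is an infimum, the slack from \<open>D\<close> to
  \<open>D + 1\<close> makes room for an actual representing functional.\<close>

lemma bai_imp_almost_unit:
  assumes bai: "has_bai conv tilde lam D" and "finite K" "0 < \<epsilon>"
  obtains u \<phi> where "rep \<phi> u" "functional_norm lam \<V> \<phi> < D + 1" "\<And>x. x \<in> K \<Longrightarrow> cmod (u x - 1) < \<epsilon>"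
proof -
  obtain \<F> where \<F>: "\<F> \<noteq> bot" "eventually (\<lambda>v. v \<in> \<A> \<and> A_norm v \<le> D) \<F>"
      "\<And>u. u \<in> \<A> \<Longrightarrow> ((\<lambda>v. A_norm (\<lambda>x. v x * u x - u x)) \<longlongrightarrow> 0) \<F>"
    using bai unfolding has_bai_def by blast
  have "eventually (\<lambda>v. cmod (v x - 1) < \<epsilon>) \<F>" for x
  proof -
    let ?u = "\<lambda>t. if t = x then 1 else 0 :: complex"
    have "finite {t. ?u t \<noteq> 0}" by simp
    from \<F>(3)[OF finite_support_fourier[OF this]]
    have "eventually (\<lambda>v. dist (A_norm (\<lambda>t. v t * ?u t - ?u t)) 0 < \<epsilon>) \<F>"
      using \<open>0 < \<epsilon>\<close> by (rule tendstoD)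
    then show ?thesis
    proof eventually_elim
      case (elim v)
      let ?g = "\<lambda>t. v t * ?u t - ?u t"
      have "finite {t. ?g t \<noteq> 0}" by (rule finite_subset[of _ "{x}"]) auto
      from pointwise_le_A_norm[OF finite_support_fourier[OF this], of x] elim show ?case by simp
    qed
  qed
  then have "eventually (\<lambda>v. \<forall>x\<in>K. cmod (v x - 1) < \<epsilon>) \<F>"
    using \<open>finite K\<close> by (simp add: eventually_ball_finite)
  with \<F>(2) have "eventually (\<lambda>v. (v \<in> \<A> \<and> A_norm v \<le> D) \<and> (\<forall>x\<in>K. cmod (v x - 1) < \<epsilon>)) \<F>"
    by (rule eventually_conj)
  then obtain v where v: "v \<in> \<A>" "A_norm v \<le> D" "\<And>x. x \<in> K \<Longrightarrow> cmod (v x - 1) < \<epsilon>"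
    using eventually_happens'[OF \<F>(1)] by blast
  obtain \<phi> where "rep \<phi> v" "functional_norm lam \<V> \<phi> < D + 1"
    using A_norm_less[OF v(1), of "D + 1"] v(2) by auto
  with v(3) that show thesis by blast
qed

section \<open>Averages of translations and their powers\<close>

definition avg :: "'a set \<Rightarrow> ('a \<Rightarrow> real) \<Rightarrow> 'a operator" where
  "avg S p \<xi> y = (\<Sum>t\<in>S. complex_of_real (p t) * L t \<xi> y)"

definition weights :: "'a set \<Rightarrow> ('a \<Rightarrow> real) \<Rightarrow> bool" where
  "weights S p \<longleftrightarrow> finite S \<and> (\<forall>t. 0 \<le> p t) \<and> (\<Sum>t\<in>S. p t) = 1"

text \<open>The involution carries the support of a product onto that of the reversed product and so
  removes the order reversal in \<open>ltrans_ltrans\<close>.\<close>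

lemma ltrans_compose: "L s (L t f) y = (\<Sum>u\<in>supp s t. complex_of_real (coef s t u) * L u f y)"
proof -
  have "bij_betw tilde (supp s t) (supp (tilde t) (tilde s))"
    by (rule bij_betwI[of _ _ _ tilde]) (auto simp: in_supp_iff coef_tilde tilde_tilde)
  then show ?thesis unfolding ltrans_ltrans
    by (subst sum.reindex_bij_betw[symmetric]) (auto simp: coef_tilde tilde_tilde intro!: sum.cong)
qed

lemma ltrans_avg: "L s (avg S p \<xi>) y = (\<Sum>t\<in>S. complex_of_real (p t) * L s (L t \<xi>) y)"
  unfolding avg_def ltrans_sum[of s] by (simp add: sum_distrib_left mult_ac) (rule sum.swap)

lemma avg_avg:
  assumes "weights S p" "weights R q"
  obtains U r where "weights U r" "avg U r = (\<lambda>\<xi>. avg S p (avg R q \<xi>))"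
proof -
  define U where "U = (\<Union>s\<in>S. \<Union>t\<in>R. supp s t)"
  \<comment> \<open>The point weights of the convolution of the two probability measures.\<close>
  define r where "r u = (\<Sum>s\<in>S. \<Sum>t\<in>R. p s * q t * coef s t u)" for u
  have fin: "finite S" "finite R" "finite U"
    using assms by (auto simp: weights_def U_def finite_msupport)
  have 1: "(\<Sum>u\<in>U. coef s t u) = 1" if "s \<in> S" "t \<in> R" for s t
  proof -
    have "(\<Sum>u\<in>U. coef s t u) = (\<Sum>u\<in>supp s t. coef s t u)"
      using that fin by (intro sum.mono_neutral_right) (auto simp: U_def in_supp_iff)
    then show ?thesis by (simp add: sum_coef)
  qed
  have "(\<Sum>u\<in>U. r u) = (\<Sum>s\<in>S. \<Sum>t\<in>R. p s * q t * (\<Sum>u\<in>U. coef s t u))"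
    unfolding r_def by (subst sum.swap, rule sum.cong, simp, subst sum.swap) (simp add: sum_distrib_left)
  also have "\<dots> = (\<Sum>s\<in>S. \<Sum>t\<in>R. p s * q t)" by (intro sum.cong refl) (simp add: 1)
  also have "\<dots> = 1" using assms by (simp add: weights_def flip: sum_distrib_left)
  finally have "weights U r"
    using fin assms by (auto simp: weights_def r_def intro!: sum_nonneg)
  moreover have "avg U r \<xi> y = avg S p (avg R q \<xi>) y" for \<xi> y
  proof -
    have "avg S p (avg R q \<xi>) y =
        (\<Sum>s\<in>S. \<Sum>t\<in>R. complex_of_real (p s * q t) * L s (L t \<xi>) y)"
      unfolding avg_def[of S] ltrans_avg by (simp add: sum_distrib_left mult_ac)
    also have "\<dots> = (\<Sum>s\<in>S. \<Sum>t\<in>R. \<Sum>u\<in>U. complex_of_real (p s * q t * coef s t u) * L u \<xi> y)"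
    proof (intro sum.cong refl)
      fix s t assume "s \<in> S" "t \<in> R"
      then have "L s (L t \<xi>) y = (\<Sum>u\<in>U. complex_of_real (coef s t u) * L u \<xi> y)"
        unfolding ltrans_compose using fin by (intro sum.mono_neutral_left) (auto simp: U_def in_supp_iff)
      then show "complex_of_real (p s * q t) * L s (L t \<xi>) y =
          (\<Sum>u\<in>U. complex_of_real (p s * q t * coef s t u) * L u \<xi> y)"
        by (simp add: sum_distrib_left mult_ac)
    qed
    also have "\<dots> = (\<Sum>u\<in>U. \<Sum>s\<in>S. \<Sum>t\<in>R. complex_of_real (p s * q t * coef s t u) * L u \<xi> y)"
      by (subst (2) sum.swap, subst sum.swap) (rule refl)
    also have "\<dots> = avg U r \<xi> y"
      unfolding avg_def r_def by (simp add: sum_distrib_right)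
    finally show ?thesis ..
  qed
  ultimately show thesis using that[of U r] by blast
qed

lemma avg_power:
  assumes "weights S p"
  shows "\<exists>U r. weights U r \<and> avg U r = (avg S p ^^ n)"
proof (induction n)
  case 0
  have "weights {e} (\<lambda>_. 1)" by (simp add: weights_def)
  moreover have "avg {e} (\<lambda>_. 1) = (avg S p ^^ 0)" by (simp add: avg_def fun_eq_iff)
  ultimately show ?case by blast
next
  case (Suc n)
  then obtain U r where U: "weights U r" "avg U r = (avg S p ^^ n)" by blast
  obtain V q where "weights V q" "avg V q = (\<lambda>\<xi>. avg S p (avg U r \<xi>))"
    using avg_avg[OF assms U(1)] .
  then show ?case by (intro exI[of _ V] exI[of _ q]) (auto simp: U(2) fun_eq_iff)
qed

text \<open>Dividing by \<open>w t\<close> compensates the Haar mass of the point, so a multiple of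
  the average is a convolution operator and lies in \<open>VN\<close>. The factor \<open>c\<close>
  serves to rescale powers of an average.\<close>

lemma
  assumes "weights S p"
  shows avg_density_integrable: "integrable lam (\<lambda>t. if t \<in> S then complex_of_real (c * p t / w t) else 0)"
    and integral_avg_density: "(\<integral>t. (if t \<in> S then complex_of_real (c * p t / w t) else 0) * g t \<partial>lam) =
      complex_of_real c * (\<Sum>t\<in>S. complex_of_real (p t) * g t)"
proof -
  have S: "finite S" using assms by (simp add: weights_def)
  show "integrable lam (\<lambda>t. if t \<in> S then complex_of_real (c * p t / w t) else 0)"
    by (rule integrable_finite[OF S]) auto
  show "(\<integral>t. (if t \<in> S then complex_of_real (c * p t / w t) else 0) * g t \<partial>lam) =
      complex_of_real c * (\<Sum>t\<in>S. complex_of_real (p t) * g t)"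
    by (subst integral_finite[OF S]) (auto simp: scaleR_conv_of_real sum_distrib_left mult_ac intro!: sum.cong)
qed

lemma hconv_avg_density:
  "weights S p \<Longrightarrow> H (\<lambda>t. if t \<in> S then complex_of_real (c * p t / w t) else 0) \<xi> y =
    complex_of_real c * avg S p \<xi> y"
  unfolding hconv_def avg_def by (rule integral_avg_density)

lemma
  assumes p: "weights S p" and \<xi>: "\<xi> \<in> L2 lam"
  shows avg_L2: "avg S p \<xi> \<in> L2 lam" and l2_norm_avg_le: "l2_norm lam (avg S p \<xi>) \<le> l2_norm lam \<xi>"
proof -
  let ?f = "\<lambda>t. if t \<in> S then complex_of_real (1 * p t / w t) else 0"
  have S: "finite S" using p by (simp add: weights_def)
  have i: "integrable lam ?f" by (rule avg_density_integrable[OF p])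
  have H: "H ?f \<xi> = avg S p \<xi>" by (rule ext) (simp only: hconv_avg_density[OF p], simp)
  show "avg S p \<xi> \<in> L2 lam" using hconv_L2[OF i \<xi>] unfolding H .
  have "(\<integral>t. cmod (?f t) \<partial>lam) = (\<Sum>t\<in>S. p t)"
    by (subst integral_finite[OF S]) (use p in \<open>auto simp: weights_def norm_divide intro!: sum.cong\<close>)
  then show "l2_norm lam (avg S p \<xi>) \<le> l2_norm lam \<xi>"
    using l2_norm_hconv_le[OF i \<xi>] p unfolding H by (simp add: weights_def)
qed

text \<open>If the average contracted every vector by \<open>r\<close>, its n-th power times
  \<open>c = 1 / r ^ n\<close> would stay in the unit ball. Pairing with a function near 1 would
  give at least c / 2 but less than D + 1, which fails for large n.\<close>

lemma bai_imp_avg_norm: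
  assumes bai: "has_bai conv tilde lam D" and D: "1 \<le> D" and p: "weights S p" and r: "0 < r" "r < 1"
  obtains \<xi> where "\<xi> \<in> L2 lam" "r * l2_norm lam \<xi> < l2_norm lam (avg S p \<xi>)"
proof (rule ccontr)
  assume "\<not> thesis"
  with that have le: "l2_norm lam (avg S p \<xi>) \<le> r * l2_norm lam \<xi>" if "\<xi> \<in> L2 lam" for \<xi>
    using that by force
  have pow: "(avg S p ^^ n) \<xi> \<in> L2 lam \<and> l2_norm lam ((avg S p ^^ n) \<xi>) \<le> r ^ n * l2_norm lam \<xi>"
    if "\<xi> \<in> L2 lam" for n \<xi>
  proof (induction n)
    case (Suc n)
    have "l2_norm lam (avg S p ((avg S p ^^ n) \<xi>)) \<le> r * (r ^ n * l2_norm lam \<xi>)"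
      using le[of "(avg S p ^^ n) \<xi>"] Suc r by (smt (verit) mult_left_mono)
    then show ?case using Suc avg_L2[OF p] by (simp add: mult.assoc)
  qed (use that in simp)
  \<comment> \<open>\<open>D + 1\<close> bounds the functional and the 2 comes from the accuracy 1 /
    2. Choosing \<open>n\<close> before the unit fixes the finite set \<open>U\<close> on which the
    unit has to be close to 1.\<close>
  have "1 / (2 * (D + 1)) > 0" using D by simp
  then obtain n where n: "r ^ n < 1 / (2 * (D + 1))" using real_arch_pow_inv r by blast
  obtain U q where U: "weights U q" "avg U q = (avg S p ^^ n)" using avg_power[OF p] by blast
  obtain u \<phi> where u: "rep \<phi> u" "functional_norm lam \<V> \<phi> < D + 1" "\<And>x. x \<in> U \<Longrightarrow> cmod (u x - 1) < 1 / 2"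
  proof -
    have "finite U" "(0 :: real) < 1 / 2" using U(1) by (auto simp: weights_def)
    then show thesis by (rule bai_imp_almost_unit[OF bai]) (rule that)
  qed
  define c where "c = 1 / r ^ n"
  have c: "c > 0" "c * r ^ n = 1" using r by (auto simp: c_def)
  let ?f = "\<lambda>t. if t \<in> U then complex_of_real (c * q t / w t) else 0"
  have Hf: "H ?f \<xi> = (\<lambda>y. complex_of_real c * (avg S p ^^ n) \<xi> y)" for \<xi>
    by (rule ext) (simp only: hconv_avg_density[OF U(1)] U(2))
  have "op_norm lam (H ?f) \<le> 1"
  proof (rule op_norm_leI)
    fix \<xi> assume \<xi>: "\<xi> \<in> L2 lam" "l2_norm lam \<xi> \<le> 1"
    have "l2_norm lam (H ?f \<xi>) = c * l2_norm lam ((avg S p ^^ n) \<xi>)"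
      unfolding Hf l2_norm_scale using c by simp
    also have "\<dots> \<le> c * (r ^ n * l2_norm lam \<xi>)" using pow[OF \<xi>(1), of n] c by (intro mult_left_mono) auto
    also have "\<dots> = l2_norm lam \<xi>" using c(2) by (simp add: mult.assoc[symmetric])
    finally show "l2_norm lam (H ?f \<xi>) \<le> 1" using \<xi>(2) by simp
  qed
  from pairing_bound[OF u(1) avg_density_integrable[OF U(1)] this]
  have "c * cmod (\<Sum>t\<in>U. complex_of_real (q t) * u t) < D + 1"
    using u(2) c unfolding integral_avg_density[OF U(1)] by (simp add: norm_mult)
  \<comment> \<open>A convex combination of values within 1 / 2 of 1 is itself within 1 / 2 of
    1.\<close>
  moreover have "1 / 2 \<le> cmod (\<Sum>t\<in>U. complex_of_real (q t) * u t)"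
  proof -
    have "(\<Sum>t\<in>U. complex_of_real (q t)) = 1"
      using U(1) by (simp add: weights_def flip: of_real_sum)
    then have "1 - (\<Sum>t\<in>U. complex_of_real (q t) * u t) = (\<Sum>t\<in>U. complex_of_real (q t) * (1 - u t))"
      by (simp add: algebra_simps sum_subtractf)
    also have "cmod \<dots> \<le> (\<Sum>t\<in>U. q t * (1 / 2))"
    proof (rule sum_norm_le)
      fix t assume "t \<in> U"
      then show "cmod (complex_of_real (q t) * (1 - u t)) \<le> q t * (1 / 2)"
        using U(1) mult_left_mono[of "cmod (1 - u t)" "1 / 2" "q t"] u(3)[of t]
        by (simp add: norm_mult weights_def norm_minus_commute)
    qed
    also have "\<dots> = 1 / 2" using U(1) by (simp add: weights_def flip: sum_divide_distrib)
    finally show ?thesis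
      using norm_triangle_ineq2[of 1 "\<Sum>t\<in>U. complex_of_real (q t) * u t"] by simp
  qed
  ultimately have "c * (1 / 2) < D + 1"
    using c(1) by (meson mult_left_mono less_imp_le order_le_less_trans)
  then have "c * r ^ n * (1 / 2) < (D + 1) * r ^ n" using r by (simp add: mult.commute mult.left_commute)
  also have "\<dots> < (D + 1) * (1 / (2 * (D + 1)))" using n D by (intro mult_strict_left_mono) auto
  also have "\<dots> = 1 / 2" using D by simp
  finally show False using c(2) by simp
qed

lemma bai_imp_P2:
  assumes bai: "has_bai conv tilde lam D" and D: "1 \<le> D"
  shows "property_P2 conv tilde lam"
  unfolding property_P2_def
proof (intro allI impI)
  fix \<epsilon> :: real and K :: "'a set"
  assume \<epsilon>: "\<epsilon> > 0" and "compact K"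
  \<comment> \<open>Including \<open>e\<close> also keeps \<open>S\<close> nonempty, so uniform
    weights exist even for empty \<open>K\<close>.\<close>
  define S where "S = insert e K"
  define m where "m = real (card S)"
  define p where "p = (\<lambda>t :: 'a. 1 / m)"
  have S: "finite S" "S \<noteq> {}" using \<open>compact K\<close> by (auto simp: S_def)
  then have m: "m > 0" by (simp add: m_def card_gt_0_iff)
  have p: "weights S p" using S m by (simp add: weights_def p_def m_def)
  \<comment> \<open>The variance will be at most \<open>1 - r\<^sup>2 = \<kappa>\<close>. Each of
    its terms has weight 1 / m, so \<open>m * \<kappa>\<close> must not exceed the square of
    \<open>\<epsilon> / 4\<close>; the cap 1 / 2 keeps \<open>r\<close> positive.\<close>
  define \<kappa> where "\<kappa> = min (1 / 2) (\<epsilon>\<^sup>2 / (16 * m))"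
  have \<kappa>: "\<kappa> > 0" "\<kappa> < 1" "m * \<kappa> \<le> \<epsilon>\<^sup>2 / 16" using \<epsilon> m by (auto simp: \<kappa>_def field_simps min_def)
  define r where "r = sqrt (1 - \<kappa>)"
  have r: "0 < r" "r < 1" "r\<^sup>2 = 1 - \<kappa>" using \<kappa> by (auto simp: r_def)
  obtain \<xi>0 where \<xi>0: "\<xi>0 \<in> L2 lam" "r * l2_norm lam \<xi>0 < l2_norm lam (avg S p \<xi>0)"
    using bai_imp_avg_norm[OF bai D p r(1,2)] .
  define N where "N = l2_norm lam \<xi>0"
  have N: "N > 0"
  proof -
    have "N \<noteq> 0" using \<xi>0(2) l2_norm_avg_le[OF p \<xi>0(1)] by (auto simp: N_def)
    then show ?thesis by (simp add: N_def less_le)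
  qed
  \<comment> \<open>The kernels are nonnegative, so taking absolute values does not decrease the
    norm of the average. It also makes all translates real, as \<open>weighted_variance\<close>
    requires.\<close>
  define \<xi> where "\<xi> = (\<lambda>t. cmod (\<xi>0 t) / N)"
  define \<xi>' where "\<xi>' = (\<lambda>t. complex_of_real (\<xi> t))"
  have \<xi>'_eq: "\<xi>' = (\<lambda>t. complex_of_real (1 / N) * complex_of_real (cmod (\<xi>0 t)))"
    by (auto simp: \<xi>'_def \<xi>_def)
  have abs_L2: "(\<lambda>t. complex_of_real (cmod (\<xi>0 t))) \<in> L2 lam"
    by (rule l2_norm_mono(1)[OF \<xi>0(1)]) auto
  have \<xi>'_L2: "\<xi>' \<in> L2 lam" unfolding \<xi>'_eq by (rule L2_scale[OF abs_L2])
  have \<xi>'_norm: "l2_norm lam \<xi>' = 1"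
  proof -
    have "l2_norm lam (\<lambda>t. complex_of_real (cmod (\<xi>0 t))) = N" by (simp add: l2_norm_def N_def)
    then show ?thesis unfolding \<xi>'_eq l2_norm_scale using N by (simp add: norm_divide)
  qed
  define l where "l = (\<lambda>t y. \<Sum>z\<in>supp (tilde t) y. coef (tilde t) y z * \<xi> z)"
  define a where "a = (\<lambda>y. \<Sum>t\<in>S. p t * l t y)"
  have l: "L t \<xi>' y = complex_of_real (l t y)" for t y
    by (simp add: ltrans_sum l_def \<xi>'_def)
  have a: "avg S p \<xi>' y = complex_of_real (a y)" for y
    by (simp add: avg_def a_def l)
  have r_le: "r \<le> l2_norm lam (avg S p \<xi>')"
  proof -
    have "l2_norm lam (avg S p \<xi>0) \<le> l2_norm lam (\<lambda>y. complex_of_real N * avg S p \<xi>' y)"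
    proof (rule l2_norm_mono(2)[OF L2_scale[OF avg_L2[OF p \<xi>'_L2]]])
      fix y
      have "cmod (avg S p \<xi>0 y) \<le> (\<Sum>t\<in>S. p t * cmod (L t \<xi>0 y))"
        unfolding avg_def by (rule order_trans[OF norm_sum]) (use p in \<open>simp add: norm_mult weights_def\<close>)
      also have "\<dots> \<le> (\<Sum>t\<in>S. p t * (N * l t y))"
      proof (intro sum_mono mult_left_mono)
        fix t
        have "N * l t y = (\<Sum>z\<in>supp (tilde t) y. coef (tilde t) y z * cmod (\<xi>0 z))"
          using N by (simp add: l_def \<xi>_def sum_distrib_left)
        then show "cmod (L t \<xi>0 y) \<le> N * l t y" using cmod_ltrans_le[of t \<xi>0 y] by simp
      qed (use p in \<open>simp add: weights_def\<close>)
      also have "\<dots> = N * a y" by (simp add: a_def sum_distrib_left mult_ac)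
      also have "\<dots> \<le> cmod (complex_of_real N * avg S p \<xi>' y)"
        unfolding a using N by (simp add: norm_mult)
      finally show "cmod (avg S p \<xi>0 y) \<le> cmod (complex_of_real N * avg S p \<xi>' y)" .
    qed simp
    also have "\<dots> = N * l2_norm lam (avg S p \<xi>')" unfolding l2_norm_scale using N by simp
    finally have "N * r < N * l2_norm lam (avg S p \<xi>')" using \<xi>0(2) by (simp add: N_def mult.commute)
    then show ?thesis using N by simp
  qed
  have dL: "(\<lambda>y. L t \<xi>' y - avg S p \<xi>' y) \<in> L2 lam" for t
    by (intro L2_diff ltrans_L2 avg_L2 p \<xi>'_L2)
  \<comment> \<open>The pointwise variance identity integrated over \<open>y\<close>: the mean
    square distance to the average is the mean of the square norms minus the square norm of the
    average. This is uniform convexity in quantitative form.\<close>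
  have "(\<Sum>t\<in>S. p t * (l2_norm lam (\<lambda>y. L t \<xi>' y - avg S p \<xi>' y))\<^sup>2) =
      (\<integral>y. (\<Sum>t\<in>S. p t * (cmod (L t \<xi>' y - avg S p \<xi>' y))\<^sup>2) \<partial>lam)"
    unfolding l2_norm_sq using L2_integrable[OF dL] by (subst Bochner_Integration.integral_sum) auto
  also have "\<dots> = (\<integral>y. (\<Sum>t\<in>S. p t * (cmod (L t \<xi>' y))\<^sup>2) - (cmod (avg S p \<xi>' y))\<^sup>2 \<partial>lam)"
  proof (intro Bochner_Integration.integral_cong refl)
    fix y
    have cmod_diff: "(cmod (complex_of_real b - complex_of_real b'))\<^sup>2 = (b - b')\<^sup>2" for b b'
      by (simp flip: of_real_diff)
    show "(\<Sum>t\<in>S. p t * (cmod (L t \<xi>' y - avg S p \<xi>' y))\<^sup>2) =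
        (\<Sum>t\<in>S. p t * (cmod (L t \<xi>' y))\<^sup>2) - (cmod (avg S p \<xi>' y))\<^sup>2"
      using weighted_variance[of p S "\<lambda>t. l t y"] p
      unfolding l a cmod_diff norm_of_real power2_abs a_def weights_def by simp
  qed
  also have "\<dots> = (\<Sum>t\<in>S. p t * (l2_norm lam (L t \<xi>'))\<^sup>2) - (l2_norm lam (avg S p \<xi>'))\<^sup>2"
    unfolding l2_norm_sq
    using L2_integrable[OF ltrans_L2[OF \<xi>'_L2]] L2_integrable[OF avg_L2[OF p \<xi>'_L2]]
    by (subst Bochner_Integration.integral_diff) (auto simp: Bochner_Integration.integral_sum)
  also have "\<dots> \<le> (\<Sum>t\<in>S. p t * 1) - r\<^sup>2"
  proof (intro diff_mono sum_mono mult_left_mono power_mono r_le)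
    fix t
    show "(l2_norm lam (L t \<xi>'))\<^sup>2 \<le> 1"
      using l2_norm_ltrans_le[OF \<xi>'_L2, of t] \<xi>'_norm by (simp add: power_le_one)
  qed (use r p in \<open>auto simp: weights_def\<close>)
  also have "\<dots> = \<kappa>" using p r by (simp add: weights_def)
  finally have var: "(\<Sum>t\<in>S. p t * (l2_norm lam (\<lambda>y. L t \<xi>' y - avg S p \<xi>' y))\<^sup>2) \<le> \<kappa>" .
  have close: "l2_norm lam (\<lambda>y. L t \<xi>' y - avg S p \<xi>' y) \<le> \<epsilon> / 4" if "t \<in> S" for t
  proof -
    have "p t * (l2_norm lam (\<lambda>y. L t \<xi>' y - avg S p \<xi>' y))\<^sup>2 \<le>
        (\<Sum>t\<in>S. p t * (l2_norm lam (\<lambda>y. L t \<xi>' y - avg S p \<xi>' y))\<^sup>2)"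
      using that S p by (intro member_le_sum) (auto simp: weights_def)
    then have "p t * (l2_norm lam (\<lambda>y. L t \<xi>' y - avg S p \<xi>' y))\<^sup>2 \<le> \<kappa>"
      using var by (rule order_trans)
    moreover have "p t = 1 / m" by (simp add: p_def)
    ultimately have "(l2_norm lam (\<lambda>y. L t \<xi>' y - avg S p \<xi>' y))\<^sup>2 / m \<le> \<kappa>" by simp
    then have "(l2_norm lam (\<lambda>y. L t \<xi>' y - avg S p \<xi>' y))\<^sup>2 \<le> m * \<kappa>"
      unfolding pos_divide_le_eq[OF m] by (simp only: mult.commute)
    also have "\<dots> \<le> (\<epsilon> / 4)\<^sup>2" using \<kappa>(3) by (simp add: power_divide)
    finally show ?thesis by (rule power2_le_imp_le) (use \<epsilon> in simp)
  qed
  have "l2_norm lam (\<lambda>y. L x \<xi>' y - \<xi>' y) < \<epsilon>" if "x \<in> K" for x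
  proof -
    let ?d = "\<lambda>t y. L t \<xi>' y - avg S p \<xi>' y"
    have "l2_norm lam (\<lambda>y. ?d x y + (-1) * ?d e y) \<le> l2_norm lam (?d x) + l2_norm lam (\<lambda>y. (-1) * ?d e y)"
      by (rule l2_norm_triangle[OF dL L2_scale[OF dL]])
    also have "\<dots> \<le> \<epsilon> / 4 + \<epsilon> / 4"
      unfolding l2_norm_scale using close[of x] close[of e] that by (simp add: S_def)
    also have "\<dots> < \<epsilon>" using \<epsilon> by simp
    finally show ?thesis by simp
  qed
  moreover have "\<forall>t. \<xi> t \<ge> 0" using N by (simp add: \<xi>_def)
  ultimately show "\<exists>\<xi> :: 'a \<Rightarrow> real. (\<forall>t. \<xi> t \<ge> 0) \<and>
     (let \<xi>' = (\<lambda>t. complex_of_real (\<xi> t)) in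
       \<xi>' \<in> L2 lam \<and> l2_norm lam \<xi>' = 1 \<and>
       (\<forall>x\<in>K. l2_norm lam (\<lambda>t. L x \<xi>' t - \<xi>' t) < \<epsilon>))"
    using \<xi>'_L2 \<xi>'_norm unfolding \<xi>'_def Let_def by blast
qed

end

theorem theorem3p3:
  fixes conv :: "'a::t2_space convolution"
    and tilde :: "'a \<Rightarrow> 'a"
    and e :: 'a
    and lam :: "'a measure"
  assumes "discrete_hypergroup conv tilde e"
    and "left_haar_measure conv tilde lam"
    and "regular_fourier conv tilde lam"
  shows "(has_bai conv tilde lam 1 \<longleftrightarrow> (\<exists>D\<ge>1. has_bai conv tilde lam D)) \<and>
    ((\<exists>D\<ge>1. has_bai conv tilde lam D) \<longleftrightarrow> property_P2 conv tilde lam)"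
proof -
  interpret discrete_hypergroup conv tilde e by (rule assms(1))
  interpret discrete_haar conv tilde e lam by unfold_locales (rule assms(2))
  show ?thesis using P2_imp_bai[OF _ assms(3)] bai_imp_P2 order_refl by blast
qed

end
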